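(* Let $\ell\ge1$ and $k\in[1,\ell-1]$. Applying the coking elimination operation with respect to the vertex $k$ (a coking of the induced subgraph $C_\ell^k[[k,\ell]]$, the vertices $1,\dots,k-1$ being isolated and their weights unchanged) to $(C_\ell^k,\psi_\ell^k)$ yields $(D_\ell^k,\phi_\ell^k)$, and applying the king elimination operation with respect to the vertex $k$ (a king of $D_\ell^k[[k,\ell]]$, the vertices $1,\dots,k-1$ being isolated and their weights unchanged) to $(D_\ell^k,\phi_\ell^k)$ yields $(C_\ell^{k+1},\psi_\ell^{k+1})$. These operations preserve both the characteristic polynomial of the $\psi$-digraphical arrangement and the freeness of its cone; thus the sequence starting from $(C_\ell^1,\psi_\ell^1)$ (for which $\mathcal{A}(C_\ell^1,\psi_\ell^1)\times\Phi_1$ is affinely equivalent to the Catalan arrangement $\mathrm{Cat}(\ell+1)$) ends with $(C_\ell^\ell,\psi_\ell^\ell)$, whose digraph is edgeless and whose arrangement has supersolvable cone. In particular, for every $n\ge 2$ the cone $\mathbf{c}\mathrm{Cat}(n)$ is free with exponents $\{0,1,n+1,n+2,\dots,2n-1\}$.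
   Context: $[a,b]=\{n\in\mathbb{Z}:a\le n\le b\}$. For $k\in[1,\ell]$, vertex-weighted digraphs on $[1,\ell]$: $E_{C_\ell^k}=\{(i,j):i,j\in[k,\ell],i\ne j\}$, $\psi_\ell^k(i)=[-\min\{i,k\},\min\{i,k\}]$; $E_{D_\ell^k}=\{(k,i):i\in[k+1,\ell]\}\cup\{(i,j):i,j\in[k+1,\ell],i\ne j\}$, $\phi_\ell^k(i)=[-\min\{i,k\},\min\{i,k\}]$ for $i\le k$ and $\phi_\ell^k(i)=[-\min\{i,k\}-1,\min\{i,k\}]$ for $i>k$. For a vertex-weighted digraph $(G,\psi)$ with $\psi(i)=[a_i,b_i]$, $\mathcal{A}(G,\psi)$ is the arrangement in $\mathbb{R}^\ell$ of $x_i-x_j=0$ ($i<j$), $x_i-x_j=1$ ($(i,j)\in E_G$), $x_i=c$ ($c\in\psi(i)$); its cone adds a coordinate $z$, consists of $z=0$ and the homogenized hyperplanes $x_i-x_j=0$, $x_i-x_j=z$, $x_i=cz$. A coking (king) $v$ has $(u,v)\in E_G$ (resp. $(v,u)\in E_G$) for all other $u$; coking elimination removes all $(i,v)$ and replaces $\psi(i)$ by $[a_i-1,b_i]$ for $i\ne v$; king elimination removes all $(v,i)$ and replaces $\psi(i)$ by $[a_i,b_i+1]$ for $i\ne v$. $\Phi_1$ is the empty arrangement in $\mathbb{R}$. $\mathrm{Cat}(n)$ is the arrangement in $\mathbb{R}^n$ of $x_i-x_j\in\{-1,0,1\}$, $1\le i<j\le n$. Characteristic polynomial $\chi_{\mathcal{A}}(t)=\sum_{X\in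 L(\mathcal{A})}\mu(X)t^{\dim X}$; a central arrangement is free with exponents $d_1,\dots,d_N$ if $D(\mathcal{A})=\{\theta\in\mathrm{Der}(S):\theta(\alpha_H)\in\alpha_HS\}$ is free over the polynomial ring $S$ with homogeneous basis of degrees $d_1,\dots,d_N$; supersolvable means the intersection lattice has a maximal chain of modular elements. *)

theory Defs
  imports "HOL-Analysis.Analysis" "HOL-Analysis.Finite_Function_Topology"
    "HOL-Computational_Algebra.Polynomial"
    "HOL-Library.Multiset" "HOL-Library.FuncSet"
begin

section \<open>Hyperplane arrangements\<close>

text \<open>
  For a finite set \<open>I\<close> of coordinates, the space \<open>\<real>\<^sup>I\<close> consists of the finitely supported
  functions whose support lies in \<open>I\<close>. An arrangement remembers its set of coordinates, since
  the ambient space cannot be recovered from the hyperplanes if there are none.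
\<close>

definition rspace :: "'v set \<Rightarrow> ('v \<Rightarrow>\<^sub>0 real) set" where
  "rspace I = {x. Poly_Mapping.keys x \<subseteq> I}"

record 'v arrangement =
  coords :: "'v set"
  hyps :: "('v \<Rightarrow>\<^sub>0 real) set set"

abbreviation ambient :: "'v arrangement \<Rightarrow> ('v \<Rightarrow>\<^sub>0 real) set" where
  "ambient A \<equiv> rspace (coords A)"

definition hyperplane :: "'v set \<Rightarrow> ('v \<Rightarrow>\<^sub>0 real) \<Rightarrow> real \<Rightarrow> ('v \<Rightarrow>\<^sub>0 real) set" where
  "hyperplane I a c =
     {x \<in> rspace I. (\<Sum>i\<in>I. Poly_Mapping.lookup a i * Poly_Mapping.lookup x i) = c}"

definition central :: "'v arrangement \<Rightarrow> bool" where
  "central A \<longleftrightarrow> (\<forall>H\<in>hyps A. 0 \<in> H)"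

text \<open>
  The new coordinate \<open>z\<close> of the cone is \<open>None\<close>. The equation of a hyperplane is unique up to a
  nonzero factor, so each hyperplane contributes exactly one homogenized hyperplane.
\<close>

definition cone_coords :: "'v set \<Rightarrow> 'v option set" where
  "cone_coords I = insert None (Some ` I)"

definition arr_cone :: "'v arrangement \<Rightarrow> 'v option arrangement" where
  "arr_cone A = \<lparr> coords = cone_coords (coords A),
     hyps = insert {y \<in> rspace (cone_coords (coords A)). Poly_Mapping.lookup y None = 0}
       {{y \<in> rspace (cone_coords (coords A)).
           (\<Sum>i\<in>coords A. Poly_Mapping.lookup a i * Poly_Mapping.lookup y (Some i))
             = c * Poly_Mapping.lookup y None}
        | a c. a \<in> ambient A \<and> a \<noteq> 0 \<and> hyperplane (coords A) a c \<in> hyps A} \<rparr>"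

definition arr_prod :: "'v arrangement \<Rightarrow> 'w arrangement \<Rightarrow> ('v + 'w) arrangement" where
  "arr_prod A B = \<lparr> coords = coords A <+> coords B,
     hyps = {{x \<in> rspace (coords A <+> coords B). Poly_Mapping.map_key Inl x \<in> H} | H. H \<in> hyps A}
          \<union> {{x \<in> rspace (coords A <+> coords B). Poly_Mapping.map_key Inr x \<in> H} | H. H \<in> hyps B} \<rparr>"

definition Phi1 :: "unit arrangement" where
  "Phi1 = \<lparr> coords = UNIV, hyps = {} \<rparr>"

definition affinely_equivalent :: "'v arrangement \<Rightarrow> 'w arrangement \<Rightarrow> bool" where
  "affinely_equivalent A B \<longleftrightarrow>
     (\<exists>f c. linear f \<and> bij_betw (\<lambda>x. f x + c) (ambient A) (ambient B)
        \<and> (\<lambda>H. (\<lambda>x. f x + c) ` H) ` hyps A = hyps B)"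

subsection \<open>Intersection poset and characteristic polynomial\<close>

text \<open>The intersection poset is ordered by reverse inclusion; its least element is the ambient space.\<close>

definition flats :: "'v arrangement \<Rightarrow> ('v \<Rightarrow>\<^sub>0 real) set set" where
  "flats A = {ambient A \<inter> \<Inter>B | B. B \<subseteq> hyps A} - {{}}"

definition flat_dim :: "('v \<Rightarrow>\<^sub>0 real) set \<Rightarrow> nat" where
  "flat_dim X = dim {x - y | x y. x \<in> X \<and> y \<in> X}"

text \<open>
  \<open>moebius L V X\<close> is the value \<open>\<mu>(V, X)\<close> of the Moebius function of a finite family \<open>L\<close> of sets
  ordered by reverse inclusion with least element \<open>V\<close>.
\<close>

function moebius :: "'a set set \<Rightarrow> 'a set \<Rightarrow> 'a set \<Rightarrow> int" where
  "moebius L V X =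
     (if \<not> finite L then 0
      else if X = V then 1
      else - (\<Sum>Y\<in>{Y \<in> L. X \<subset> Y}. moebius L V Y))"
  by pat_completeness auto
termination
proof (relation "Wellfounded.measure (\<lambda>(L, V, X). card {Y \<in> L. X \<subset> Y})")
  fix L :: "'a set set" and V X Y :: "'a set"
  assume "\<not> \<not> finite L" and Y: "Y \<in> {Y \<in> L. X \<subset> Y}"
  then have "finite {Y \<in> L. X \<subset> Y}" by simp
  moreover have "{Z \<in> L. Y \<subset> Z} \<subset> {Y \<in> L. X \<subset> Y}" using Y by blast
  ultimately show "((L, V, Y), (L, V, X)) \<in> Wellfounded.measure (\<lambda>(L, V, X). card {Y \<in> L. X \<subset> Y})"
    by (simp add: psubset_card_mono)
qed simp

declare moebius.simps [simp del]

definition arr_char_poly :: "'v arrangement \<Rightarrow> int poly" where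
  "arr_char_poly A = (\<Sum>X\<in>flats A. monom (moebius (flats A) (ambient A) X) (flat_dim X))"

subsection \<open>Supersolvability\<close>

text \<open>
  In the intersection lattice of a central arrangement the join of two flats is their intersection
  and their meet is the smallest flat containing both. A flat \<open>X\<close> is modular if
  \<open>Z \<or> (X \<and> Y) = (Z \<or> X) \<and> Y\<close> for all flats \<open>Z \<le> Y\<close>.
\<close>

definition flat_meet :: "'a set set \<Rightarrow> 'a set \<Rightarrow> 'a set \<Rightarrow> 'a set" where
  "flat_meet L X Y = \<Inter>{Z \<in> L. X \<union> Y \<subseteq> Z}"

definition modular_flat :: "'a set set \<Rightarrow> 'a set \<Rightarrow> bool" where
  "modular_flat L X \<longleftrightarrow> X \<in> L \<and>
     (\<forall>Y\<in>L. \<forall>Z\<in>L. Y \<subseteq> Z \<longrightarrow> Z \<inter> flat_meet L X Y = flat_meet L (Z \<inter> X) Y)"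

definition supersolvable :: "'v arrangement \<Rightarrow> bool" where
  "supersolvable A \<longleftrightarrow> central A \<and>
     (\<exists>C. subset.maxchain (flats A) C \<and> (\<forall>X\<in>C. modular_flat (flats A) X))"

subsection \<open>Logarithmic derivations and freeness\<close>

type_synonym 'v rpoly = "('v \<Rightarrow>\<^sub>0 nat) \<Rightarrow>\<^sub>0 real"

definition poly_ring :: "'v set \<Rightarrow> 'v rpoly set" where
  "poly_ring I = {p. \<forall>m\<in>Poly_Mapping.keys p. Poly_Mapping.keys m \<subseteq> I}"

definition poly_var :: "'v \<Rightarrow> 'v rpoly" where
  "poly_var i = Poly_Mapping.single (Poly_Mapping.single i 1) 1"

definition linear_form :: "'v set \<Rightarrow> ('v \<Rightarrow>\<^sub>0 real) \<Rightarrow> 'v rpoly" where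
  "linear_form I a = (\<Sum>i\<in>I. Poly_Mapping.lookup a i *\<^sub>R poly_var i)"

definition homogeneous_poly :: "nat \<Rightarrow> 'v rpoly \<Rightarrow> bool" where
  "homogeneous_poly d p \<longleftrightarrow>
     (\<forall>m\<in>Poly_Mapping.keys p. (\<Sum>i\<in>Poly_Mapping.keys m. Poly_Mapping.lookup m i) = d)"

text \<open>
  A derivation of \<open>S = poly_ring I\<close> is a map on \<open>S\<close>; outside \<open>S\<close> it is fixed to be zero so that equality
  of functions is equality of derivations.
\<close>

definition derivations :: "'v set \<Rightarrow> ('v rpoly \<Rightarrow> 'v rpoly) set" where
  "derivations I = {\<theta>.
     (\<forall>p\<in>poly_ring I. \<theta> p \<in> poly_ring I) \<and> (\<forall>p. p \<notin> poly_ring I \<longrightarrow> \<theta> p = 0) \<and>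
     (\<forall>p\<in>poly_ring I. \<forall>q\<in>poly_ring I. \<theta> (p + q) = \<theta> p + \<theta> q) \<and>
     (\<forall>c. \<forall>p\<in>poly_ring I. \<theta> (c *\<^sub>R p) = c *\<^sub>R \<theta> p) \<and>
     (\<forall>p\<in>poly_ring I. \<forall>q\<in>poly_ring I. \<theta> (p * q) = \<theta> p * q + p * \<theta> q)}"

definition log_derivations :: "'v arrangement \<Rightarrow> ('v rpoly \<Rightarrow> 'v rpoly) set" where
  "log_derivations A = {\<theta> \<in> derivations (coords A).
     \<forall>a. a \<in> ambient A \<and> a \<noteq> 0 \<and> hyperplane (coords A) a 0 \<in> hyps A \<longrightarrow>
       (\<exists>q\<in>poly_ring (coords A).
          \<theta> (linear_form (coords A) a) = linear_form (coords A) a * q)}"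

definition homogeneous_der :: "'v set \<Rightarrow> nat \<Rightarrow> ('v rpoly \<Rightarrow> 'v rpoly) \<Rightarrow> bool" where
  "homogeneous_der I d \<theta> \<longleftrightarrow> (\<forall>i\<in>I. homogeneous_poly d (\<theta> (poly_var i)))"

definition log_basis :: "'v arrangement \<Rightarrow> ('v rpoly \<Rightarrow> 'v rpoly) list \<Rightarrow> bool" where
  "log_basis A \<theta>s \<longleftrightarrow> set \<theta>s \<subseteq> log_derivations A \<and>
     (\<forall>\<theta>\<in>log_derivations A. \<exists>!fs. length fs = length \<theta>s \<and> set fs \<subseteq> poly_ring (coords A) \<and>
        \<theta> = (\<lambda>p. \<Sum>j<length \<theta>s. (fs ! j) * (\<theta>s ! j) p))"

definition free_with_exponents :: "'v arrangement \<Rightarrow> nat multiset \<Rightarrow> bool" where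
  "free_with_exponents A E \<longleftrightarrow> central A \<and>
     (\<exists>\<theta>s ds. log_basis A \<theta>s \<and> list_all2 (homogeneous_der (coords A)) ds \<theta>s \<and> mset ds = E)"

definition free_arrangement :: "'v arrangement \<Rightarrow> bool" where
  "free_arrangement A \<longleftrightarrow> (\<exists>E. free_with_exponents A E)"

section \<open>Vertex-weighted digraphs\<close>

text \<open>The pair \<open>weight G i = (a, b)\<close> stands for the integer interval \<open>[a, b]\<close>.\<close>

record 'v wdigraph =
  vertices :: "'v set"
  edges :: "('v \<times> 'v) set"
  weight :: "'v \<Rightarrow> int \<times> int"

definition wdig_arr :: "'v::linorder wdigraph \<Rightarrow> 'v arrangement" where
  "wdig_arr G = \<lparr> coords = vertices G,
     hyps =
       {{x \<in> rspace (vertices G). Poly_Mapping.lookup x i - Poly_Mapping.lookup x j = 0}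
         | i j. i \<in> vertices G \<and> j \<in> vertices G \<and> i < j}
     \<union> {{x \<in> rspace (vertices G). Poly_Mapping.lookup x i - Poly_Mapping.lookup x j = 1}
         | i j. (i, j) \<in> edges G}
     \<union> {{x \<in> rspace (vertices G). Poly_Mapping.lookup x i = of_int c}
         | i c. i \<in> vertices G \<and> c \<in> {fst (weight G i)..snd (weight G i)}} \<rparr>"

definition coking :: "'v wdigraph \<Rightarrow> 'v \<Rightarrow> bool" where
  "coking G v \<longleftrightarrow> v \<in> vertices G \<and> (\<forall>u\<in>vertices G - {v}. (u, v) \<in> edges G)"

definition king :: "'v wdigraph \<Rightarrow> 'v \<Rightarrow> bool" where
  "king G v \<longleftrightarrow> v \<in> vertices G \<and> (\<forall>u\<in>vertices G - {v}. (v, u) \<in> edges G)"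

definition isolated :: "'v wdigraph \<Rightarrow> 'v \<Rightarrow> bool" where
  "isolated G v \<longleftrightarrow> v \<in> vertices G \<and> (\<forall>u. (u, v) \<notin> edges G \<and> (v, u) \<notin> edges G)"

definition coking_elim :: "'v \<Rightarrow> 'v wdigraph \<Rightarrow> 'v wdigraph" where
  "coking_elim v G = \<lparr> vertices = vertices G,
     edges = edges G - {(i, v) | i. True},
     weight = (\<lambda>i\<in>vertices G. if i = v then weight G i
                 else (fst (weight G i) - 1, snd (weight G i))) \<rparr>"

definition king_elim :: "'v \<Rightarrow> 'v wdigraph \<Rightarrow> 'v wdigraph" where
  "king_elim v G = \<lparr> vertices = vertices G,
     edges = edges G - {(v, i) | i. True},
     weight = (\<lambda>i\<in>vertices G. if i = v then weight G i
                 else (fst (weight G i), snd (weight G i) + 1)) \<rparr>"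

definition induced :: "'v wdigraph \<Rightarrow> 'v set \<Rightarrow> 'v wdigraph" where
  "induced G U = \<lparr> vertices = U, edges = edges G \<inter> U \<times> U, weight = restrict (weight G) U \<rparr>"

text \<open>
  The operation \<open>f\<close> is carried out on the subgraph induced on \<open>U\<close>; edges not inside \<open>U\<close> and weights of
  vertices outside \<open>U\<close> are kept.
\<close>

definition apply_on :: "'v set \<Rightarrow> ('v wdigraph \<Rightarrow> 'v wdigraph) \<Rightarrow> 'v wdigraph \<Rightarrow> 'v wdigraph" where
  "apply_on U f G = \<lparr> vertices = vertices G,
     edges = edges (f (induced G U)) \<union> (edges G - U \<times> U),
     weight = (\<lambda>i. if i \<in> U then weight (f (induced G U)) i else weight G i) \<rparr>"

definition C_dig :: "nat \<Rightarrow> nat \<Rightarrow> nat wdigraph" where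
  "C_dig l k = \<lparr> vertices = {1..l},
     edges = {(i, j). i \<in> {k..l} \<and> j \<in> {k..l} \<and> i \<noteq> j},
     weight = (\<lambda>i\<in>{1..l}. (- int (min i k), int (min i k))) \<rparr>"

definition D_dig :: "nat \<Rightarrow> nat \<Rightarrow> nat wdigraph" where
  "D_dig l k = \<lparr> vertices = {1..l},
     edges = {(k, i) | i. i \<in> {k+1..l}}
           \<union> {(i, j). i \<in> {k+1..l} \<and> j \<in> {k+1..l} \<and> i \<noteq> j},
     weight = (\<lambda>i\<in>{1..l}. if i \<le> k then (- int (min i k), int (min i k))
                 else (- int (min i k) - 1, int (min i k))) \<rparr>"

definition Cat :: "nat \<Rightarrow> nat arrangement" where
  "Cat n = \<lparr> coords = {1..n},
     hyps = {{x \<in> rspace {1..n}. Poly_Mapping.lookup x i - Poly_Mapping.lookup x j = c}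
       | i j c. 1 \<le> i \<and> i < j \<and> j \<le> n \<and> c \<in> {-1, 0, 1}} \<rparr>"

end

theory Submission
  imports Defs "HOL-Library.Option_ord" "Jordan_Normal_Form.Determinant"
begin

text \<open>
  Every cone in the sequence is free with an explicit basis, certified by Saito's criterion. Apart from the
  Euler derivation the basis consists of derivations with \<open>\<theta>(z) = 0\<close> and \<open>\<theta>(x\<^sub>i) = P(x\<^sub>i)\<close> for
  polynomials \<open>P(t)\<close> with coefficients in the polynomial ring. On the block \<open>k, \<dots>, l\<close> one takes \<open>P\<close> with \<open>P(0) = 0\<close> and
  \<open>P(t + z) - P(t) = z t\<^sup>r \<Prod>\<^sub>c (t - c z) \<Prod>\<^sub>j (t - x\<^sub>j)\<close>, where \<open>-a \<le> c < k\<close> and \<open>j\<close> runs over the set \<open>S\<close> of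
  heads of edges: the right-hand side vanishes at \<open>t = x\<^sub>j\<close>, so \<open>x\<^sub>i - x\<^sub>j - z\<close> divides \<open>P(x\<^sub>i) - P(x\<^sub>j)\<close>.
  The vertices \<open>m < k\<close> contribute \<open>P(t) = \<Prod>\<^bsub>|c| \<le> m\<^esub> (t - c z) \<Prod>\<^bsub>j > m\<^esub> (t - x\<^sub>j)\<close>. These derivations are independent
  because a dependency would be a polynomial in \<open>t\<close> with more zeros than its degree. The Catalan cone is
  treated in the same way.

  The characteristic polynomials are computed by counting points modulo a large \<open>q\<close>: subtracting from each
  coordinate of the block the number of smaller coordinates indexed by \<open>S\<close> turns the admissible points into
  injective maps, and the lower coordinates are then chosen one after another. Both steps only involve
  \<open>a + |S| = l\<close>, so all arrangements of the sequence have the same count.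
\<close>

section \<open>Polynomials as finitely supported functions\<close>

text \<open>No derivation is carried from one arrangement to the next: each equivalence of freeness
  holds because both sides are shown free. The degrees explain the uniformity. On the block they are
  \<open>a + k + card S + r + 1\<close> for \<open>r \<le> l - k\<close>, below it
  \<open>2 * m + 1 + (l - m)\<close> for \<open>m < k\<close>; as \<open>a + card S = l\<close>,
  together they are always \<open>l + 2, ..., 2 * l + 1\<close>, the roots of the common
  characteristic polynomial and the large exponents of \<open>Cat (l + 1)\<close>.

  Any polynomial in one variable respects the hyperplanes \<open>x_i = x_j\<close>, so only edges
  and weights constrain \<open>P\<close>. The weights come from the same difference equation as the
  edges: starting from \<open>P(0) = 0\<close>, the factors \<open>t - c z\<close> let the zero
  travel in steps of \<open>z\<close> over all \<open>c z\<close> with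
  \<open>-a \<le> c \<le> k\<close>, and one step further down the value of \<open>P\<close> still
  has the factor \<open>c z - x_i\<close> for \<open>i\<close> in \<open>S\<close>.

  Independence is tested at one real point: for \<open>z = 1\<close> and
  \<open>x_i = l + 2 i\<close> the integers from \<open>-a\<close> to \<open>k\<close>, the
  \<open>x_i\<close> of the block and the \<open>x_j + 1\<close> with \<open>j\<close> in
  \<open>S\<close> are distinct, one more than the degree bound.\<close>

definition cst :: "real \<Rightarrow> 'v rpoly" where
  "cst c = Poly_Mapping.single 0 c"

definition mon_eval :: "('v \<Rightarrow> 'b::comm_ring_1) \<Rightarrow> ('v \<Rightarrow>\<^sub>0 nat) \<Rightarrow> 'b" where
  "mon_eval s m = (\<Prod>i\<in>Poly_Mapping.keys m. s i ^ Poly_Mapping.lookup m i)"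

text \<open>The target ring is arbitrary because every homomorphism of the proof is an instance:
  elimination of a variable, scaling, retraction to a subring, evaluation at a real point, and the
  map to polynomials in \<open>\<epsilon>\<close> that yields derivations.\<close>

definition poly_subst :: "(real \<Rightarrow> 'b::comm_ring_1) \<Rightarrow> ('v \<Rightarrow> 'b) \<Rightarrow> 'v rpoly \<Rightarrow> 'b" where
  "poly_subst \<kappa> s p = (\<Sum>m\<in>Poly_Mapping.keys p. \<kappa> (Poly_Mapping.lookup p m) * mon_eval s m)"

lemma comm_ring_hom_cst: "comm_ring_hom cst"
  by unfold_locales (auto simp: cst_def single_add mult_single)

interpretation cst: comm_ring_hom cst by (rule comm_ring_hom_cst)

lemma cst_eq_0_iff [simp]: "cst c = 0 \<longleftrightarrow> c = 0"
  by (metis cst_def lookup_single_eq lookup_zero single_zero)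

lemma lookup_scaleR: "Poly_Mapping.lookup (c *\<^sub>R p) m = c * Poly_Mapping.lookup p m"
  for p :: "'v \<Rightarrow>\<^sub>0 real"
  by (simp add: scaleR_poly_mapping_def)

lemma cst_mult_single: "cst c * Poly_Mapping.single m b = Poly_Mapping.single m (c * b)"
  by (simp add: cst_def mult_single)

lemma rpoly_induct [case_names single add]:
  fixes p :: "'a \<Rightarrow>\<^sub>0 real"
  assumes "\<And>m c. P (Poly_Mapping.single m c)" "\<And>p q. P p \<Longrightarrow> P q \<Longrightarrow> P (p + q)"
  shows "P p"
proof -
  have eq: "p = (\<Sum>m\<in>Poly_Mapping.keys p. Poly_Mapping.single m (Poly_Mapping.lookup p m))"
    by (rule poly_mapping_eqI) (auto simp: lookup_sum lookup_single when_def in_keys_iff)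
  have "P (\<Sum>m\<in>K. Poly_Mapping.single m (Poly_Mapping.lookup p m))" if "finite K" for K
    using that
  proof induction
    case empty
    show ?case using assms(1)[of undefined 0] by simp
  qed (use assms in simp)
  then show ?thesis using eq finite_keys by metis
qed

lemma scaleR_eq_cst_mult: "c *\<^sub>R p = cst c * p" for p :: "'v rpoly"
proof (induction p rule: rpoly_induct)
  case (single m b)
  show ?case
    by (rule poly_mapping_eqI) (simp add: cst_mult_single lookup_scaleR lookup_single when_def)
qed (simp add: scaleR_add_right distrib_left)

lemma mon_eval_superset:
  assumes "finite K" "Poly_Mapping.keys m \<subseteq> K"
  shows "mon_eval s m = (\<Prod>i\<in>K. s i ^ Poly_Mapping.lookup m i)"
  unfolding mon_eval_def
  by (rule prod.mono_neutral_left) (use assms in \<open>auto simp: in_keys_iff\<close>)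

lemma mon_eval_0 [simp]: "mon_eval s 0 = 1"
  by (simp add: mon_eval_def)

lemma mon_eval_add: "mon_eval s (m + n) = mon_eval s m * mon_eval s n"
proof -
  let ?K = "Poly_Mapping.keys m \<union> Poly_Mapping.keys n"
  have "mon_eval s (m + n) = (\<Prod>i\<in>?K. s i ^ Poly_Mapping.lookup (m + n) i)"
    by (rule mon_eval_superset) (auto dest: subsetD[OF keys_add])
  also have "\<dots> = (\<Prod>i\<in>?K. s i ^ Poly_Mapping.lookup m i) * (\<Prod>i\<in>?K. s i ^ Poly_Mapping.lookup n i)"
    by (simp add: lookup_add power_add prod.distrib)
  also have "\<dots> = mon_eval s m * mon_eval s n"
    by (simp add: mon_eval_superset[of ?K])
  finally show ?thesis .
qed

lemma mon_eval_single: "mon_eval s (Poly_Mapping.single i n) = s i ^ n"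
  by (cases "n = 0") (auto simp: mon_eval_def)

lemma poly_subst_add:
  assumes "comm_ring_hom \<kappa>"
  shows "poly_subst \<kappa> s (p + q) = poly_subst \<kappa> s p + poly_subst \<kappa> s q"
proof -
  interpret \<kappa>: comm_ring_hom \<kappa> by fact
  show ?thesis
    unfolding poly_subst_def
    by (rule setsum_keys_plus_distrib) (auto simp: \<kappa>.hom_add algebra_simps)
qed

lemma poly_subst_single:
  assumes "comm_ring_hom \<kappa>"
  shows "poly_subst \<kappa> s (Poly_Mapping.single m c) = \<kappa> c * mon_eval s m"
proof -
  interpret \<kappa>: comm_ring_hom \<kappa> by fact
  show ?thesis
    by (cases "c = 0") (auto simp: poly_subst_def)
qed

lemma poly_subst_mult:
  assumes "comm_ring_hom \<kappa>"
  shows "poly_subst \<kappa> s (p * q) = poly_subst \<kappa> s p * poly_subst \<kappa> s q"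
proof -
  interpret \<kappa>: comm_ring_hom \<kappa> by fact
  show ?thesis
  proof (induction p rule: rpoly_induct)
    case (single m c)
    show ?case
    proof (induction q rule: rpoly_induct)
      case (single n d)
      show ?case
        by (simp add: mult_single poly_subst_single[OF assms] mon_eval_add \<kappa>.hom_mult algebra_simps)
    qed (simp add: poly_subst_add[OF assms] algebra_simps)
  qed (simp add: poly_subst_add[OF assms] algebra_simps)
qed

lemma poly_subst_cst:
  assumes "comm_ring_hom \<kappa>"
  shows "poly_subst \<kappa> s (cst c) = \<kappa> c"
  by (simp add: cst_def poly_subst_single[OF assms])

lemma poly_subst_var:
  assumes "comm_ring_hom \<kappa>"
  shows "poly_subst \<kappa> s (poly_var i) = s i"
proof -
  interpret \<kappa>: comm_ring_hom \<kappa> by fact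
  show ?thesis
    by (simp add: poly_var_def poly_subst_single[OF assms] mon_eval_single)
qed

lemma comm_ring_hom_poly_subst:
  assumes "comm_ring_hom \<kappa>"
  shows "comm_ring_hom (poly_subst \<kappa> s)"
proof -
  interpret \<kappa>: comm_ring_hom \<kappa> by fact
  have "poly_subst \<kappa> s (cst 0) = 0" "poly_subst \<kappa> s (cst 1) = 1"
    by (simp_all only: poly_subst_cst[OF assms] \<kappa>.hom_zero \<kappa>.hom_one)
  then show ?thesis
    by unfold_locales (auto simp: poly_subst_add[OF assms] poly_subst_mult[OF assms])
qed

lemma single_eq_monomial: "Poly_Mapping.single m c = cst c * mon_eval poly_var m" for c :: real
proof -
  have *: "poly_var i ^ n = Poly_Mapping.single (Poly_Mapping.single i n) (1::real)" for i :: 'b and n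
    by (induction n) (auto simp: poly_var_def mult_single simp flip: single_add)
  have "(\<Prod>i\<in>K. poly_var i ^ Poly_Mapping.lookup m i)
      = Poly_Mapping.single (\<Sum>i\<in>K. Poly_Mapping.single i (Poly_Mapping.lookup m i)) (1::real)"
    if "finite K" for K
    using that by induction (auto simp: * mult_single)
  moreover have "(\<Sum>i\<in>Poly_Mapping.keys m. Poly_Mapping.single i (Poly_Mapping.lookup m i)) = m"
    by (rule poly_mapping_eqI) (auto simp: lookup_sum lookup_single when_def in_keys_iff)
  ultimately show ?thesis
    by (simp add: mon_eval_def cst_mult_single)
qed

section \<open>The ring of polynomials in the variables from \<open>I\<close>\<close>

lemma poly_ring_cst [simp]: "cst c \<in> poly_ring I"
  by (auto simp: poly_ring_def cst_def)

lemma poly_ring_var [simp]: "poly_var i \<in> poly_ring I \<longleftrightarrow> i \<in> I"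
  by (auto simp: poly_ring_def poly_var_def)

lemma poly_ring_add: "p \<in> poly_ring I \<Longrightarrow> q \<in> poly_ring I \<Longrightarrow> p + q \<in> poly_ring I"
  unfolding poly_ring_def using keys_add[of p q] by blast

lemma poly_ring_mult: "p \<in> poly_ring I \<Longrightarrow> q \<in> poly_ring I \<Longrightarrow> p * q \<in> poly_ring I"
  unfolding poly_ring_def using keys_mult[of p q] keys_add
  by (smt (verit, ccfv_threshold) Un_iff mem_Collect_eq subset_iff)

lemma poly_ring_0 [simp]: "0 \<in> poly_ring I" and poly_ring_1 [simp]: "1 \<in> poly_ring I"
  by (auto simp: poly_ring_def)

lemma poly_ring_sum: "(\<And>i. i \<in> K \<Longrightarrow> f i \<in> poly_ring I) \<Longrightarrow> sum f K \<in> poly_ring I"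
  by (induction K rule: infinite_finite_induct) (auto intro: poly_ring_add)

lemma poly_ring_induct [consumes 1, case_names cst var add mult]:
  assumes p: "p \<in> poly_ring I"
    and 1: "\<And>c. P (cst c)" and 2: "\<And>i. i \<in> I \<Longrightarrow> P (poly_var i)"
    and 3: "\<And>p q. p \<in> poly_ring I \<Longrightarrow> q \<in> poly_ring I \<Longrightarrow> P p \<Longrightarrow> P q \<Longrightarrow> P (p + q)"
    and 4: "\<And>p q. p \<in> poly_ring I \<Longrightarrow> q \<in> poly_ring I \<Longrightarrow> P p \<Longrightarrow> P q \<Longrightarrow> P (p * q)"
  shows "P p"
proof -
  have P1: "P 1" using 1[of 1] by simp
  have pow: "P (poly_var i ^ n) \<and> poly_var i ^ n \<in> poly_ring I" if "i \<in> I" for i n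
    using that by (induction n) (auto intro: 4 2 P1 poly_ring_mult)
  have "P (\<Prod>i\<in>K. poly_var i ^ Poly_Mapping.lookup m i) \<and> (\<Prod>i\<in>K. poly_var i ^ Poly_Mapping.lookup m i) \<in> poly_ring I"
    if "finite K" "K \<subseteq> I" for K and m :: "'a \<Rightarrow>\<^sub>0 nat"
    using that by induction (use P1 4 pow in \<open>auto intro: poly_ring_mult\<close>)
  then have mon: "P (mon_eval poly_var m) \<and> mon_eval poly_var m \<in> poly_ring I"
    if "Poly_Mapping.keys m \<subseteq> I" for m
    using that by (simp add: mon_eval_def)
  have s: "P (Poly_Mapping.single m c) \<and> Poly_Mapping.single m c \<in> poly_ring I"
    if "Poly_Mapping.keys m \<subseteq> I" for m c
    unfolding single_eq_monomial using mon[OF that] 1 4 poly_ring_cst poly_ring_mult by blast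
  have eq: "p = (\<Sum>m\<in>Poly_Mapping.keys p. Poly_Mapping.single m (Poly_Mapping.lookup p m))"
    by (rule poly_mapping_eqI) (auto simp: lookup_sum lookup_single when_def in_keys_iff)
  have "P (\<Sum>m\<in>K. Poly_Mapping.single m (Poly_Mapping.lookup p m))
     \<and> (\<Sum>m\<in>K. Poly_Mapping.single m (Poly_Mapping.lookup p m)) \<in> poly_ring I"
    if "finite K" "K \<subseteq> Poly_Mapping.keys p" for K
    using that
  proof induction
    case empty
    show ?case using 1[of 0] by simp
  next
    case (insert m K)
    then have "Poly_Mapping.keys m \<subseteq> I" using p by (auto simp: poly_ring_def)
    then have "P (Poly_Mapping.single m (Poly_Mapping.lookup p m))"
      "Poly_Mapping.single m (Poly_Mapping.lookup p m) \<in> poly_ring I" using s by blast+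
    then show ?case using insert by (auto intro: 3 poly_ring_add)
  qed
  then show ?thesis using eq finite_keys subset_refl by metis
qed

lemma poly_ring_UNIV: "p \<in> poly_ring UNIV"
  by (simp add: poly_ring_def)

section \<open>Linear forms\<close>

lemma linear_form_eq: "linear_form I a = (\<Sum>i\<in>I. cst (Poly_Mapping.lookup a i) * poly_var i)"
  by (simp add: linear_form_def scaleR_eq_cst_mult)

lemma linear_form_in_poly_ring [simp]: "linear_form I a \<in> poly_ring I"
  unfolding linear_form_eq by (intro poly_ring_sum poly_ring_mult) auto

lemma linear_form_diff: "linear_form I (a - b) = linear_form I a - linear_form I b"
  by (simp add: linear_form_eq lookup_minus cst.hom_minus left_diff_distrib sum_subtractf)

lemma linear_form_scaleR: "linear_form I (c *\<^sub>R a) = cst c * linear_form I a"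
  by (simp add: linear_form_eq lookup_scaleR cst.hom_mult sum_distrib_left mult.assoc)

lemma lookup_linear_form:
  assumes "finite I" "i \<in> I"
  shows "Poly_Mapping.lookup (linear_form I a) (Poly_Mapping.single i 1) = Poly_Mapping.lookup a i"
proof -
  have "Poly_Mapping.single j (1::nat) = Poly_Mapping.single i 1 \<longleftrightarrow> j = i" for j
    by (metis lookup_single_eq lookup_single_not_eq zero_neq_one)
  then have "Poly_Mapping.lookup (cst c * poly_var j) (Poly_Mapping.single i 1) = (if j = i then c else 0)" for j c
    by (simp add: poly_var_def cst_mult_single lookup_single when_def)
  then show ?thesis
    using assms by (simp add: linear_form_eq lookup_sum)
qed

lemma rspace_diff: "a \<in> rspace I \<Longrightarrow> b \<in> rspace I \<Longrightarrow> a - b \<in> rspace I"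
  using keys_diff[of a b] unfolding rspace_def by blast

lemma rspace_scaleR: "a \<in> rspace I \<Longrightarrow> c *\<^sub>R a \<in> rspace I"
  by (auto simp: rspace_def in_keys_iff lookup_scaleR)

lemma linear_form_eq_0_iff:
  assumes "finite I" "a \<in> rspace I"
  shows "linear_form I a = 0 \<longleftrightarrow> a = 0"
proof
  assume "linear_form I a = 0"
  then have "Poly_Mapping.lookup a i = 0" if "i \<in> I" for i
    using lookup_linear_form[OF assms(1) that, of a] by simp
  moreover have "Poly_Mapping.lookup a i = 0" if "i \<notin> I" for i
    using assms(2) that by (auto simp: rspace_def in_keys_iff)
  ultimately show "a = 0" by (metis poly_mapping_eqI lookup_zero)
qed (simp add: linear_form_eq)

text \<open>Divisibility by a linear form is detected by the substitution that solves the form for one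
  of its variables; hence linear forms are prime.\<close>

lemma linear_form_dvd_hom:
  assumes I: "finite I" and a: "a \<in> rspace I" "a \<noteq> 0"
  obtains \<sigma> :: "'v rpoly \<Rightarrow> 'v rpoly" where "comm_ring_hom \<sigma>" "\<And>c. \<sigma> (cst c) = cst c"
    "\<And>f. linear_form I a dvd f \<longleftrightarrow> \<sigma> f = 0"
    "\<And>b. b \<in> rspace I \<Longrightarrow> linear_form I a dvd linear_form I b \<Longrightarrow> \<exists>c. b = c *\<^sub>R a"
proof -
  obtain j where j: "Poly_Mapping.lookup a j \<noteq> 0"
    using a(2) by (metis poly_mapping_eqI lookup_zero)
  then have jI: "j \<in> I" using a(1) by (auto simp: rspace_def in_keys_iff)
  let ?aj = "Poly_Mapping.lookup a j" and ?\<alpha> = "linear_form I a"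
  define s where "s i = (if i = j then poly_var j - cst (1 / ?aj) * ?\<alpha> else poly_var i)" for i
  define \<sigma> where "\<sigma> = poly_subst cst s"
  interpret \<sigma>: comm_ring_hom \<sigma>
    unfolding \<sigma>_def by (rule comm_ring_hom_poly_subst[OF comm_ring_hom_cst])
  have \<sigma>c: "\<sigma> (cst c) = cst c" for c
    by (simp add: \<sigma>_def poly_subst_cst[OF comm_ring_hom_cst])
  have \<sigma>v: "\<sigma> (poly_var i) = s i" for i
    by (simp add: \<sigma>_def poly_subst_var[OF comm_ring_hom_cst])
  have stable: "\<sigma> (linear_form I b) = linear_form I b" if "Poly_Mapping.lookup b j = 0" for b
  proof -
    have "cst (Poly_Mapping.lookup b i) * s i = cst (Poly_Mapping.lookup b i) * poly_var i" for i
      using that by (simp add: s_def)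
    then show ?thesis
      by (simp add: linear_form_eq \<sigma>.hom_sum \<sigma>.hom_mult \<sigma>c \<sigma>v)
  qed
  have "?\<alpha> = cst ?aj * poly_var j + linear_form I (a - Poly_Mapping.single j ?aj)"
  proof -
    have "linear_form I (Poly_Mapping.single j ?aj) = cst ?aj * poly_var j"
      unfolding linear_form_eq using I jI
      by (subst sum.remove[of _ j]) (auto intro!: sum.neutral simp: lookup_single_not_eq[OF not_sym])
    then show ?thesis by (simp add: linear_form_diff)
  qed
  then have "\<sigma> ?\<alpha> = cst ?aj * s j + (?\<alpha> - cst ?aj * poly_var j)"
    using stable[of "a - Poly_Mapping.single j ?aj"]
    by (simp add: \<sigma>.hom_add \<sigma>.hom_mult \<sigma>c \<sigma>v lookup_minus lookup_single)
  also have "\<dots> = ?\<alpha> - (cst ?aj * cst (1 / ?aj)) * ?\<alpha>"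
    by (simp add: s_def algebra_simps)
  also have "cst ?aj * cst (1 / ?aj) = (1 :: 'v rpoly)"
    using j by (simp flip: cst.hom_mult)
  finally have \<sigma>\<alpha>: "\<sigma> ?\<alpha> = 0" by simp
  \<comment> \<open>\<open>\<sigma>\<close> shifts only the variable \<open>j\<close>, and by a
    multiple of \<open>?\<alpha>\<close>, so it is the identity modulo \<open>?\<alpha>\<close>. As
    it also kills \<open>?\<alpha>\<close>, its kernel is exactly the ideal of
    \<open>?\<alpha>\<close>.\<close>
  have sub: "?\<alpha> dvd f - \<sigma> f" for f
    using poly_ring_UNIV[of f]
  proof (induction f rule: poly_ring_induct)
    case (var i)
    show ?case by (simp add: \<sigma>v s_def)
  next
    case (add p q)
    then have "?\<alpha> dvd (p - \<sigma> p) + (q - \<sigma> q)" by (intro dvd_add)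
    then show ?case by (simp add: \<sigma>.hom_add algebra_simps)
  next
    case (mult p q)
    then have "?\<alpha> dvd (p - \<sigma> p) * q + \<sigma> p * (q - \<sigma> q)" by (intro dvd_add) auto
    then show ?case by (simp add: \<sigma>.hom_mult algebra_simps)
  qed (simp add: \<sigma>c)
  have iff: "?\<alpha> dvd f \<longleftrightarrow> \<sigma> f = 0" for f
  proof
    assume "?\<alpha> dvd f"
    then obtain q where "f = ?\<alpha> * q" by (elim dvdE)
    then show "\<sigma> f = 0" using \<sigma>\<alpha> by (simp add: \<sigma>.hom_mult)
  next
    assume "\<sigma> f = 0"
    then show "?\<alpha> dvd f" using sub[of f] by simp
  qed
  have "\<exists>c. b = c *\<^sub>R a" if b: "b \<in> rspace I" and d: "?\<alpha> dvd linear_form I b" for b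
  proof -
    \<comment> \<open>This multiple of \<open>a\<close> cancels the coordinate \<open>j\<close>; the
      remaining form is then fixed by \<open>\<sigma>\<close>, while divisibility makes its image
      zero.\<close>
    define c where "c = Poly_Mapping.lookup b j / ?aj"
    have rspace: "b - c *\<^sub>R a \<in> rspace I"
      using a(1) b by (intro rspace_diff rspace_scaleR)
    have "linear_form I (b - c *\<^sub>R a) = \<sigma> (linear_form I (b - c *\<^sub>R a))"
      using j by (intro stable[symmetric]) (simp add: lookup_minus lookup_scaleR c_def)
    also have "\<dots> = 0"
      using iff[of "linear_form I b"] d \<sigma>\<alpha>
      by (simp add: linear_form_diff linear_form_scaleR \<sigma>.hom_minus \<sigma>.hom_mult)
    finally have "b - c *\<^sub>R a = 0"
      using linear_form_eq_0_iff[OF I, of "b - c *\<^sub>R a"] rspace by blast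
    then show ?thesis by auto
  qed
  then show ?thesis using that[OF \<sigma>.comm_ring_hom_axioms \<sigma>c iff] by blast
qed

text \<open>Induction on the set of forms. The homomorphism belonging to the new form kills
  \<open>f\<close> but none of the earlier factors, as these are not proportional to it, so it kills
  the cofactor. The order on the variables is what makes the polynomials an integral domain.\<close>

lemma prod_linear_forms_dvd:
  fixes f :: "'v::linorder rpoly"
  assumes I: "finite I" and F: "finite F" "F \<subseteq> rspace I - {0}"
    and np: "\<And>a b c. a \<in> F \<Longrightarrow> b \<in> F \<Longrightarrow> b = c *\<^sub>R a \<Longrightarrow> a = b"
    and dvd: "\<And>a. a \<in> F \<Longrightarrow> linear_form I a dvd f"
  shows "(\<Prod>a\<in>F. linear_form I a) dvd f"
proof -
  have "(\<Prod>a\<in>G. linear_form I a) dvd f" if "finite G" "G \<subseteq> F" for G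
    using that
  proof (induction G rule: finite_induct)
    case (insert a G)
    then have "(\<Prod>b\<in>G. linear_form I b) dvd f" by simp
    then obtain g where g: "f = (\<Prod>b\<in>G. linear_form I b) * g" by (elim dvdE)
    have aF: "a \<in> F" and GF: "G \<subseteq> F" using insert.prems by auto
    then have a: "a \<in> rspace I" "a \<noteq> 0" using F by auto
    obtain \<sigma> :: "'v rpoly \<Rightarrow> 'v rpoly" where \<sigma>: "comm_ring_hom \<sigma>" "\<And>c. \<sigma> (cst c) = cst c"
      "\<And>f. linear_form I a dvd f \<longleftrightarrow> \<sigma> f = 0"
      "\<And>b. b \<in> rspace I \<Longrightarrow> linear_form I a dvd linear_form I b \<Longrightarrow> \<exists>c. b = c *\<^sub>R a"
      by (rule linear_form_dvd_hom[OF I a], rule that)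
    interpret comm_ring_hom \<sigma> by fact
    have "\<sigma> (linear_form I b) \<noteq> 0" if b: "b \<in> G" for b
    proof
      assume "\<sigma> (linear_form I b) = 0"
      moreover have "b \<in> rspace I" using b GF F by blast
      ultimately obtain c where "b = c *\<^sub>R a" using \<sigma>(3,4) by blast
      moreover have "b \<in> F" using b GF by blast
      ultimately have "a = b" by (intro np[OF aF])
      then show False using insert.hyps b by simp
    qed
    moreover have "\<sigma> f = 0" using \<sigma>(3) dvd[OF aF] by blast
    ultimately have "\<sigma> g = 0" using g insert.hyps(1) by (simp add: hom_mult hom_prod)
    then have "linear_form I a dvd g" using \<sigma>(3) by blast
    then show ?case
      unfolding prod.insert[OF insert.hyps] mult.commute[of "linear_form I a"] g by (rule mult_dvd_mono[OF dvd_refl])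
  qed simp
  then show ?thesis using F(1) by blast
qed

section \<open>The scaling endomorphism\<close>

text \<open>\<open>scale2 I\<close> doubles the variables in \<open>I\<close> and kills all others. Its eigenvectors for the
  eigenvalue \<open>2\<^sup>d\<close> are the homogeneous polynomials of degree \<open>d\<close> in the variables from \<open>I\<close>.\<close>

definition scale2 :: "'v set \<Rightarrow> 'v rpoly \<Rightarrow> 'v rpoly" where
  "scale2 I = poly_subst cst (\<lambda>i. if i \<in> I then 2 * poly_var i else 0)"

lemma comm_ring_hom_scale2: "comm_ring_hom (scale2 I)"
  unfolding scale2_def by (rule comm_ring_hom_poly_subst[OF comm_ring_hom_cst])

interpretation scale2: comm_ring_hom "scale2 I" for I by (rule comm_ring_hom_scale2)

lemma scale2_var: "scale2 I (poly_var i) = (if i \<in> I then 2 * poly_var i else 0)"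
  by (simp add: scale2_def poly_subst_var[OF comm_ring_hom_cst])

lemma scale2_cst: "scale2 I (cst c) = cst c"
  by (simp add: scale2_def poly_subst_cst[OF comm_ring_hom_cst])

lemma two_power_eq_cst: "(2::'v rpoly) ^ d = cst (2 ^ d)"
proof -
  have "(2::'v rpoly) = cst 2" by (metis cst.hom_one cst.hom_add one_add_one)
  then show ?thesis by (metis cst.hom_power)
qed

lemma lookup_scale2:
  "Poly_Mapping.lookup (scale2 I p) m =
    (if Poly_Mapping.keys m \<subseteq> I then 2 ^ (\<Sum>i\<in>Poly_Mapping.keys m. Poly_Mapping.lookup m i) else 0)
      * Poly_Mapping.lookup p m"
proof (induction p rule: rpoly_induct)
  case (single n c)
  let ?d = "\<Sum>i\<in>Poly_Mapping.keys n. Poly_Mapping.lookup n i"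
  have "scale2 I (Poly_Mapping.single n c) = (if Poly_Mapping.keys n \<subseteq> I then Poly_Mapping.single n (2 ^ ?d * c) else 0)"
  proof (cases "Poly_Mapping.keys n \<subseteq> I")
    case True
    then have "mon_eval (\<lambda>i. if i \<in> I then 2 * poly_var i else 0) n
        = (\<Prod>i\<in>Poly_Mapping.keys n. 2 ^ Poly_Mapping.lookup n i * (poly_var i :: 'a rpoly) ^ Poly_Mapping.lookup n i)"
      unfolding mon_eval_def by (intro prod.cong) (auto simp: power_mult_distrib)
    also have "\<dots> = cst (2 ^ ?d) * mon_eval poly_var n"
      unfolding two_power_eq_cst by (simp add: prod.distrib mon_eval_def power_sum cst.hom_prod)
    finally show ?thesis
      using True unfolding scale2_def poly_subst_single[OF comm_ring_hom_cst]
      by (simp add: single_eq_monomial[of n] cst.hom_mult mult_ac)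
  next
    case False
    then obtain i where "i \<in> Poly_Mapping.keys n" "i \<notin> I" by blast
    then have "mon_eval (\<lambda>i. if i \<in> I then 2 * poly_var i else (0::'a rpoly)) n = 0"
      unfolding mon_eval_def by (auto simp: in_keys_iff zero_power intro!: prod_zero bexI[of _ i])
    then show ?thesis
      using False by (simp add: scale2_def poly_subst_single[OF comm_ring_hom_cst])
  qed
  then show ?case by (auto simp: lookup_single when_def)
qed (simp add: scale2.hom_add lookup_add distrib_left)

text \<open>Over the reals the powers of 2 are nonzero and distinct, so comparing coefficients
  excludes monomials with a variable outside \<open>I\<close> as well as those of another degree.
  One equation thus gives membership and homogeneity.\<close>

lemma scale2_eigenvector:
  assumes "scale2 I p = 2 ^ d * p"
  shows "p \<in> poly_ring I" "homogeneous_poly d p"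
proof -
  have *: "Poly_Mapping.lookup (2 ^ d * p) m = 2 ^ d * Poly_Mapping.lookup p m" for m
    using lookup_scaleR[of "2 ^ d" p m] unfolding two_power_eq_cst scaleR_eq_cst_mult .
  have "Poly_Mapping.keys m \<subseteq> I \<and> (\<Sum>i\<in>Poly_Mapping.keys m. Poly_Mapping.lookup m i) = d"
    if "m \<in> Poly_Mapping.keys p" for m
    using arg_cong[OF assms, of "\<lambda>q. Poly_Mapping.lookup q m"] that
    unfolding lookup_scale2 * by (auto simp: in_keys_iff split: if_splits)
  then show "p \<in> poly_ring I" "homogeneous_poly d p"
    by (auto simp: poly_ring_def homogeneous_poly_def)
qed

lemma scale2_fixed:
  assumes "scale2 I p = p"
  obtains c where "p = cst c"
proof -
  have "homogeneous_poly 0 p" using scale2_eigenvector(2)[of I p 0] assms by simp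
  then have "m = 0" if "m \<in> Poly_Mapping.keys p" for m
    using that unfolding homogeneous_poly_def
    by (metis finite_keys in_keys_iff poly_mapping_eqI lookup_zero sum_eq_0_iff)
  then have "p = cst (Poly_Mapping.lookup p 0)"
    by (intro poly_mapping_eqI) (auto simp: cst_def lookup_single when_def in_keys_iff)
  then show ?thesis using that by blast
qed

text \<open>A ring retraction onto \<open>poly_ring I\<close>. Quotients found in the ring of all
  polynomials are brought back into \<open>poly_ring I\<close> by applying it to the identity that
  they satisfy.\<close>

definition retract :: "'v set \<Rightarrow> 'v rpoly \<Rightarrow> 'v rpoly" where
  "retract I = poly_subst cst (\<lambda>i. if i \<in> I then poly_var i else 0)"

lemma comm_ring_hom_retract: "comm_ring_hom (retract I)"
  unfolding retract_def by (rule comm_ring_hom_poly_subst[OF comm_ring_hom_cst])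

interpretation retract: comm_ring_hom "retract I" for I by (rule comm_ring_hom_retract)

lemma retract_in_poly_ring: "retract I p \<in> poly_ring I"
  using poly_ring_UNIV[of p]
proof (induction p rule: poly_ring_induct)
  case (cst c)
  then show ?case by (simp add: retract_def poly_subst_cst[OF comm_ring_hom_cst])
next
  case (var i)
  then show ?case by (simp add: retract_def poly_subst_var[OF comm_ring_hom_cst])
qed (auto simp: retract.hom_add retract.hom_mult intro: poly_ring_add poly_ring_mult)

lemma retract_id: "p \<in> poly_ring I \<Longrightarrow> retract I p = p"
proof (induction p rule: poly_ring_induct)
  case (cst c)
  then show ?case by (simp add: retract_def poly_subst_cst[OF comm_ring_hom_cst])
next
  case (var i)
  then show ?case by (simp add: retract_def poly_subst_var[OF comm_ring_hom_cst])
qed (auto simp: retract.hom_add retract.hom_mult)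

lemma dvd_in_poly_ring:
  assumes "p \<in> poly_ring I" "q \<in> poly_ring I" "p dvd q"
  shows "\<exists>r\<in>poly_ring I. q = p * r"
proof -
  obtain r where "q = p * r" using assms(3) by (elim dvdE)
  then have "q = p * retract I r"
    using retract_id[OF assms(1)] retract_id[OF assms(2)] by (metis retract.hom_mult)
  then show ?thesis using retract_in_poly_ring by blast
qed

section \<open>Derivations\<close>

text \<open>The derivation with prescribed values \<open>g\<close> on the variables is the \<open>\<epsilon>\<close>-coefficient of the
  homomorphism into dual numbers sending \<open>x\<^sub>i\<close> to \<open>x\<^sub>i + \<epsilon> g\<^sub>i\<close>.\<close>

definition der_of :: "'v set \<Rightarrow> ('v \<Rightarrow> 'v rpoly) \<Rightarrow> 'v rpoly \<Rightarrow> 'v rpoly" where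
  "der_of I g p = (if p \<in> poly_ring I
     then poly.coeff (poly_subst (\<lambda>c. [:cst c:]) (\<lambda>i. [:poly_var i, g i:]) p) 1 else 0)"

context
  fixes I :: "'v set" and g :: "'v \<Rightarrow> 'v rpoly"
begin

private abbreviation "dual \<equiv> poly_subst (\<lambda>c. [:cst c:]) (\<lambda>i. [:poly_var i, g i:])"

private lemma hom: "comm_ring_hom (\<lambda>c. [:cst c:])"
  by unfold_locales (auto simp: cst.hom_add cst.hom_mult one_pCons)

private lemma dual_cst: "dual (cst c) = [:cst c:]"
  and dual_var: "dual (poly_var i) = [:poly_var i, g i:]"
  by (simp_all add: poly_subst_cst[OF hom] poly_subst_var[OF hom])

private lemma dual_add: "dual (p + q) = dual p + dual q"
  and dual_mult: "dual (p * q) = dual p * dual q"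
  by (simp_all add: poly_subst_add[OF hom] poly_subst_mult[OF hom])

private lemma coeff_dual_0: "poly.coeff (dual p) 0 = p"
  using poly_ring_UNIV[of p]
  by (induction p rule: poly_ring_induct)
    (simp_all add: dual_cst dual_var dual_add dual_mult coeff_mult_0)

text \<open>Polynomials in \<open>\<epsilon>\<close> are not truncated at
  \<open>\<epsilon>^2\<close>. This does no harm: the coefficient of degree 1 of a product involves
  only coefficients of degrees 0 and 1.\<close>

private lemma coeff_dual_1:
  "poly.coeff (dual (p * q)) 1 = poly.coeff (dual p) 1 * q + p * poly.coeff (dual q) 1"
  by (simp add: dual_mult coeff_mult coeff_dual_0)

lemma der_of_var: "i \<in> I \<Longrightarrow> der_of I g (poly_var i) = g i"
  by (simp add: der_of_def dual_var)

lemma der_of_derivation: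
  assumes "\<And>i. i \<in> I \<Longrightarrow> g i \<in> poly_ring I"
  shows "der_of I g \<in> derivations I"
proof -
  have cst1: "poly.coeff (dual (cst c)) 1 = 0" for c by (simp add: dual_cst)
  have "poly.coeff (dual p) 1 \<in> poly_ring I" if "p \<in> poly_ring I" for p
    using that
  proof (induction p rule: poly_ring_induct)
    case (add p q)
    then show ?case by (simp add: dual_add poly_ring_add)
  next
    case (mult p q)
    then show ?case unfolding coeff_dual_1 by (intro poly_ring_add poly_ring_mult)
  qed (auto simp: dual_cst dual_var assms)
  moreover have "poly.coeff (dual (c *\<^sub>R p)) 1 = c *\<^sub>R poly.coeff (dual p) 1" for c p
    unfolding scaleR_eq_cst_mult coeff_dual_1 cst1 by simp
  ultimately show ?thesis
    unfolding derivations_def mem_Collect_eq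
    by (intro conjI ballI allI impI)
      (simp_all add: der_of_def poly_ring_add poly_ring_mult coeff_dual_1[unfolded One_nat_def] dual_add
        scaleR_eq_cst_mult)
qed

end

lemma derivation_cst:
  assumes "\<theta> \<in> derivations I"
  shows "\<theta> (cst c) = 0"
proof -
  have "\<theta> (1 * 1) = \<theta> 1 * 1 + 1 * \<theta> 1"
    using assms poly_ring_1 unfolding derivations_def by blast
  then have "\<theta> 1 = 0" by simp
  moreover have "\<theta> (c *\<^sub>R 1) = c *\<^sub>R \<theta> 1"
    using assms poly_ring_1 unfolding derivations_def by blast
  ultimately show ?thesis by (simp add: scaleR_eq_cst_mult)
qed

lemma derivation_mult:
  "\<theta> \<in> derivations I \<Longrightarrow> p \<in> poly_ring I \<Longrightarrow> q \<in> poly_ring I \<Longrightarrow> \<theta> (p * q) = \<theta> p * q + p * \<theta> q"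
  and derivation_add:
  "\<theta> \<in> derivations I \<Longrightarrow> p \<in> poly_ring I \<Longrightarrow> q \<in> poly_ring I \<Longrightarrow> \<theta> (p + q) = \<theta> p + \<theta> q"
  and derivation_closed:
  "\<theta> \<in> derivations I \<Longrightarrow> p \<in> poly_ring I \<Longrightarrow> \<theta> p \<in> poly_ring I"
  and derivation_outside:
  "\<theta> \<in> derivations I \<Longrightarrow> p \<notin> poly_ring I \<Longrightarrow> \<theta> p = 0"
  unfolding derivations_def by blast+

lemma derivation_eqI:
  assumes "\<theta> \<in> derivations I" "\<eta> \<in> derivations I" "\<And>i. i \<in> I \<Longrightarrow> \<theta> (poly_var i) = \<eta> (poly_var i)"
  shows "\<theta> = \<eta>"
proof
  fix p
  show "\<theta> p = \<eta> p"
  proof (cases "p \<in> poly_ring I")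
    case True
    then show ?thesis
      by (induction p rule: poly_ring_induct)
        (use assms in \<open>auto simp: derivation_cst derivation_add derivation_mult\<close>)
  qed (use assms in \<open>simp add: derivation_outside\<close>)
qed

lemma derivation_linear_form:
  assumes \<theta>: "\<theta> \<in> derivations I"
  shows "\<theta> (linear_form I a) = (\<Sum>i\<in>I. cst (Poly_Mapping.lookup a i) * \<theta> (poly_var i))"
proof -
  have "\<theta> (\<Sum>i\<in>J. cst (Poly_Mapping.lookup a i) * poly_var i)
      = (\<Sum>i\<in>J. cst (Poly_Mapping.lookup a i) * \<theta> (poly_var i))" if "J \<subseteq> I" for J
    using that
  proof (induction J rule: infinite_finite_induct)
    case (insert i J)
    then have "\<theta> (cst (Poly_Mapping.lookup a i) * poly_var i) = cst (Poly_Mapping.lookup a i) * \<theta> (poly_var i)"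
      using \<theta> by (simp add: derivation_mult derivation_cst)
    moreover have "(\<Sum>i\<in>J. cst (Poly_Mapping.lookup a i) * poly_var i) \<in> poly_ring I"
      using insert by (intro poly_ring_sum poly_ring_mult) auto
    ultimately show ?case
      using insert \<theta> by (simp add: derivation_add poly_ring_mult)
  qed (use derivation_cst[OF \<theta>, of 0] in auto)
  then show ?thesis by (simp add: linear_form_eq)
qed

lemma derivation_combination:
  assumes \<theta>: "\<And>j. j < n \<Longrightarrow> \<theta> j \<in> derivations I" and f: "\<And>j. j < n \<Longrightarrow> f j \<in> poly_ring I"
  shows "(\<lambda>p. \<Sum>j<n. f j * \<theta> j p) \<in> derivations I"
proof -
  have c: "\<theta> j (cst c * p) = cst c * \<theta> j p" if "j < n" "p \<in> poly_ring I" for j c p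
    using derivation_mult[OF \<theta>[OF that(1)] poly_ring_cst that(2)] derivation_cst[OF \<theta>[OF that(1)]]
    by (simp only: mult_zero_left add_0)
  have h1: "(\<Sum>j<n. f j * \<theta> j p) \<in> poly_ring I" if "p \<in> poly_ring I" for p
    using that by (auto intro!: poly_ring_sum poly_ring_mult f derivation_closed[OF \<theta>])
  have h2: "(\<Sum>j<n. f j * \<theta> j p) = 0" if "p \<notin> poly_ring I" for p
    using that by (intro sum.neutral) (auto simp: derivation_outside[OF \<theta>])
  have h3: "(\<Sum>j<n. f j * \<theta> j (p + q)) = (\<Sum>j<n. f j * \<theta> j p) + (\<Sum>j<n. f j * \<theta> j q)"
    if "p \<in> poly_ring I" "q \<in> poly_ring I" for p q
    unfolding sum.distrib[symmetric]
    by (intro sum.cong) (auto simp: derivation_add[OF \<theta> that] distrib_left)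
  have h4: "(\<Sum>j<n. f j * \<theta> j (cst c * p)) = cst c * (\<Sum>j<n. f j * \<theta> j p)"
    if "p \<in> poly_ring I" for c p
    unfolding sum_distrib_left by (intro sum.cong) (auto simp: c that)
  have h5: "(\<Sum>j<n. f j * \<theta> j (p * q)) = (\<Sum>j<n. f j * \<theta> j p) * q + p * (\<Sum>j<n. f j * \<theta> j q)"
    if "p \<in> poly_ring I" "q \<in> poly_ring I" for p q
    unfolding sum_distrib_left sum_distrib_right sum.distrib[symmetric]
    by (intro sum.cong) (auto simp: derivation_mult[OF \<theta> that] algebra_simps)
  show ?thesis
    unfolding derivations_def scaleR_eq_cst_mult mem_Collect_eq
    by (intro conjI ballI allI impI; rule h1 h2 h3 h4 h5; assumption)
qed

section \<open>Saito's criterion\<close>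

lemma log_derivation_dvd:
  assumes "\<theta> \<in> log_derivations A" "a \<in> ambient A" "a \<noteq> 0" "hyperplane (coords A) a 0 \<in> hyps A"
  shows "linear_form (coords A) a dvd \<theta> (linear_form (coords A) a)"
proof -
  have "\<exists>q\<in>poly_ring (coords A). \<theta> (linear_form (coords A) a) = linear_form (coords A) a * q"
    using assms(1) unfolding log_derivations_def mem_Collect_eq
    by (elim conjE allE[of _ a] impE) (intro conjI assms(2-4))
  then show ?thesis by (elim bexE) (rule dvdI)
qed

text \<open>Modulo a form \<open>\<alpha>\<close> the coefficient vector of \<open>\<alpha>\<close>
  is a nonzero kernel vector of the matrix, because row \<open>i\<close> maps it to
  \<open>\<theta> i \<alpha>\<close>, which \<open>\<alpha>\<close> divides. So each form divides
  the determinant, and nonproportional forms multiply.\<close>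

lemma prod_dvd_det_log_derivations:
  fixes A :: "'v::linorder arrangement"
  assumes I: "finite (coords A)" and e: "bij_betw e {..<n} (coords A)"
    and F: "finite F" "F \<subseteq> ambient A - {0}" "\<And>a. a \<in> F \<Longrightarrow> hyperplane (coords A) a 0 \<in> hyps A"
    and np: "\<And>a b c. a \<in> F \<Longrightarrow> b \<in> F \<Longrightarrow> b = c *\<^sub>R a \<Longrightarrow> a = b"
    and \<theta>: "\<And>i. i < n \<Longrightarrow> \<theta> i \<in> log_derivations A"
  shows "(\<Prod>a\<in>F. linear_form (coords A) a)
    dvd Determinant.det (mat n n (\<lambda>(i, j). \<theta> i (poly_var (e j))))" (is "_ dvd Determinant.det ?N")
proof (rule prod_linear_forms_dvd[OF I F(1,2) np])
  fix a assume aF: "a \<in> F"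
  let ?\<alpha> = "linear_form (coords A) a"
  have a: "a \<in> ambient A" "a \<noteq> 0" using aF F by auto
  obtain \<sigma> :: "'v rpoly \<Rightarrow> 'v rpoly" where \<sigma>: "comm_ring_hom \<sigma>" "\<And>c. \<sigma> (cst c) = cst c"
    "\<And>f. ?\<alpha> dvd f \<longleftrightarrow> \<sigma> f = 0"
    "\<And>b. b \<in> rspace (coords A) \<Longrightarrow> ?\<alpha> dvd linear_form (coords A) b \<Longrightarrow> \<exists>c. b = c *\<^sub>R a"
    by (rule linear_form_dvd_hom[OF I a], rule that)
  interpret comm_ring_hom \<sigma> by fact
  let ?v = "vec n (\<lambda>j. cst (Poly_Mapping.lookup a (e j))) :: 'v rpoly Matrix.vec"
  have "map_mat \<sigma> ?N *\<^sub>v ?v = 0\<^sub>v n"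
  proof (rule eq_vecI)
    fix i assume "i < dim_vec (0\<^sub>v n :: 'v rpoly Matrix.vec)"
    then have i: "i < n" by simp
    have "vec_index (map_mat \<sigma> ?N *\<^sub>v ?v) i = (\<Sum>j<n. \<sigma> (\<theta> i (poly_var (e j))) * cst (Poly_Mapping.lookup a (e j)))"
      using i by (simp add: scalar_prod_def lessThan_atLeast0)
    also have "\<dots> = \<sigma> (\<Sum>j<n. cst (Poly_Mapping.lookup a (e j)) * \<theta> i (poly_var (e j)))"
      by (simp add: hom_sum hom_mult \<sigma>(2) mult.commute)
    also have "(\<Sum>j<n. cst (Poly_Mapping.lookup a (e j)) * \<theta> i (poly_var (e j)))
        = (\<Sum>x\<in>coords A. cst (Poly_Mapping.lookup a x) * \<theta> i (poly_var x))"
      by (rule sum.reindex_bij_betw[OF e])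
    also have "\<dots> = \<theta> i ?\<alpha>"
      using \<theta>[OF i] by (intro derivation_linear_form[symmetric]) (simp add: log_derivations_def)
    also have "\<sigma> (\<theta> i ?\<alpha>) = 0"
      using \<sigma>(3) log_derivation_dvd[OF \<theta>[OF i] a F(3)[OF aF]] by blast
    finally show "vec_index (map_mat \<sigma> ?N *\<^sub>v ?v) i = vec_index (0\<^sub>v n) i" using i by simp
  qed simp
  moreover have "?v \<noteq> 0\<^sub>v n"
  proof
    assume v: "?v = 0\<^sub>v n"
    have "Poly_Mapping.lookup a x = 0" for x
    proof (cases "x \<in> coords A")
      case True
      then obtain j where "j < n" "x = e j" using e by (auto simp: bij_betw_def)
      then show ?thesis using arg_cong[OF v, of "\<lambda>u. vec_index u j"] by simp
    next
      case False
      then show ?thesis using a(1) by (auto simp: rspace_def in_keys_iff)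
    qed
    then show False using a(2) by (metis poly_mapping_eqI lookup_zero)
  qed
  ultimately have "Determinant.det (map_mat \<sigma> ?N) = 0"
    using det_0_iff_vec_prod_zero[of "map_mat \<sigma> ?N" n] by (auto intro!: exI[of _ ?v])
  then show "?\<alpha> dvd Determinant.det ?N" using \<sigma>(3) by simp
qed

text \<open>Cramer's rule without division, for a combination of rows: expanding along row
  \<open>r\<close> produces cofactors, and the adjugate matrix sums them up.\<close>

lemma cramer_row:
  fixes M :: "nat \<Rightarrow> nat \<Rightarrow> 'a::comm_ring_1"
  assumes c: "c < n"
  shows "(\<Sum>r<n. Determinant.det (mat n n (\<lambda>(i, j). if i = r then v j else M i j)) * M r c)
    = Determinant.det (mat n n (\<lambda>(i, j). M i j)) * v c"
proof -
  let ?M = "mat n n (\<lambda>(i, j). M i j)"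
  let ?N = "\<lambda>r. mat n n (\<lambda>(i, j). if i = r then v j else M i j)"
  have M: "?M \<in> carrier_mat n n" by simp
  have N: "Determinant.det (?N r) = (\<Sum>j<n. v j * cofactor ?M r j)" if r: "r < n" for r
  proof -
    have "mat_delete (?N r) r j = mat_delete ?M r j" for j
      unfolding mat_delete_def using r by (intro eq_matI) auto
    then show ?thesis
      using r laplace_expansion_row[of "?N r" n r] by (simp add: cofactor_def)
  qed
  have adj: "(\<Sum>r<n. cofactor ?M r j * M r c) = (if j = c then Determinant.det ?M else 0)" if j: "j < n" for j
  proof -
    have "(adj_mat ?M * ?M) $$ (j, c) = (\<Sum>r<n. cofactor ?M r j * M r c)"
      using j c by (simp add: adj_mat_def scalar_prod_def lessThan_atLeast0)
    then show ?thesis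
      using adj_mat(3)[OF M] j c by (auto simp: mult.commute)
  qed
  have "(\<Sum>r<n. Determinant.det (?N r) * M r c) = (\<Sum>r<n. \<Sum>j<n. v j * (cofactor ?M r j * M r c))"
    by (intro sum.cong) (auto simp: N sum_distrib_right mult.assoc)
  also have "\<dots> = (\<Sum>j<n. \<Sum>r<n. v j * (cofactor ?M r j * M r c))" by (rule sum.swap)
  also have "\<dots> = (\<Sum>j<n. v j * (if j = c then Determinant.det ?M else 0))"
    by (intro sum.cong) (auto simp: adj simp flip: sum_distrib_left)
  also have "\<dots> = v c * Determinant.det ?M"
    using c by (simp add: if_distrib cong: if_cong)
  finally show ?thesis by (simp add: mult.commute)
qed

text \<open>Applied twice: over the reals at the evaluation point, to obtain a nonzero determinant,
  and over the polynomial ring, to obtain uniqueness of coefficients.\<close>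

lemma row_kernel_trivial:
  fixes M :: "nat \<Rightarrow> nat \<Rightarrow> 'a::idom"
  shows "Determinant.det (mat n n (\<lambda>(i, j). M i j)) \<noteq> 0 \<longleftrightarrow>
    (\<forall>w. (\<forall>c<n. (\<Sum>r<n. w r * M r c) = 0) \<longrightarrow> (\<forall>r<n. w r = 0))"
proof -
  let ?M = "mat n n (\<lambda>(i, j). M i j)"
  have *: "vec_index (transpose_mat ?M *\<^sub>v w) c = (\<Sum>r<n. vec_index w r * M r c)" if "c < n" "dim_vec w = n" for w c
    using that by (simp add: scalar_prod_def lessThan_atLeast0 mult.commute)
  have **: "transpose_mat ?M *\<^sub>v w = 0\<^sub>v n \<longleftrightarrow> (\<forall>c<n. (\<Sum>r<n. vec_index w r * M r c) = 0)"
    if "dim_vec w = n" for w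
  proof
    assume "transpose_mat ?M *\<^sub>v w = 0\<^sub>v n"
    then show "\<forall>c<n. (\<Sum>r<n. vec_index w r * M r c) = 0" using *[OF _ that] by (metis index_zero_vec(1))
  next
    assume "\<forall>c<n. (\<Sum>r<n. vec_index w r * M r c) = 0"
    then show "transpose_mat ?M *\<^sub>v w = 0\<^sub>v n"
      using *[OF _ that] by (intro eq_vecI) (simp_all del: index_mult_mat_vec)
  qed
  have "Determinant.det ?M = 0 \<longleftrightarrow> Determinant.det (transpose_mat ?M) = 0"
    by (subst Determinant.det_transpose[of _ n]) auto
  also have "\<dots> \<longleftrightarrow> (\<exists>w. w \<in> carrier_vec n \<and> w \<noteq> 0\<^sub>v n \<and> transpose_mat ?M *\<^sub>v w = 0\<^sub>v n)"
    by (rule det_0_iff_vec_prod_zero) simp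
  also have "\<dots> \<longleftrightarrow> (\<exists>w. (\<forall>c<n. (\<Sum>r<n. w r * M r c) = 0) \<and> (\<exists>r<n. w r \<noteq> 0))"
  proof safe
    fix w assume w: "w \<in> carrier_vec n" "w \<noteq> 0\<^sub>v n" "transpose_mat ?M *\<^sub>v w = 0\<^sub>v n"
    then have "\<exists>r<n. vec_index w r \<noteq> 0" by (metis carrier_vecD eq_vecI index_zero_vec)
    then show "\<exists>w. (\<forall>c<n. (\<Sum>r<n. w r * M r c) = 0) \<and> (\<exists>r<n. w r \<noteq> 0)"
      using w ** by (intro exI[of _ "\<lambda>r. vec_index w r"]) auto
  next
    fix w r assume w: "\<forall>c<n. (\<Sum>r<n. w r * M r c) = 0" "r < n" "w r \<noteq> 0"
    then have "vec n w \<noteq> 0\<^sub>v n" by (metis index_vec index_zero_vec(1))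
    then show "\<exists>w. w \<in> carrier_vec n \<and> w \<noteq> 0\<^sub>v n \<and> transpose_mat ?M *\<^sub>v w = 0\<^sub>v n"
      using w ** by (intro exI[of _ "vec n w"]) auto
  qed
  finally show ?thesis by blast
qed

text \<open>With \<open>Q\<close> the product of the forms from \<open>F\<close>, equal degrees turn
  \<open>det = Q * g\<close> into a nonzero constant multiple of \<open>Q\<close>. Cramer's rule
  writes any logarithmic derivation with numerators that \<open>Q\<close> divides too, hence with
  polynomial coefficients. That the determinant is nonzero follows from independence of the rows at
  the single point \<open>pt\<close>.\<close>

theorem saito_criterion:
  fixes A :: "'v::linorder arrangement"
  assumes I_def: "I = coords A" and n_def: "n = card (coords A)"
    and I: "finite I" and cent: "central A"
    and F: "finite F" "F \<subseteq> rspace I - {0}" "\<And>a. a \<in> F \<Longrightarrow> hyperplane I a 0 \<in> hyps A"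
    and np: "\<And>a b c. a \<in> F \<Longrightarrow> b \<in> F \<Longrightarrow> b = c *\<^sub>R a \<Longrightarrow> a = b"
    and len: "length \<theta>s = n" "length ds = n" and \<theta>s: "set \<theta>s \<subseteq> log_derivations A"
    and deg: "\<And>j i. j < n \<Longrightarrow> i \<in> I \<Longrightarrow> scale2 I ((\<theta>s ! j) (poly_var i)) = 2 ^ (ds ! j) * (\<theta>s ! j) (poly_var i)"
    and card: "card F = sum_list ds"
    and indep: "\<And>w. (\<And>i. i \<in> I \<Longrightarrow> (\<Sum>j<n. w j * poly_subst id pt ((\<theta>s ! j) (poly_var i))) = 0)
      \<Longrightarrow> \<forall>j<n. w j = 0"
  shows "free_with_exponents A (mset ds)"
proof -
  obtain e where e: "bij_betw e {..<n} I"
    using ex_bij_betw_nat_finite[OF I] by (auto simp: n_def I_def lessThan_atLeast0)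
  have eI: "e c \<in> I" if "c < n" for c using e that by (auto simp: bij_betw_def)
  have \<theta>: "\<theta>s ! j \<in> log_derivations A" if "j < n" for j using \<theta>s that len by auto
  then have \<theta>d: "\<theta>s ! j \<in> derivations I" if "j < n" for j
    using that by (auto simp: log_derivations_def I_def)
  define M where "M r c = (\<theta>s ! r) (poly_var (e c))" for r c
  have MR: "M r c \<in> poly_ring I" if "r < n" "c < n" for r c
    unfolding M_def using that eI by (intro derivation_closed[OF \<theta>d]) auto
  let ?det = "Determinant.det (mat n n (\<lambda>(i, j). M i j))"
  have det0: "?det \<noteq> 0"
  proof
    assume "?det = 0"
    have hid: "comm_ring_hom (id :: real \<Rightarrow> real)" by unfold_locales auto
    interpret comm_ring_hom "poly_subst id pt :: 'v rpoly \<Rightarrow> real"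
      by (rule comm_ring_hom_poly_subst[OF hid])
    have "Determinant.det (map_mat (poly_subst id pt) (mat n n (\<lambda>(i, j). M i j))) = 0"
      using \<open>?det = 0\<close> by simp
    also have "map_mat (poly_subst id pt) (mat n n (\<lambda>(i, j). M i j))
        = mat n n (\<lambda>(i, j). poly_subst id pt (M i j))"
      by (rule eq_matI) auto
    finally obtain w where w: "\<forall>c<n. (\<Sum>r<n. w r * poly_subst id pt (M r c)) = 0" "\<exists>r<n. w r \<noteq> 0"
      using row_kernel_trivial[of n "\<lambda>r c. poly_subst id pt (M r c)"] by blast
    have "(\<Sum>j<n. w j * poly_subst id pt ((\<theta>s ! j) (poly_var i))) = 0" if i: "i \<in> I" for i
    proof -
      obtain c where "c < n" "i = e c" using e i unfolding bij_betw_def by blast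
      then show ?thesis using w(1) by (auto simp: M_def)
    qed
    then show False using indep[of w] w(2) by blast
  qed
  let ?Q = "\<Prod>a\<in>F. linear_form I a"
  have Qdvd: "?Q dvd Determinant.det (mat n n (\<lambda>(i, j). \<theta> i (poly_var (e j))))"
    if "\<And>i. i < n \<Longrightarrow> \<theta> i \<in> log_derivations A" for \<theta>
    unfolding I_def
    by (rule prod_dvd_det_log_derivations[OF I[unfolded I_def] e[unfolded I_def] F(1)
          F(2,3)[unfolded I_def] np that])
  have "?Q dvd ?det" unfolding M_def by (rule Qdvd[OF \<theta>])
  then obtain g where g: "?det = ?Q * g" by (elim dvdE)
  have Q0: "?Q \<noteq> 0" using det0 g by auto
  \<comment> \<open>Row \<open>i\<close> consists of polynomials of degree \<open>ds ! i\<close>, so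
    each term of the Leibniz expansion has degree \<open>sum_list ds\<close>.\<close>
  have "scale2 I ?det = 2 ^ sum_list ds * ?det"
  proof -
    have pl: "p i < n" if "p permutes {0..<n}" "i < n" for p i
      using permutes_in_image[OF that(1), of i] that(2) by simp
    have "scale2 I ?det = Determinant.det (map_mat (scale2 I) (mat n n (\<lambda>(i, j). M i j)))"
      by (rule scale2.hom_det[symmetric])
    also have "map_mat (scale2 I) (mat n n (\<lambda>(i, j). M i j)) = mat n n (\<lambda>(i, j). 2 ^ (ds ! i) * M i j)"
      using deg eI by (intro eq_matI) (auto simp: M_def)
    also have "Determinant.det \<dots> = (\<Sum>p | p permutes {0..<n}. signof p * (\<Prod>i = 0..<n. 2 ^ (ds ! i) * M i (p i)))"
      by (subst det_def'[of _ n]) (auto intro!: sum.cong prod.cong simp: pl)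
    also have "\<dots> = (\<Sum>p | p permutes {0..<n}. (\<Prod>i = 0..<n. 2 ^ (ds ! i)) * (signof p * (\<Prod>i = 0..<n. M i (p i))))"
      by (simp add: prod.distrib mult_ac)
    also have "\<dots> = (\<Prod>i = 0..<n. 2 ^ (ds ! i)) * ?det"
      by (subst det_def'[of _ n])
        (auto intro!: sum.cong prod.cong simp: pl simp flip: sum_distrib_left)
    also have "(\<Prod>i = 0..<n. 2 ^ (ds ! i)) = (2 :: 'v rpoly) ^ sum_list ds"
      using len by (simp add: sum_list_sum_nth power_sum)
    finally show ?thesis .
  qed
  moreover have "scale2 I ?Q = 2 ^ card F * ?Q"
  proof -
    have "scale2 I (linear_form I a) = 2 * linear_form I a" for a
      by (simp add: linear_form_eq scale2.hom_sum scale2.hom_mult scale2_cst scale2_var sum_distrib_left mult_ac)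
    then show ?thesis by (simp add: scale2.hom_prod prod.distrib)
  qed
  ultimately have "2 ^ card F * (?Q * scale2 I g) = 2 ^ card F * (?Q * g)"
    by (simp add: g card scale2.hom_mult mult_ac)
  \<comment> \<open>The determinant and \<open>?Q\<close> have the same degree
    \<open>card F\<close>, which leaves degree 0 for \<open>g\<close>.\<close>
  then have "scale2 I g = g" using Q0 by simp
  then obtain \<gamma> where \<gamma>: "g = cst \<gamma>" by (rule scale2_fixed)
  have \<gamma>0: "\<gamma> \<noteq> 0" using det0 g \<gamma> by auto
  have ex: "\<exists>fs. length fs = n \<and> set fs \<subseteq> poly_ring I \<and> \<theta> = (\<lambda>p. \<Sum>j<n. fs ! j * (\<theta>s ! j) p)"
    if \<theta>L: "\<theta> \<in> log_derivations A" for \<theta>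
  proof -
    have \<theta>D: "\<theta> \<in> derivations I" using \<theta>L by (simp add: log_derivations_def I_def)
    define v where "v c = \<theta> (poly_var (e c))" for c
    \<comment> \<open>Replacing row \<open>r\<close> by the values of \<open>\<theta>\<close> gives
      again a matrix of logarithmic derivations.\<close>
    have "?Q dvd Determinant.det (mat n n (\<lambda>(i, j). if i = r then v j else M i j))" for r
    proof -
      have "(\<lambda>(i, j). (if i = r then \<theta> else \<theta>s ! i) (poly_var (e j)))
          = (\<lambda>(i, j). if i = r then v j else M i j)"
        by (auto simp: v_def M_def)
      then show ?thesis
        using Qdvd[of "\<lambda>i. if i = r then \<theta> else \<theta>s ! i"] \<theta> \<theta>L by auto
    qed
    then obtain u where u: "\<And>r. Determinant.det (mat n n (\<lambda>(i, j). if i = r then v j else M i j)) = ?Q * u r"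
      unfolding dvd_def by metis
    \<comment> \<open>The quotient \<open>u r\<close> comes from divisibility among all polynomials,
      hence the retraction; the factor removes the constant \<open>\<gamma>\<close> of the
      determinant.\<close>
    define f where "f r = retract I (cst (1 / \<gamma>) * u r)" for r
    have f: "f r \<in> poly_ring I" for r unfolding f_def by (rule retract_in_poly_ring)
    have "(\<Sum>r<n. f r * M r c) = v c" if c: "c < n" for c
    proof -
      have "?Q * (\<Sum>r<n. u r * M r c) = ?Q * (cst \<gamma> * v c)"
        using cramer_row[OF c, of v M] by (simp add: u g \<gamma> sum_distrib_left mult.assoc)
      then have "(\<Sum>r<n. u r * M r c) = cst \<gamma> * v c" by (simp only: mult_left_cancel[OF Q0])
      then have "cst (1 / \<gamma>) * (\<Sum>r<n. u r * M r c) = (cst (1 / \<gamma>) * cst \<gamma>) * v c"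
        by (simp add: mult.assoc)
      also have "cst (1 / \<gamma>) * cst \<gamma> = (1 :: 'v rpoly)" using \<gamma>0 by (simp flip: cst.hom_mult)
      finally have "retract I (\<Sum>r<n. (cst (1 / \<gamma>) * u r) * M r c) = retract I (v c)"
        by (simp add: sum_distrib_left mult.assoc)
      moreover have "v c \<in> poly_ring I"
        unfolding v_def using eI[OF c] by (intro derivation_closed[OF \<theta>D]) simp
      ultimately show ?thesis
        using MR c by (simp add: retract.hom_sum retract.hom_mult[of I _ "M _ c"] retract_id f_def)
    qed
    then have "\<theta> (poly_var i) = (\<Sum>j<n. f j * (\<theta>s ! j) (poly_var i))" if "i \<in> I" for i
      using e that by (auto simp: bij_betw_def M_def v_def)
    then have "\<theta> = (\<lambda>p. \<Sum>j<n. f j * (\<theta>s ! j) p)"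
      by (intro derivation_eqI[OF \<theta>D derivation_combination]) (use \<theta>d f in auto)
    then show ?thesis
      using f by (intro exI[of _ "map f [0..<n]"]) auto
  qed
  have uniq: "fs = gs"
    if fs: "length fs = n" and gs: "length gs = n"
      and eq: "(\<lambda>p. \<Sum>j<n. fs ! j * (\<theta>s ! j) p) = (\<lambda>p. \<Sum>j<n. gs ! j * (\<theta>s ! j) p)" for fs gs
  proof -
    have "(\<Sum>r<n. (fs ! r - gs ! r) * M r c) = 0" for c
      using fun_cong[OF eq, of "poly_var (e c)"] by (simp add: M_def left_diff_distrib sum_subtractf)
    then have "\<forall>r<n. fs ! r - gs ! r = 0"
      using det0 row_kernel_trivial[of n M] by (auto dest!: spec[of _ "\<lambda>r. fs ! r - gs ! r"])
    then show ?thesis using fs gs by (auto intro: nth_equalityI)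
  qed
  have "log_basis A \<theta>s"
    unfolding log_basis_def len I_def[symmetric]
  proof (intro conjI ballI \<theta>s)
    fix \<theta> assume "\<theta> \<in> log_derivations A"
    then obtain fs where "length fs = n \<and> set fs \<subseteq> poly_ring I \<and> \<theta> = (\<lambda>p. \<Sum>j<n. fs ! j * (\<theta>s ! j) p)"
      using ex by blast
    then show "\<exists>!fs. length fs = n \<and> set fs \<subseteq> poly_ring I \<and> \<theta> = (\<lambda>p. \<Sum>j<n. fs ! j * (\<theta>s ! j) p)"
      by (intro ex1I[of _ fs]) (use uniq in \<open>blast+\<close>)
  qed
  moreover have "list_all2 (homogeneous_der I) ds \<theta>s"
    unfolding list_all2_conv_all_nth homogeneous_der_def
    using len by (auto intro!: scale2_eigenvector(2)[of I] deg)
  ultimately show ?thesis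
    using cent by (auto simp: free_with_exponents_def I_def)
qed

section \<open>Arrangements of integral gain graphs and their cones\<close>

text \<open>Points supported on \<open>j\<close>, where \<open>b\<close> does not vanish, and one
  further coordinate already determine the ratio. This removes the choice of an equation from the
  definitions of the cone and of logarithmic derivations.\<close>

lemma hyperplane_eq_imp_proportional:
  fixes a b :: "'v \<Rightarrow>\<^sub>0 real"
  assumes I: "finite I" and a: "a \<in> rspace I" "a \<noteq> 0" and b: "b \<in> rspace I" "b \<noteq> 0"
    and eq: "hyperplane I a c = hyperplane I b d"
  shows "\<exists>r. r \<noteq> 0 \<and> a = r *\<^sub>R b \<and> c = r * d"
proof -
  let ?l = "Poly_Mapping.lookup :: ('v \<Rightarrow>\<^sub>0 real) \<Rightarrow> 'v \<Rightarrow> real"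
  obtain j where j: "?l b j \<noteq> 0" using b(2) by (metis poly_mapping_eqI lookup_zero)
  then have jI: "j \<in> I" using b(1) by (auto simp: rspace_def in_keys_iff)
  have dot: "(\<Sum>i\<in>I. ?l v i * ?l (Poly_Mapping.single k s) i) = ?l v k * s" if "k \<in> I" for v k s
  proof -
    have "?l v i * ?l (Poly_Mapping.single k s) i = (if k = i then ?l v k * s else 0)" for i
      by (simp add: lookup_single)
    then show ?thesis using I that by simp
  qed
  have dot2: "(\<Sum>i\<in>I. ?l v i * ?l (Poly_Mapping.single j s + Poly_Mapping.single k t) i)
      = ?l v j * s + ?l v k * t" if "k \<in> I" for v k s t
    using dot[OF jI, of v s] dot[OF that, of v t] by (simp add: lookup_add distrib_left sum.distrib)
  have mem: "Poly_Mapping.single j s + Poly_Mapping.single k t \<in> hyperplane I v e \<longleftrightarrow> ?l v j * s + ?l v k * t = e"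
    if "k \<in> I" for v k s t e
  proof -
    have "Poly_Mapping.single j s + Poly_Mapping.single k t \<in> rspace I"
      using that jI keys_add[of "Poly_Mapping.single j s" "Poly_Mapping.single k t"]
      by (auto simp: rspace_def split: if_splits)
    then show ?thesis by (simp add: hyperplane_def dot2[OF that])
  qed
  define r where "r = ?l a j / ?l b j"
  have "Poly_Mapping.single j (d / ?l b j) + Poly_Mapping.single j 0 \<in> hyperplane I b d"
    unfolding mem[OF jI] using j by simp
  then have c: "c = r * d" unfolding eq[symmetric] mem[OF jI] using j by (simp add: r_def)
  have "?l a k = r * ?l b k" for k
  proof (cases "k \<in> I")
    case True
    have "Poly_Mapping.single j ((d - ?l b k) / ?l b j) + Poly_Mapping.single k 1 \<in> hyperplane I b d"
      unfolding mem[OF True] using j by simp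
    then have "?l a j * ((d - ?l b k) / ?l b j) + ?l a k = r * d"
      unfolding eq[symmetric] mem[OF True] c by simp
    then show ?thesis using j by (simp add: r_def field_simps)
  next
    case False
    then show ?thesis using a(1) b(1) by (metis in_keys_iff mem_Collect_eq mult_zero_right rspace_def subsetD)
  qed
  then have ar: "a = r *\<^sub>R b" by (intro poly_mapping_eqI) (simp add: lookup_scaleR)
  then have "r \<noteq> 0" using a(2) by auto
  then show ?thesis using ar c by blast
qed

text \<open>The definition tests every equation of every hyperplane; by proportionality one normal
  per hyperplane suffices.\<close>

lemma log_derivations_intro:
  assumes I: "finite (coords A)" and \<theta>: "\<theta> \<in> derivations (coords A)"
    and B: "hyps A \<subseteq> (\<lambda>b. hyperplane (coords A) b 0) ` B" "B \<subseteq> ambient A - {0}"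
    and dvd: "\<And>b. b \<in> B \<Longrightarrow> linear_form (coords A) b dvd \<theta> (linear_form (coords A) b)"
  shows "\<theta> \<in> log_derivations A"
proof -
  have "\<exists>q\<in>poly_ring (coords A). \<theta> (linear_form (coords A) a) = linear_form (coords A) a * q"
    if a: "a \<in> ambient A" "a \<noteq> 0" "hyperplane (coords A) a 0 \<in> hyps A" for a
  proof -
    obtain b where b: "b \<in> B" "hyperplane (coords A) a 0 = hyperplane (coords A) b 0"
      using B(1) a(3) by blast
    then have "b \<in> ambient A" "b \<noteq> 0" using B(2) by auto
    then obtain r where "a = r *\<^sub>R b"
      using hyperplane_eq_imp_proportional[OF I a(1,2) _ _ b(2)] by blast
    moreover have "\<theta> (cst r * linear_form (coords A) b) = cst r * \<theta> (linear_form (coords A) b)"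
      using derivation_mult[OF \<theta>] derivation_cst[OF \<theta>] by simp
    ultimately have "linear_form (coords A) a dvd \<theta> (linear_form (coords A) a)"
      using dvd[OF b(1)] by (simp add: linear_form_scaleR mult_dvd_mono)
    then show ?thesis
      by (intro dvd_in_poly_ring derivation_closed[OF \<theta>]) auto
  qed
  then show ?thesis
    using \<theta> unfolding log_derivations_def by simp
qed

text \<open>A triple \<open>(i, j, c)\<close> stands for the hyperplane \<open>x\<^sub>i - x\<^sub>j = c\<close>. The index \<open>0\<close> is never a
  coordinate, so \<open>x\<^sub>0 = 0\<close> and the hyperplane \<open>x\<^sub>i = c\<close> is given by \<open>(i, 0, c)\<close>.\<close>

definition gain_hyp :: "nat set \<Rightarrow> nat \<times> nat \<times> int \<Rightarrow> (nat \<Rightarrow>\<^sub>0 real) set" where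
  "gain_hyp I = (\<lambda>(i, j, c). {x \<in> rspace I. Poly_Mapping.lookup x i - Poly_Mapping.lookup x j = of_int c})"

definition gain_arr :: "nat set \<Rightarrow> (nat \<times> nat \<times> int) set \<Rightarrow> nat arrangement" where
  "gain_arr I T = \<lparr> coords = I, hyps = gain_hyp I ` T \<rparr>"

text \<open>The clause \<open>(j, i, - c) \<notin> T\<close> keeps a hyperplane from being listed
  with both orientations, so that \<open>card T\<close> counts hyperplanes.\<close>

definition gains :: "nat set \<Rightarrow> (nat \<times> nat \<times> int) set \<Rightarrow> bool" where
  "gains I T \<longleftrightarrow> finite I \<and> finite T \<and> 0 \<notin> I \<and>
     (\<forall>(i, j, c)\<in>T. i \<in> I \<and> j \<in> insert 0 I \<and> i \<noteq> j \<and> (j, i, - c) \<notin> T)"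

definition cone_hyp :: "nat set \<Rightarrow> nat \<times> nat \<times> int \<Rightarrow> (nat option \<Rightarrow>\<^sub>0 real) set" where
  "cone_hyp I = (\<lambda>(i, j, c). {y \<in> rspace (cone_coords I). Poly_Mapping.lookup y (Some i)
     - Poly_Mapping.lookup y (Some j) = of_int c * Poly_Mapping.lookup y None})"

definition infinity_hyp :: "nat set \<Rightarrow> (nat option \<Rightarrow>\<^sub>0 real) set" where
  "infinity_hyp I = {y \<in> rspace (cone_coords I). Poly_Mapping.lookup y None = 0}"

definition gain_vec :: "nat \<Rightarrow> nat \<Rightarrow> nat \<Rightarrow>\<^sub>0 real" where
  "gain_vec i j = Poly_Mapping.single i 1 - (if j = 0 then 0 else Poly_Mapping.single j 1)"

definition cone_vec :: "nat \<times> nat \<times> int \<Rightarrow> nat option \<Rightarrow>\<^sub>0 real" where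
  "cone_vec = (\<lambda>(i, j, c). Poly_Mapping.single (Some i) 1
     - (if j = 0 then 0 else Poly_Mapping.single (Some j) 1) - Poly_Mapping.single None (of_int c))"

lemma coords_gain_arr [simp]: "coords (gain_arr I T) = I"
  and hyps_gain_arr [simp]: "hyps (gain_arr I T) = gain_hyp I ` T"
  by (simp_all add: gain_arr_def)

definition gain_sign :: "nat \<Rightarrow> nat \<Rightarrow> nat \<Rightarrow> 'a::comm_ring_1" where
  "gain_sign i j k = (if k = i then 1 else if k = j \<and> k \<noteq> 0 then -1 else 0)"

lemma lookup_gain_vec:
  "i \<noteq> j \<Longrightarrow> i \<noteq> 0 \<Longrightarrow> Poly_Mapping.lookup (gain_vec i j) k = gain_sign i j k"
  by (auto simp: gain_sign_def gain_vec_def lookup_minus lookup_single when_def)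

lemma lookup_cone_vec:
  "i \<noteq> j \<Longrightarrow> i \<noteq> 0 \<Longrightarrow> Poly_Mapping.lookup (cone_vec (i, j, c)) k = (case k of None \<Rightarrow> - of_int c
     | Some k \<Rightarrow> gain_sign i j k)"
  by (auto simp: gain_sign_def cone_vec_def lookup_minus lookup_single when_def split: option.splits)

lemma cst_gain_sign: "cst (gain_sign i j k) = gain_sign i j k"
  by (simp add: gain_sign_def cst.hom_uminus)

lemma sum_gain:
  fixes f :: "nat \<Rightarrow> 'a::comm_ring_1"
  assumes "finite I" "i \<in> I" "j \<in> insert 0 I" "i \<noteq> j" "0 \<notin> I"
  shows "(\<Sum>k\<in>I. gain_sign i j k * f k) = f i - (if j = 0 then 0 else f j)"
proof -
  have "(\<Sum>k\<in>I. gain_sign i j k * f k) = (\<Sum>k\<in>I. (if k = i then f k else 0) - (if k = j then f k else 0))"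
    using assms by (intro sum.cong) (auto simp: gain_sign_def)
  also have "\<dots> = f i - (if j = 0 then 0 else f j)"
    using assms by (auto simp: sum_subtractf)
  finally show ?thesis .
qed

lemma sum_cone_coords:
  "finite I \<Longrightarrow> (\<Sum>v\<in>cone_coords I. f v) = f None + (\<Sum>i\<in>I. f (Some i))"
  unfolding cone_coords_def by (subst sum.insert) (auto simp: sum.reindex)

lemma finite_cone_coords [simp]: "finite (cone_coords I) \<longleftrightarrow> finite I"
  by (auto simp: cone_coords_def dest: finite_imageD)

lemma Some_in_cone_coords [simp]: "Some i \<in> cone_coords I \<longleftrightarrow> i \<in> I"
  and None_in_cone_coords [simp]: "None \<in> cone_coords I"
  by (auto simp: cone_coords_def)

lemma card_cone_coords: "finite I \<Longrightarrow> card (cone_coords I) = Suc (card I)"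
  unfolding cone_coords_def by (subst card_insert_disjoint) (auto simp: card_image)

lemma lookup_rspace_0: "x \<in> rspace I \<Longrightarrow> i \<notin> I \<Longrightarrow> Poly_Mapping.lookup x i = 0"
  by (auto simp: rspace_def in_keys_iff)

context
  fixes I :: "nat set" and T :: "(nat \<times> nat \<times> int) set"
  assumes gains: "gains I T"
begin

lemma finite_gains: "finite I" "finite T" "0 \<notin> I"
  using gains by (auto simp: gains_def)

lemma gains_tripleD:
  assumes "(i, j, c) \<in> T"
  shows "i \<in> I" "j \<in> insert 0 I" "i \<noteq> j" "i \<noteq> 0" "(j, i, - c) \<notin> T"
  using assms gains unfolding gains_def by (fastforce dest: bspec)+

lemma gain_vec_rspace: "(i, j, c) \<in> T \<Longrightarrow> gain_vec i j \<in> rspace I - {0}"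
proof -
  assume t: "(i, j, c) \<in> T"
  note d = gains_tripleD[OF t]
  have "Poly_Mapping.lookup (gain_vec i j) i \<noteq> 0" using d by (simp add: lookup_gain_vec gain_sign_def)
  moreover have "gain_vec i j \<in> rspace I"
    using d by (auto simp: rspace_def in_keys_iff lookup_gain_vec gain_sign_def split: if_splits)
  ultimately show ?thesis by auto
qed

lemma cone_vec_rspace: "t \<in> T \<Longrightarrow> cone_vec t \<in> rspace (cone_coords I) - {0}"
proof -
  assume t: "t \<in> T"
  obtain i j c where [simp]: "t = (i, j, c)" by (cases t)
  note d = gains_tripleD[OF t[unfolded \<open>t = _\<close>]]
  have "Poly_Mapping.lookup (cone_vec t) (Some i) \<noteq> 0" using d by (simp add: lookup_cone_vec gain_sign_def)
  moreover have "cone_vec t \<in> rspace (cone_coords I)"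
    using d by (auto simp: rspace_def in_keys_iff lookup_cone_vec gain_sign_def split: if_splits option.splits)
  ultimately show ?thesis by auto
qed

lemma gain_hyp_eq: "(i, j, c) \<in> T \<Longrightarrow> gain_hyp I (i, j, c) = hyperplane I (gain_vec i j) (of_int c)"
  using gains_tripleD[of i j c] finite_gains
  by (auto simp: gain_hyp_def hyperplane_def lookup_gain_vec sum_gain lookup_rspace_0)

lemma cone_hyp_eq: "t \<in> T \<Longrightarrow> cone_hyp I t = hyperplane (cone_coords I) (cone_vec t) 0"
proof -
  assume t: "t \<in> T"
  obtain i j c where [simp]: "t = (i, j, c)" by (cases t)
  note d = gains_tripleD[OF t[unfolded \<open>t = _\<close>]]
  have "(\<Sum>v\<in>cone_coords I. Poly_Mapping.lookup (cone_vec t) v * Poly_Mapping.lookup y v)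
      = Poly_Mapping.lookup y (Some i) - Poly_Mapping.lookup y (Some j) - of_int c * Poly_Mapping.lookup y None"
    if "y \<in> rspace (cone_coords I)" for y
    using d finite_gains that
    by (auto simp: sum_cone_coords lookup_cone_vec sum_gain lookup_rspace_0)
  then show ?thesis by (auto simp: cone_hyp_def hyperplane_def)
qed

lemma infinity_hyp_eq: "infinity_hyp I = hyperplane (cone_coords I) (Poly_Mapping.single None 1) 0"
  using finite_gains by (auto simp: infinity_hyp_def hyperplane_def sum_cone_coords lookup_single)

text \<open>The cone homogenizes all equations of a hyperplane; they differ by a nonzero factor,
  which cancels.\<close>

lemma hyps_cone_gain_arr: "hyps (arr_cone (gain_arr I T)) = insert (infinity_hyp I) (cone_hyp I ` T)"
proof -
  have eq: "{y \<in> rspace (cone_coords I). (\<Sum>k\<in>I. Poly_Mapping.lookup (gain_vec i j) k * Poly_Mapping.lookup y (Some k))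
      = of_int c * Poly_Mapping.lookup y None} = cone_hyp I (i, j, c)" if t: "(i, j, c) \<in> T" for i j c
    using gains_tripleD[OF t] finite_gains
    by (auto simp: cone_hyp_def lookup_gain_vec sum_gain lookup_rspace_0)
  have "{{y \<in> rspace (cone_coords I). (\<Sum>i\<in>I. Poly_Mapping.lookup a i * Poly_Mapping.lookup y (Some i))
             = c * Poly_Mapping.lookup y None} | a c. a \<in> rspace I \<and> a \<noteq> 0 \<and> hyperplane I a c \<in> gain_hyp I ` T}
      = cone_hyp I ` T" (is "?L = ?R")
  proof (intro subset_antisym subsetI)
    fix K assume "K \<in> ?L"
    then obtain a c where K: "K = {y \<in> rspace (cone_coords I).
          (\<Sum>i\<in>I. Poly_Mapping.lookup a i * Poly_Mapping.lookup y (Some i)) = c * Poly_Mapping.lookup y None}"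
      and a: "a \<in> rspace I" "a \<noteq> 0" and "hyperplane I a c \<in> gain_hyp I ` T" by blast
    then obtain i j d where t: "(i, j, d) \<in> T" "hyperplane I a c = gain_hyp I (i, j, d)" by auto
    then have "hyperplane I a c = hyperplane I (gain_vec i j) (of_int d)" by (simp add: gain_hyp_eq)
    then obtain r where r: "r \<noteq> 0" "a = r *\<^sub>R gain_vec i j" "c = r * of_int d"
      using hyperplane_eq_imp_proportional[OF finite_gains(1) a] gain_vec_rspace[OF t(1)] by blast
    have "K = cone_hyp I (i, j, d)"
      unfolding K eq[OF t(1), symmetric] r(2,3)
      using r(1) by (simp add: lookup_scaleR mult.assoc flip: sum_distrib_left)
    then show "K \<in> ?R" using t(1) by blast
  next
    fix K assume "K \<in> ?R"
    then obtain i j c where t: "(i, j, c) \<in> T" and K: "K = cone_hyp I (i, j, c)" by auto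
    then show "K \<in> ?L"
      using gain_vec_rspace[OF t] gain_hyp_eq[OF t] eq[OF t]
      by (auto intro!: exI[of _ "gain_vec i j"] exI[of _ "real_of_int c"])
  qed
  then show ?thesis by (simp add: arr_cone_def infinity_hyp_def)
qed

lemma coords_cone_gain_arr: "coords (arr_cone (gain_arr I T)) = cone_coords I"
  by (simp add: arr_cone_def)

lemma central_cone_gain_arr: "central (arr_cone (gain_arr I T))"
  unfolding central_def hyps_cone_gain_arr
  by (auto simp: infinity_hyp_def cone_hyp_def rspace_def)

text \<open>Proportional normals have the same support. Equal first indices force the factor
  \<open>1\<close>; exchanged indices force \<open>-1\<close> and the opposite offset, which
  \<open>gains\<close> excludes.\<close>

lemma cone_vecs_nonproportional:
  assumes "a \<in> insert (Poly_Mapping.single None 1) (cone_vec ` T)"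
    "b \<in> insert (Poly_Mapping.single None 1) (cone_vec ` T)" and b: "b = r *\<^sub>R a"
  shows "a = b"
proof -
  have l: "Poly_Mapping.lookup b k = r * Poly_Mapping.lookup a k" for k
    using b by (simp add: lookup_scaleR)
  consider "a = Poly_Mapping.single None 1" "b = Poly_Mapping.single None 1"
    | i j c where "a = Poly_Mapping.single None 1" "b = cone_vec (i, j, c)" "(i, j, c) \<in> T"
    | i j c where "b = Poly_Mapping.single None 1" "a = cone_vec (i, j, c)" "(i, j, c) \<in> T"
    | i j c i' j' c' where "a = cone_vec (i, j, c)" "(i, j, c) \<in> T" "b = cone_vec (i', j', c')" "(i', j', c') \<in> T"
    using assms(1,2) by force
  then show ?thesis
  proof cases
    case 1
    then show ?thesis by simp
  next
    case 2
    then show ?thesis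
      using l[of "Some i"] gains_tripleD[OF 2(3)] by (simp add: lookup_cone_vec gain_sign_def lookup_single)
  next
    case 3
    then show ?thesis
      using l[of "Some i"] l[of None] gains_tripleD[OF 3(3)] by (simp add: lookup_cone_vec gain_sign_def lookup_single)
  next
    case 4
    note d = gains_tripleD[OF 4(2)] and d' = gains_tripleD[OF 4(4)]
    note l' = l[unfolded 4(1,3) lookup_cone_vec[OF d(3,4)] lookup_cone_vec[OF d'(3,4)]]
    have 1: "i' = i \<or> i' = j" using l'[of "Some i'"] by (auto simp: gain_sign_def split: if_splits)
    have 2: "i = i' \<or> i = j'" using l'[of "Some i"] l'[of "Some i'"] by (auto simp: gain_sign_def split: if_splits)
    show ?thesis
    proof (cases "i' = i")
      case True
      then have "r = 1" using l'[of "Some i"] by (simp add: gain_sign_def)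
      then show ?thesis using b by simp
    next
      case False
      then have eq: "i' = j" "j' = i" using 1 2 by auto
      then have "r = -1" using l'[of "Some i"] False d by (simp add: gain_sign_def)
      then have "c' = - c" using l'[of None] by (simp flip: of_int_minus)
      then show ?thesis using 4 d(5) eq by simp
    qed
  qed
qed

lemma inj_on_cone_vec: "inj_on cone_vec T"
proof (rule inj_onI)
  fix s t assume st: "s \<in> T" "t \<in> T" "cone_vec s = cone_vec t"
  obtain i j c i' j' c' where s: "s = (i, j, c)" and t: "t = (i', j', c')" by (cases s; cases t)
  note d = gains_tripleD[OF st(1)[unfolded s]] and d' = gains_tripleD[OF st(2)[unfolded t]]
  have l: "Poly_Mapping.lookup (cone_vec (i, j, c)) k = Poly_Mapping.lookup (cone_vec (i', j', c')) k" for k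
    using st s t by simp
  note l' = l[unfolded lookup_cone_vec[OF d(3,4)] lookup_cone_vec[OF d'(3,4)]]
  have "i = i'" using l'[of "Some i"] by (auto simp: gain_sign_def split: if_splits)
  moreover have "j = j'"
    using l'[of "Some j"] l'[of "Some j'"] d d' \<open>i = i'\<close> by (auto simp: gain_sign_def split: if_splits)
  moreover have "c = c'" using l'[of None] by simp
  ultimately show "s = t" using s t by simp
qed

end

section \<open>Derivations given by a polynomial in one variable\<close>

abbreviation Zv :: "nat option rpoly" where "Zv \<equiv> poly_var None"

text \<open>\<open>Xv 0 = 0\<close> stands for the fixed coordinate, so weights and edges obey one
  and the same divisibility condition.\<close>

definition Xv :: "nat \<Rightarrow> nat option rpoly" where
  "Xv i = (if i = 0 then 0 else poly_var (Some i))"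

lemma linear_form_cone_vec:
  assumes "gains I T" "(i, j, c) \<in> T"
  shows "linear_form (cone_coords I) (cone_vec (i, j, c)) = Xv i - Xv j - of_int c * Zv"
proof -
  note d = gains_tripleD[OF assms] and f = finite_gains[OF assms(1)]
  have [simp]: "cst (of_int c) = of_int c" for c by (simp add: cst_def)
  have "linear_form (cone_coords I) (cone_vec (i, j, c))
      = cst (- of_int c) * Zv + (poly_var (Some i) - (if j = 0 then 0 else poly_var (Some j)))"
    using d f by (simp add: linear_form_eq sum_cone_coords lookup_cone_vec cst_gain_sign sum_gain)
  then show ?thesis using d by (simp add: Xv_def cst.hom_uminus)
qed

text \<open>Joint homogeneity in \<open>t\<close> and the variables: the coefficient of
  \<open>t^m\<close> has degree \<open>d - m\<close>. The factor \<open>2 ^ m\<close> on the left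
  avoids a subtraction of exponents.\<close>

definition poly_homogeneous :: "nat set \<Rightarrow> nat \<Rightarrow> nat option rpoly poly \<Rightarrow> bool" where
  "poly_homogeneous I d P \<longleftrightarrow>
     (\<forall>m. scale2 (cone_coords I) (poly.coeff P m) * 2 ^ m = 2 ^ d * poly.coeff P m)"

lemma scale2_poly:
  assumes P: "poly_homogeneous I d P" and x: "scale2 (cone_coords I) x = 2 * x"
  shows "scale2 (cone_coords I) (poly P x) = 2 ^ d * poly P x"
proof -
  have "scale2 (cone_coords I) (poly P x)
      = (\<Sum>m\<le>degree P. (scale2 (cone_coords I) (poly.coeff P m) * 2 ^ m) * x ^ m)"
    by (simp add: poly_altdef scale2.hom_sum scale2.hom_mult scale2.hom_power x power_mult_distrib mult_ac)
  also have "\<dots> = 2 ^ d * poly P x"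
    using P by (simp add: poly_homogeneous_def poly_altdef sum_distrib_left mult_ac)
  finally show ?thesis .
qed

text \<open>The point is taken on \<open>z = 1\<close>, where differences with step \<open>z\<close>
  become differences with step \<open>1\<close>.\<close>

definition pt_eval :: "(nat \<Rightarrow> real) \<Rightarrow> nat option rpoly \<Rightarrow> real" where
  "pt_eval p = poly_subst id (\<lambda>v. case v of None \<Rightarrow> 1 | Some i \<Rightarrow> p i)"

lemma comm_ring_hom_pt_eval: "comm_ring_hom (pt_eval p)"
proof -
  have "comm_ring_hom (id :: real \<Rightarrow> real)" by unfold_locales auto
  then show ?thesis unfolding pt_eval_def by (rule comm_ring_hom_poly_subst)
qed

interpretation pt_eval: comm_ring_hom "pt_eval p" for p by (rule comm_ring_hom_pt_eval)

lemma pt_eval_Zv [simp]: "pt_eval p Zv = 1"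
  and pt_eval_Xv: "i \<noteq> 0 \<Longrightarrow> pt_eval p (Xv i) = p i"
  and pt_eval_cst [simp]: "pt_eval p (cst c) = c"
proof -
  have *: "comm_ring_hom (id :: real \<Rightarrow> real)" by unfold_locales auto
  show "pt_eval p Zv = 1" "i \<noteq> 0 \<Longrightarrow> pt_eval p (Xv i) = p i" "pt_eval p (cst c) = c"
    unfolding pt_eval_def Xv_def by (simp_all add: poly_subst_var[OF *] poly_subst_cst[OF *])
qed

text \<open>Each \<open>P\<close> defines the derivation with \<open>z \<mapsto> 0\<close> and
  \<open>x_i \<mapsto> P(x_i)\<close>; the Euler derivation supplies the exponent 1. It alone moves
  \<open>z\<close>, so its coefficient in a dependency vanishes, and what remains is the situation
  of \<open>indep\<close>.\<close>

theorem free_cone_gain_arr: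
  assumes gains: "gains I T"
    and len: "length Ps = card I" "length ds = card I"
    and dvd: "\<And>P i j c. P \<in> set Ps \<Longrightarrow> (i, j, c) \<in> T \<Longrightarrow> Xv i - Xv j - of_int c * Zv dvd poly P (Xv i) - poly P (Xv j)"
    and zero: "\<And>P i c. P \<in> set Ps \<Longrightarrow> (i, 0, c) \<in> T \<Longrightarrow> poly P 0 = 0"
    and hom: "\<And>r. r < card I \<Longrightarrow> poly_homogeneous I (ds ! r) (Ps ! r)"
    and card: "card T = sum_list ds"
    and indep: "\<And>w. (\<And>i. i \<in> I \<Longrightarrow> (\<Sum>r<card I. w r * pt_eval p (poly (Ps ! r) (Xv i))) = 0)
      \<Longrightarrow> \<forall>r<card I. w r = 0"
  shows "free_with_exponents (arr_cone (gain_arr I T)) (add_mset 1 (mset ds))"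
proof -
  let ?A = "arr_cone (gain_arr I T)" and ?J = "cone_coords I"
  let ?B = "insert (Poly_Mapping.single None 1) (cone_vec ` T) :: (nat option \<Rightarrow>\<^sub>0 real) set"
  note f = finite_gains[OF gains]
  have fJ: "finite ?J" using f by simp
  have J: "coords ?A = ?J" by (rule coords_cone_gain_arr[OF gains])
  have s1: "Poly_Mapping.single None 1 \<in> rspace ?J - {0}"
    by (simp add: rspace_def) (metis lookup_single_eq lookup_zero zero_neq_one)
  have B: "?B \<subseteq> rspace ?J - {0}" using cone_vec_rspace[OF gains] s1 by auto
  have hB: "hyps ?A = (\<lambda>b. hyperplane ?J b 0) ` ?B"
    unfolding hyps_cone_gain_arr[OF gains] infinity_hyp_eq[OF gains] image_insert image_image
    by (intro arg_cong2[where f = insert] refl image_cong cone_hyp_eq[OF gains])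
  define val where "val P v = (case v of None \<Rightarrow> 0 | Some i \<Rightarrow> poly P (Xv i))" for P v
  define \<theta>s where "\<theta>s = der_of ?J poly_var # map (\<lambda>P. der_of ?J (val P)) Ps"
  have sX: "scale2 ?J (Xv i) = 2 * Xv i" if "i \<in> I" for i using that by (simp add: Xv_def scale2_var)
  have valJ: "val P v \<in> poly_ring ?J" if "P \<in> set Ps" "v \<in> ?J" for P v
  proof -
    obtain r where r: "r < card I" "P = Ps ! r" using \<open>P \<in> set Ps\<close> len by (auto simp: in_set_conv_nth)
    show ?thesis
    proof (cases v)
      case (Some i)
      then show ?thesis
        using scale2_eigenvector(1)[OF scale2_poly[OF hom[OF r(1)] sX]] that r by (simp add: val_def)
    qed (simp add: val_def)
  qed
  have der: "der_of ?J (val P) \<in> derivations ?J" if "P \<in> set Ps" for P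
    by (rule der_of_derivation) (use valJ that in auto)
  have derE: "der_of ?J poly_var \<in> derivations ?J"
    by (rule der_of_derivation) auto
  have E: "der_of ?J poly_var (linear_form ?J a) = linear_form ?J a" for a
    unfolding derivation_linear_form[OF derE] by (simp add: der_of_var linear_form_eq)
  have \<theta>P: "der_of ?J (val P) (linear_form ?J a) = (\<Sum>i\<in>I. cst (Poly_Mapping.lookup a (Some i)) * poly P (Xv i))"
    if "P \<in> set Ps" for P a
    using that f by (simp add: derivation_linear_form[OF der] der_of_var sum_cone_coords val_def)
  have log: "\<theta> \<in> log_derivations ?A" if \<theta>: "\<theta> \<in> set \<theta>s" for \<theta>
  proof (rule log_derivations_intro[where A = ?A and B = ?B, unfolded J])
    show "finite ?J" "hyps ?A \<subseteq> (\<lambda>b. hyperplane ?J b 0) ` ?B" "?B \<subseteq> rspace ?J - {0}"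
      using fJ hB B by simp_all
    show "\<theta> \<in> derivations ?J" using \<theta> der derE by (auto simp: \<theta>s_def)
    fix b assume b: "b \<in> ?B"
    consider "\<theta> = der_of ?J poly_var" | P where "P \<in> set Ps" "\<theta> = der_of ?J (val P)"
      using \<theta> by (auto simp: \<theta>s_def)
    then show "linear_form ?J b dvd \<theta> (linear_form ?J b)"
    proof cases
      case 1
      then show ?thesis by (simp add: E)
    next
      case 2
      show ?thesis
      proof (cases "b = Poly_Mapping.single None 1")
        case True
        then show ?thesis using 2 by (simp add: \<theta>P lookup_single)
      next
        case False
        then obtain i j c where t: "(i, j, c) \<in> T" "b = cone_vec (i, j, c)" using b by auto
        note d = gains_tripleD[OF gains t(1)]
        have "\<theta> (linear_form ?J b) = poly P (Xv i) - (if j = 0 then 0 else poly P (Xv j))"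
          unfolding 2(2) \<theta>P[OF 2(1)] t(2) lookup_cone_vec[OF d(3,4)]
          using f d by (simp add: sum_gain cst_gain_sign)
        \<comment> \<open>For a weight, where \<open>j = 0\<close>, the form has no second variable;
          \<open>P(0) = 0\<close> lets it be treated as a difference with
          \<open>x_0 = 0\<close>.\<close>
        also have "\<dots> = poly P (Xv i) - poly P (Xv j)"
          using zero[OF 2(1)] t(1) by (auto simp: Xv_def)
        finally show ?thesis
          using dvd[OF 2(1) t(1)] linear_form_cone_vec[OF gains t(1)] t(2) by simp
      qed
    qed
  qed
  have val\<theta>: "(\<theta>s ! 0) (poly_var v) = poly_var v" "r < card I \<Longrightarrow> (\<theta>s ! Suc r) (poly_var v) = val (Ps ! r) v"
    if "v \<in> ?J" for v r
    using that len by (simp_all add: \<theta>s_def der_of_var)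
  have "free_with_exponents ?A (mset (1 # ds))"
  proof (rule saito_criterion[where I = ?J and n = "card ?J" and F = ?B and \<theta>s = \<theta>s
        and pt = "\<lambda>v. case v of None \<Rightarrow> 1 | Some i \<Rightarrow> p i"])
    show "?J = coords ?A" "card ?J = card (coords ?A)" by (simp_all add: J)
    show "finite ?J" "central ?A" "?B \<subseteq> rspace ?J - {0}" "set \<theta>s \<subseteq> log_derivations ?A"
      "length \<theta>s = card ?J" "length (1 # ds) = card ?J" "finite ?B"
      using fJ central_cone_gain_arr[OF gains] B log len f by (auto simp: \<theta>s_def card_cone_coords)
    show "hyperplane ?J a 0 \<in> hyps ?A" if "a \<in> ?B" for a using that unfolding hB by blast
    show "a = b" if "a \<in> ?B" "b \<in> ?B" "b = c *\<^sub>R a" for a b c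
      using cone_vecs_nonproportional[OF gains that] .
    show "scale2 ?J ((\<theta>s ! j) (poly_var v)) = 2 ^ ((1 # ds) ! j) * (\<theta>s ! j) (poly_var v)"
      if "j < card ?J" "v \<in> ?J" for j v
    proof (cases j)
      case 0
      then show ?thesis using that by (simp add: val\<theta> scale2_var)
    next
      case (Suc r)
      then have r: "r < card I" using that f by (simp add: card_cone_coords)
      show ?thesis
      proof (cases v)
        case None
        then show ?thesis using r Suc by (simp add: val\<theta> val_def)
      next
        case (Some i)
        then show ?thesis
          using r Suc that scale2_poly[OF hom[OF r] sX] by (simp add: val\<theta> val_def)
      qed
    qed
    have "Poly_Mapping.single None 1 \<notin> cone_vec ` T"
    proof
      assume "Poly_Mapping.single None 1 \<in> cone_vec ` T"
      then obtain i j c where t: "(i, j, c) \<in> T" "Poly_Mapping.single None 1 = cone_vec (i, j, c)" by auto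
      show False
        using gains_tripleD[OF gains t(1)] arg_cong[OF t(2), of "\<lambda>a. Poly_Mapping.lookup a (Some i)"]
        by (simp add: lookup_cone_vec gain_sign_def lookup_single)
    qed
    then show "card ?B = sum_list (1 # ds)"
      using f card inj_on_cone_vec[OF gains] by (simp add: card_image)
    fix w :: "nat \<Rightarrow> real"
    assume w: "\<And>v. v \<in> ?J \<Longrightarrow>
      (\<Sum>j<card ?J. w j * poly_subst id (\<lambda>v. case v of None \<Rightarrow> 1 | Some i \<Rightarrow> p i) ((\<theta>s ! j) (poly_var v))) = 0"
    then have w': "w 0 * pt_eval p (poly_var v) + (\<Sum>r<card I. w (Suc r) * pt_eval p (val (Ps ! r) v)) = 0"
      if "v \<in> ?J" for v
      using w[OF that] that f unfolding pt_eval_def[symmetric]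
      by (simp add: card_cone_coords lessThan_Suc_eq_insert_0 sum.reindex val\<theta>)
    have w0: "w 0 = 0" using w'[of None] by (simp add: val_def)
    have "(\<Sum>r<card I. w (Suc r) * pt_eval p (poly (Ps ! r) (Xv i))) = 0" if "i \<in> I" for i
      using w'[of "Some i"] that by (simp add: val_def w0)
    then have "\<forall>r<card I. w (Suc r) = 0" by (rule indep)
    then show "\<forall>j<card ?J. w j = 0"
      using w0 f by (auto simp: card_cone_coords less_Suc_eq_0_disj)
  qed
  then show ?thesis by simp
qed

section \<open>Discrete antiderivatives\<close>

lemma cst_of_int: "cst (of_int c) = of_int c" and cst_of_nat: "cst (of_nat n) = of_nat n"
  by (simp_all add: cst_def)

lemma scale2_of_int: "scale2 I (of_int c) = of_int c" and scale2_of_nat: "scale2 I (of_nat n) = of_nat n"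
  by (metis cst_of_int scale2_cst, metis cst_of_nat scale2_cst)

lemma diff_dvd_poly_diff: "x - y dvd poly P x - poly P y" for P :: "'a::comm_ring_1 poly"
proof (induction P)
  case (pCons a P)
  have "x * poly P x - y * poly P y = (x - y) * poly P x + y * (poly P x - poly P y)"
    by (simp add: algebra_simps)
  then show ?case using pCons by simp
qed simp

lemma poly_homogeneous_add:
  "poly_homogeneous I d P \<Longrightarrow> poly_homogeneous I d Q \<Longrightarrow> poly_homogeneous I d (P + Q)"
  by (simp add: poly_homogeneous_def scale2.hom_add algebra_simps)

lemma poly_homogeneous_0: "poly_homogeneous I d 0"
  by (simp add: poly_homogeneous_def)

lemma poly_homogeneous_sum:
  "(\<And>i. i \<in> K \<Longrightarrow> poly_homogeneous I d (f i)) \<Longrightarrow> poly_homogeneous I d (sum f K)"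
  by (induction K rule: infinite_finite_induct) (auto intro: poly_homogeneous_add poly_homogeneous_0)

lemma poly_homogeneous_mult:
  assumes "poly_homogeneous I d P" "poly_homogeneous I e Q"
  shows "poly_homogeneous I (d + e) (P * Q)"
  unfolding poly_homogeneous_def
proof
  fix m
  let ?s = "scale2 (cone_coords I)"
  have "?s (poly.coeff (P * Q) m) * 2 ^ m
      = (\<Sum>i\<le>m. (?s (poly.coeff P i) * 2 ^ i) * (?s (poly.coeff Q (m - i)) * 2 ^ (m - i)))"
    unfolding coeff_mult scale2.hom_sum scale2.hom_mult sum_distrib_right
  proof (intro sum.cong refl)
    fix i assume "i \<in> {..m}"
    then have "(2 :: nat option rpoly) ^ m = 2 ^ i * 2 ^ (m - i)" by (simp flip: power_add)
    then show "?s (poly.coeff P i) * ?s (poly.coeff Q (m - i)) * 2 ^ m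
        = (?s (poly.coeff P i) * 2 ^ i) * (?s (poly.coeff Q (m - i)) * 2 ^ (m - i))"
      by (simp add: mult_ac)
  qed
  also have "\<dots> = (\<Sum>i\<le>m. (2 ^ d * poly.coeff P i) * (2 ^ e * poly.coeff Q (m - i)))"
    using assms by (simp add: poly_homogeneous_def)
  also have "\<dots> = 2 ^ (d + e) * poly.coeff (P * Q) m"
    unfolding coeff_mult sum_distrib_left by (intro sum.cong refl) (simp add: power_add mult_ac)
  finally show "?s (poly.coeff (P * Q) m) * 2 ^ m = 2 ^ (d + e) * poly.coeff (P * Q) m" .
qed

lemma poly_homogeneous_1: "poly_homogeneous I 0 1"
  by (simp add: poly_homogeneous_def)

lemma poly_homogeneous_prod:
  "(\<And>i. i \<in> K \<Longrightarrow> poly_homogeneous I (d i) (f i)) \<Longrightarrow> finite K \<Longrightarrow> poly_homogeneous I (sum d K) (prod f K)"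
  by (induction K rule: infinite_finite_induct) (auto intro: poly_homogeneous_mult poly_homogeneous_1)

lemma poly_homogeneous_linear:
  assumes "scale2 (cone_coords I) a = 2 * a"
  shows "poly_homogeneous I 1 [:- a, 1:]"
  using assms by (auto simp: poly_homogeneous_def coeff_pCons scale2.hom_uminus split: nat.splits)

lemma poly_homogeneous_monom: "poly_homogeneous I n (Polynomial.monom 1 n)"
  by (simp add: poly_homogeneous_def)

text \<open>The first assumption gives \<open>c\<close> the degree \<open>d - m\<close> without a
  subtraction, so a factor of degree \<open>m + e\<close> yields \<open>d + e\<close>.\<close>

lemma poly_homogeneous_smult:
  assumes "scale2 (cone_coords I) c * 2 ^ m = 2 ^ d * c" "poly_homogeneous I (m + e) P"
  shows "poly_homogeneous I (d + e) (Polynomial.smult c P)"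
  unfolding poly_homogeneous_def
proof
  fix k
  let ?s = "scale2 (cone_coords I)"
  have "?s (poly.coeff (Polynomial.smult c P) k) * 2 ^ k = ?s c * (?s (poly.coeff P k) * 2 ^ k)"
    by (simp add: scale2.hom_mult mult.assoc)
  also have "\<dots> = ?s c * (2 ^ (m + e) * poly.coeff P k)"
    using assms(2) by (simp add: poly_homogeneous_def)
  also have "\<dots> = (?s c * 2 ^ m) * (2 ^ e * poly.coeff P k)" by (simp add: power_add mult_ac)
  also have "\<dots> = 2 ^ (d + e) * poly.coeff (Polynomial.smult c P) k"
    unfolding assms(1) by (simp add: power_add mult_ac)
  finally show "?s (poly.coeff (Polynomial.smult c P) k) * 2 ^ k = 2 ^ (d + e) * poly.coeff (Polynomial.smult c P) k" .
qed

text \<open>These are the Bernoulli polynomials \<open>z\<^bsup>n+1\<^esup> (B\<^bsub>n+1\<^esub>(t/z) - B\<^bsub>n+1\<^esub>) / (n+1)\<close>.\<close>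

lemma monom_antidifference:
  "\<exists>B. poly_homogeneous I (n + 1) B \<and> poly B 0 = 0 \<and> degree B \<le> n + 1 \<and>
     (\<forall>x. poly B (x + Zv) - poly B x = Zv * x ^ n)"
proof (induction n rule: less_induct)
  case (less n)
  then obtain b where b: "\<And>i. i < n \<Longrightarrow> poly_homogeneous I (i + 1) (b i)" "\<And>i. i < n \<Longrightarrow> poly (b i) 0 = 0"
    "\<And>i. i < n \<Longrightarrow> degree (b i) \<le> i + 1" "\<And>i x. i < n \<Longrightarrow> poly (b i) (x + Zv) - poly (b i) x = Zv * x ^ i"
    by metis
  \<comment> \<open>By the binomial theorem \<open>(x + z)^(n+1) - x^(n+1)\<close> is
    \<open>(n + 1) z x^n\<close> plus the terms \<open>c i z x^i\<close> with \<open>i < n\<close>;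
    the latter are removed by the antidifferences already found.\<close>
  define c where "c i = of_nat (Suc n choose i) * Zv ^ (n - i)" for i
  define B where "B = Polynomial.smult (cst (1 / (n + 1)))
    (Polynomial.monom 1 (n + 1) + (\<Sum>i<n. Polynomial.smult (- c i) (b i)))"
  have homc: "scale2 (cone_coords I) (- c i) * 2 ^ i = 2 ^ n * (- c i)" if "i < n" for i
  proof -
    have "(2 :: nat option rpoly) ^ n = 2 ^ (n - i) * 2 ^ i" using that by (simp flip: power_add)
    then show ?thesis
      by (simp add: c_def scale2.hom_mult scale2.hom_power scale2.hom_uminus scale2_var scale2_of_nat power_mult_distrib mult_ac)
  qed
  have hb: "poly_homogeneous I (n + 1) (Polynomial.smult (- c i) (b i))" if "i < n" for i
    using that by (intro poly_homogeneous_smult[OF homc] b(1))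
  have "poly_homogeneous I (0 + (n + 1)) (Polynomial.monom 1 (n + 1) + (\<Sum>i<n. Polynomial.smult (- c i) (b i)))"
    unfolding add_0 by (intro poly_homogeneous_add poly_homogeneous_monom poly_homogeneous_sum hb) simp
  then have "poly_homogeneous I (0 + (n + 1)) B"
    unfolding B_def by (rule poly_homogeneous_smult[rotated]) (simp add: scale2_cst)
  moreover have "poly B 0 = 0" by (simp add: B_def poly_monom poly_sum b(2))
  moreover have "degree B \<le> n + 1"
    unfolding B_def
    by (intro order.trans[OF degree_smult_le] degree_add_le order.trans[OF degree_monom_le] degree_sum_le)
      (auto intro!: order.trans[OF degree_smult_le] order.trans[OF b(3)])
  moreover have "poly B (x + Zv) - poly B x = Zv * x ^ n" for x
  proof -
    let ?k = "cst (1 / (n + 1)) :: nat option rpoly"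
    have "(x + Zv) ^ (n + 1) = (\<Sum>i\<le>n + 1. of_nat (Suc n choose i) * x ^ i * Zv ^ (n + 1 - i))"
      by (simp only: binomial_ring Suc_eq_plus1)
    also have "\<dots> = x ^ (n + 1) + (of_nat (n + 1) * x ^ n * Zv
        + (\<Sum>i<n. of_nat (Suc n choose i) * x ^ i * Zv ^ (n + 1 - i)))"
    proof -
      have "(\<Sum>i\<le>n + 1. f i) = f (n + 1) + (f n + (\<Sum>i<n. f i))" for f :: "nat \<Rightarrow> nat option rpoly"
        by (simp add: lessThan_Suc_atMost[symmetric])
      then show ?thesis by (simp del: binomial_Suc_Suc)
    qed
    also have "(\<Sum>i<n. of_nat (Suc n choose i) * x ^ i * Zv ^ (n + 1 - i)) = (\<Sum>i<n. c i * (Zv * x ^ i))"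
    proof (intro sum.cong refl)
      fix i assume "i \<in> {..<n}"
      then have "n + 1 - i = Suc (n - i)" by auto
      then show "of_nat (Suc n choose i) * x ^ i * Zv ^ (n + 1 - i) = c i * (Zv * x ^ i)"
        by (simp add: c_def mult_ac)
    qed
    finally have 1: "(x + Zv) ^ (n + 1) - x ^ (n + 1) - (\<Sum>i<n. c i * (Zv * x ^ i)) = of_nat (n + 1) * x ^ n * Zv"
      by simp
    have "poly B (x + Zv) - poly B x
        = ?k * ((x + Zv) ^ (n + 1) - x ^ (n + 1) - (\<Sum>i<n. c i * (poly (b i) (x + Zv) - poly (b i) x)))"
      by (simp add: B_def poly_monom poly_sum sum_negf right_diff_distrib sum_subtractf algebra_simps)
    also have "\<dots> = ?k * (of_nat (n + 1) * x ^ n * Zv)"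
    proof -
      have "(\<Sum>i<n. c i * (poly (b i) (x + Zv) - poly (b i) x)) = (\<Sum>i<n. c i * (Zv * x ^ i))"
        by (intro sum.cong) (simp_all only: b(4) lessThan_iff)
      then show ?thesis by (simp only: 1[symmetric])
    qed
    also have "\<dots> = (?k * of_nat (n + 1)) * (Zv * x ^ n)" by (simp only: mult_ac)
    also have "?k * of_nat (n + 1) = 1"
    proof -
      have "cst (real (n + 1)) = (of_nat (n + 1) :: nat option rpoly)" by (simp add: cst_def single_of_nat del: of_nat_Suc of_nat_add)
      then show ?thesis by (metis cst.hom_mult cst.hom_one nonzero_divide_eq_eq of_nat_eq_0_iff add_is_0 one_neq_zero of_nat_1 of_nat_add)
    qed
    finally show ?thesis by simp
  qed
  ultimately show ?case by (intro exI[of _ B]) simp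
qed

lemma antidifference:
  assumes h: "poly_homogeneous I d h"
  obtains P where "poly_homogeneous I (d + 1) P" "poly P 0 = 0" "degree P \<le> degree h + 1"
    "\<And>x. poly P (x + Zv) - poly P x = Zv * poly h x"
proof -
  obtain b where b: "\<And>n. poly_homogeneous I (n + 1) (b n)" "\<And>n. poly (b n) 0 = 0"
    "\<And>n. degree (b n) \<le> n + 1" "\<And>n x. poly (b n) (x + Zv) - poly (b n) x = Zv * x ^ n"
    using monom_antidifference[of I] by metis
  define P where "P = (\<Sum>n\<le>degree h. Polynomial.smult (poly.coeff h n) (b n))"
  show ?thesis
  proof (rule that[of P])
    show "poly_homogeneous I (d + 1) P"
      unfolding P_def using h b(1)
      by (intro poly_homogeneous_sum poly_homogeneous_smult) (auto simp: poly_homogeneous_def)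
    show "poly P 0 = 0" by (simp add: P_def poly_sum b(2))
    show "degree P \<le> degree h + 1"
      unfolding P_def
      by (intro degree_sum_le) (auto intro!: order.trans[OF degree_smult_le] order.trans[OF b(3)])
    fix x
    have "poly P (x + Zv) - poly P x
        = (\<Sum>n\<le>degree h. poly.coeff h n * (poly (b n) (x + Zv) - poly (b n) x))"
      by (simp add: P_def poly_sum right_diff_distrib sum_subtractf)
    also have "\<dots> = Zv * poly h x"
      unfolding b(4) by (simp add: poly_altdef sum_distrib_left mult_ac)
    finally show "poly P (x + Zv) - poly P x = Zv * poly h x" .
  qed
qed

section \<open>The derivations of a block\<close>

definition block_poly :: "int set \<Rightarrow> nat set \<Rightarrow> nat \<Rightarrow> nat option rpoly poly" where
  "block_poly K S r = (\<Prod>c\<in>K. [:- (of_int c * Zv), 1:]) * (\<Prod>j\<in>S. [:- Xv j, 1:]) * Polynomial.monom 1 r"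

lemma scale2_Xv: "i \<in> I \<Longrightarrow> scale2 (cone_coords I) (Xv i) = 2 * Xv i"
  by (simp add: Xv_def scale2_var)

lemma scale2_Zv: "scale2 (cone_coords I) (of_int c * Zv) = 2 * (of_int c * Zv)"
  by (simp add: scale2.hom_mult scale2_var scale2_of_int mult_ac)

lemma poly_block_poly:
  "poly (block_poly K S r) x = (\<Prod>c\<in>K. x - of_int c * Zv) * (\<Prod>j\<in>S. x - Xv j) * x ^ r"
  by (simp add: block_poly_def poly_prod poly_monom)

lemma poly_homogeneous_block_poly:
  assumes "finite K" "finite S" "S \<subseteq> I"
  shows "poly_homogeneous I (card K + card S + r) (block_poly K S r)"
proof -
  have "poly_homogeneous I (sum (\<lambda>_. 1) K + sum (\<lambda>_. 1) S + r) (block_poly K S r)"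
    unfolding block_poly_def using assms
    by (intro poly_homogeneous_mult poly_homogeneous_prod poly_homogeneous_linear poly_homogeneous_monom)
      (auto simp: scale2_Xv scale2_Zv)
  then show ?thesis by simp
qed

lemma degree_block_poly:
  assumes "finite K" "finite S"
  shows "degree (block_poly K S r) \<le> card K + card S + r"
proof -
  have *: "degree (\<Prod>i\<in>L. [:- f i, 1:]) \<le> card L" if "finite L" for L :: "'b set" and f :: "'b \<Rightarrow> nat option rpoly"
    using degree_prod_sum_le[OF that, of "\<lambda>i. [:- f i, 1:]"] by simp
  show ?thesis
    unfolding block_poly_def
    by (intro order.trans[OF degree_mult_le] add_mono *[OF assms(1), of "\<lambda>c. of_int c * Zv"] *[OF assms(2)] degree_monom_le)
qed

text \<open>The statements on edges and weights follow from the difference equation and the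
  normalisation at \<open>0\<close>. \<open>K\<close> stays a parameter: it is
  \<open>{- int a..<int k}\<close> for the digraphs and empty for the Catalan arrangement.\<close>

locale block =
  fixes K :: "int set" and S :: "nat set" and r :: nat and P :: "nat option rpoly poly"
  assumes diff: "\<And>x. poly P (x + Zv) - poly P x = Zv * poly (block_poly K S r) x"
    and finK: "finite K" and finS: "finite S" and P0: "poly P 0 = 0"
begin

lemma poly_shift: "poly P (x + Zv) = poly P x + Zv * poly (block_poly K S r) x"
  using diff[of x] by (simp add: algebra_simps)

lemma block_poly_S: "j \<in> S \<Longrightarrow> poly (block_poly K S r) (Xv j) = 0"
  using finS by (auto simp: poly_block_poly)

lemma edge_dvd:
  assumes "j \<in> S"
  shows "Xv i - Xv j - Zv dvd poly P (Xv i) - poly P (Xv j)"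
  using diff_dvd_poly_diff[of "Xv i" "Xv j + Zv" P] poly_shift[of "Xv j"] block_poly_S[OF assms]
  by (simp add: algebra_simps)

text \<open>The zero at \<open>0\<close> is carried along in steps of \<open>z\<close> in both
  directions. The factor for \<open>c\<close> permits the step between \<open>c z\<close> and
  \<open>(c + 1) z\<close>, so \<open>a + b\<close> factors produce \<open>a + b + 1\<close>
  zeros.\<close>

lemma vanishes_at:
  assumes K: "{-a..<b} \<subseteq> K" and "a \<ge> 0" "b \<ge> 0" "c \<in> {-a..b}"
  shows "poly P (of_int c * Zv) = 0"
proof -
  have h: "poly (block_poly K S r) (of_int c * Zv) = 0" if "c \<in> {-a..<b}" for c
    using that K finK by (auto simp: poly_block_poly)
  have shift: "poly P (of_int (c + 1) * Zv) = poly P (of_int c * Zv)" if "c \<in> {-a..<b}" for c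
    using poly_shift[of "of_int c * Zv"] h[OF that] by (simp add: algebra_simps)
  show ?thesis
  proof (cases "c \<ge> 0")
    case True
    have "c \<le> b \<longrightarrow> poly P (of_int c * Zv) = 0"
      using True
    proof (induction c rule: int_ge_induct)
      case (step i)
      then show ?case using shift[of i] assms(2) by auto
    qed (simp add: P0)
    then show ?thesis using assms by simp
  next
    case False
    then have "c \<le> 0" by simp
    then have "c \<ge> - a \<longrightarrow> poly P (of_int c * Zv) = 0"
    proof (induction c rule: int_le_induct)
      case (step i)
      then show ?case using shift[of "i - 1"] assms(3) by auto
    qed (simp add: P0)
    then show ?thesis using assms by simp
  qed
qed

text \<open>Within the range \<open>P\<close> vanishes at \<open>c z\<close>. For
  \<open>c = - a - 1\<close> the last step fails, but \<open>P(c z)\<close> is then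
  \<open>-z\<close> times the value of \<open>block_poly\<close> at \<open>c z\<close>, which
  contains the factor \<open>c z - x_i\<close> if \<open>i \<in> S\<close>. So heads of edges afford
  one more weight.\<close>

lemma weight_dvd:
  assumes K: "{-a..<b} \<subseteq> K" and "a \<ge> 0" "b \<ge> 0" and c: "c \<in> {-a..b} \<or> c = - a - 1 \<and> i \<in> S"
  shows "Xv i - of_int c * Zv dvd poly P (Xv i)"
  using c
proof
  assume "c \<in> {-a..b}"
  then show ?thesis
    using diff_dvd_poly_diff[of "Xv i" "of_int c * Zv" P] vanishes_at[OF assms(1-3)] by simp
next
  assume c: "c = - a - 1 \<and> i \<in> S"
  let ?c = "of_int c * Zv"
  have "?c + Zv = of_int (c + 1) * Zv" by (simp add: algebra_simps)
  also have "c + 1 = - a" using c by simp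
  finally have "?c + Zv = of_int (- a) * Zv" .
  then have "poly P ?c = - Zv * poly (block_poly K S r) ?c"
    using poly_shift[of ?c] vanishes_at[OF assms(1-3), of "- a"] assms(2,3) by (simp add: add_eq_0_iff2)
  moreover have "Xv i - ?c dvd poly (block_poly K S r) ?c"
  proof -
    have "?c - Xv i dvd (\<Prod>j\<in>S. ?c - Xv j)" using c finS by (intro dvd_prodI) auto
    then have "?c - Xv i dvd poly (block_poly K S r) ?c"
      unfolding poly_block_poly by simp
    then show ?thesis by (metis minus_diff_eq minus_dvd_iff)
  qed
  ultimately have "Xv i - ?c dvd poly P ?c" by simp
  then show ?thesis
    using diff_dvd_poly_diff[of "Xv i" ?c P] by (metis dvd_add diff_add_cancel)
qed

end

lemma poly_map_pt_eval: "pt_eval p (poly P x) = poly (map_poly (pt_eval p) P) (pt_eval p x)"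
  by (induction P) (simp_all add: map_poly_pCons pt_eval.hom_add pt_eval.hom_mult)

text \<open>A combination of the discrete antiderivatives of \<open>H\<close>, \<open>t H\<close>, \<dots>, \<open>t\<^bsup>N-1\<^esup> H\<close> with more zeros than its
  degree vanishes, and then so does its difference.\<close>

lemma antidifferences_independent:
  fixes Q :: "nat \<Rightarrow> real poly" and H :: "real poly"
  assumes diff: "\<And>r s. r < N \<Longrightarrow> poly (Q r) (s + 1) - poly (Q r) s = poly H s * s ^ r"
    and deg: "\<And>r. r < N \<Longrightarrow> degree (Q r) \<le> D" and H: "H \<noteq> 0"
    and R: "finite R" "card R > D"
    and zero: "\<And>s. s \<in> R \<Longrightarrow> (\<Sum>r<N. w r * poly (Q r) s) + c = 0"
  shows "(\<forall>r<N. w r = 0) \<and> c = 0"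
proof -
  \<comment> \<open>The constant \<open>c\<close> serves the Catalan case, where the constant
    polynomial \<open>1\<close> is a further member of the basis.\<close>
  define W where "W = (\<Sum>r<N. Polynomial.smult (w r) (Q r)) + [:c:]"
  have W: "poly W s = (\<Sum>r<N. w r * poly (Q r) s) + c" for s by (simp add: W_def poly_sum)
  have "degree W \<le> D"
    unfolding W_def using deg
    by (intro degree_add_le degree_sum_le) (auto intro: order.trans[OF degree_smult_le])
  moreover have "card R \<le> card {s. poly W s = 0}" if "W \<noteq> 0"
    by (intro card_mono poly_roots_finite that) (use zero W in auto)
  moreover have "card {s. poly W s = 0} \<le> degree W" if "W \<noteq> 0"
    by (rule card_poly_roots_bound[OF that])
  ultimately have W0: "W = 0" using R by fastforce
  define V where "V = (\<Sum>r<N. Polynomial.monom (w r) r)"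
  have "poly (H * V) s = 0" for s
  proof -
    have "poly (H * V) s = (\<Sum>r<N. w r * (poly (Q r) (s + 1) - poly (Q r) s))"
      by (simp add: V_def poly_sum poly_monom sum_distrib_left diff mult_ac)
    also have "\<dots> = poly W (s + 1) - poly W s" by (simp add: W right_diff_distrib sum_subtractf)
    finally show ?thesis by (simp add: W0)
  qed
  then have "H * V = 0" by (simp add: poly_eq_poly_eq_iff[symmetric] fun_eq_iff)
  then have V0: "V = 0" using H by simp
  have "w r = 0" if "r < N" for r
    using arg_cong[OF V0, of "\<lambda>q. poly.coeff q r"] that by (simp add: V_def coeff_sum)
  moreover have "c = 0" using W[of 0] calculation W0 by simp
  ultimately show ?thesis by blast
qed

section \<open>Freeness of the cones\<close>

text \<open>For \<open>S = {k..l}\<close>, \<open>a = k - 1\<close> these are the hyperplanes of the digraph \<open>C\<close>, and for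
  \<open>S = {k+1..l}\<close>, \<open>a = k\<close> those of the digraph \<open>D\<close>.\<close>

definition CD_gains :: "nat \<Rightarrow> nat \<Rightarrow> nat set \<Rightarrow> nat \<Rightarrow> (nat \<times> nat \<times> int) set" where
  "CD_gains l k S a =
     {(i, j, 0) | i j. 1 \<le> i \<and> i < j \<and> j \<le> l}
   \<union> {(i, j, 1) | i j. i \<in> {k..l} \<and> j \<in> S \<and> i \<noteq> j}
   \<union> {(i, 0, c) | i c. 1 \<le> i \<and> i < k \<and> - int i \<le> c \<and> c \<le> int i}
   \<union> {(i, 0, c) | i c. i \<in> {k..l} \<and> - int a - of_bool (i \<in> S) \<le> c \<and> c \<le> int k}"

text \<open>Coking elimination moves \<open>k\<close> out of \<open>S\<close> and raises
  \<open>a\<close> from \<open>k - 1\<close> to \<open>k\<close>; king elimination keeps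
  \<open>S\<close> and \<open>a\<close> and shrinks the block to \<open>{k+1..l}\<close>. Thus
  \<open>a + card S\<close> stays \<open>l\<close> throughout.\<close>

locale CD =
  fixes l k a :: nat and S :: "nat set"
  assumes k: "1 \<le> k" "k \<le> l" and S: "S \<subseteq> {k..l}" and a: "a + card S = l"
begin

lemma finS: "finite S" and S0: "0 \<notin> S" and SI: "S \<subseteq> {1..l}"
  using S k finite_subset by auto

lemma card_S_le: "card S \<le> l + 1 - k"
  using card_mono[OF _ S] by simp

lemma a_ge: "k \<le> a + 1"
  using card_S_le a k by simp

abbreviation "T \<equiv> CD_gains l k S a"

lemma finite_gain_parts:
  "finite {(i, j, 0::int) | i j. 1 \<le> i \<and> i < j \<and> j \<le> l}"
  "finite {(i, j, 1::int) | i j. i \<in> {k..l} \<and> j \<in> S \<and> i \<noteq> j}"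
  "finite {(i, 0::nat, c) | i c. 1 \<le> i \<and> i < k \<and> - int i \<le> c \<and> c \<le> int i}"
  "finite {(i, 0::nat, c) | i c. i \<in> {k..l} \<and> - int a - of_bool (i \<in> S) \<le> c \<and> c \<le> int k}"
proof -
  show "finite {(i, j, 0::int) | i j. 1 \<le> i \<and> i < j \<and> j \<le> l}"
    by (rule finite_subset[of _ "{1..l} \<times> {1..l} \<times> {0}"]) auto
  show "finite {(i, j, 1::int) | i j. i \<in> {k..l} \<and> j \<in> S \<and> i \<noteq> j}"
    by (rule finite_subset[of _ "{k..l} \<times> S \<times> {1}"]) (auto simp: finS)
  show "finite {(i, 0::nat, c) | i c. 1 \<le> i \<and> i < k \<and> - int i \<le> c \<and> c \<le> int i}"
    by (rule finite_subset[of _ "{1..k} \<times> {0} \<times> {- int k..int k}"]) auto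
  show "finite {(i, 0::nat, c) | i c. i \<in> {k..l} \<and> - int a - of_bool (i \<in> S) \<le> c \<and> c \<le> int k}"
    by (rule finite_subset[of _ "{k..l} \<times> {0} \<times> {- int a - 1..int k}"]) (auto simp: of_bool_def split: if_splits)
qed

lemma gains_T: "gains {1..l} T"
proof -
  have "finite T" unfolding CD_gains_def using finite_gain_parts by simp
  then show ?thesis
    using S k unfolding gains_def CD_gains_def by (auto; fastforce)
qed

text \<open>The degree condition of Saito's criterion, with the hyperplane at infinity matched by
  the Euler derivation. The pairs \<open>i < j\<close> are split at \<open>k\<close>: those with
  \<open>i < k\<close> give the summands \<open>l - m\<close>, those within the block give the
  summands \<open>r\<close>.\<close>

lemma card_T: "card T = (\<Sum>m = 1..<k. 2 * m + 1 + (l - m)) + (\<Sum>r<l + 1 - k. a + k + card S + r + 1)"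
proof -
  let ?N = "l + 1 - k"
  let ?T1 = "{(i, j, 0::int) | i j. 1 \<le> i \<and> i < j \<and> j \<le> l}"
  let ?T2 = "{(i, j, 1::int) | i j. i \<in> {k..l} \<and> j \<in> S \<and> i \<noteq> j}"
  let ?T3 = "{(i, 0::nat, c) | i c. 1 \<le> i \<and> i < k \<and> - int i \<le> c \<and> c \<le> int i}"
  let ?T4 = "{(i, 0::nat, c) | i c. i \<in> {k..l} \<and> - int a - of_bool (i \<in> S) \<le> c \<and> c \<le> int k}"
  have "card T = card ?T1 + card ?T2 + card ?T3 + card ?T4"
    unfolding CD_gains_def using finite_gain_parts S0
    by (subst card_Un_disjoint; (subst card_Un_disjoint)?; (subst card_Un_disjoint)?) (auto simp: finite_gain_parts)
  moreover have "card ?T1 = (\<Sum>m = 1..l. l - m)"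
  proof -
    have "?T1 = (\<lambda>(i, j). (i, j, 0)) ` (SIGMA i:{1..l}. {i<..l})" by (auto simp: image_iff)
    then have "card ?T1 = card (SIGMA i:{1..l}. {i<..l})"
      by (simp add: card_image inj_on_def)
    then show ?thesis by simp
  qed
  moreover have "card ?T2 = card S * (?N - 1)"
  proof -
    have "?T2 = (\<lambda>(j, i). (i, j, 1)) ` (SIGMA j:S. {k..l} - {j})" by (auto simp: image_iff)
    then have "card ?T2 = card (SIGMA j:S. {k..l} - {j})"
      by (simp add: card_image inj_on_def)
    also have "\<dots> = (\<Sum>j\<in>S. card ({k..l} - {j}))" by (simp add: finS)
    also have "\<dots> = (\<Sum>j\<in>S. ?N - 1)"
      using S by (intro sum.cong refl) (subst card_Diff_singleton; auto)
    finally show ?thesis by simp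
  qed
  moreover have "card ?T3 = (\<Sum>m = 1..<k. 2 * m + 1)"
  proof -
    have "?T3 = (\<lambda>(i, c). (i, 0, c)) ` (SIGMA i:{1..<k}. {- int i..int i})" by (auto simp: image_iff)
    then have "card ?T3 = card (SIGMA i:{1..<k}. {- int i..int i})"
      by (simp add: card_image inj_on_def)
    also have "\<dots> = (\<Sum>m = 1..<k. card {- int m..int m})" by simp
    also have "\<dots> = (\<Sum>m = 1..<k. 2 * m + 1)" by (intro sum.cong refl) simp
    finally show ?thesis .
  qed
  moreover have "card ?T4 = ?N * (a + k + 1) + card S"
  proof -
    have "{(i, 0::nat, c) | i c. i \<in> {k..l} \<and> f i \<le> c \<and> c \<le> int k}
        = (\<lambda>(i, c). (i, 0, c)) ` (SIGMA i:{k..l}. {f i..int k})" for f :: "nat \<Rightarrow> int"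
      by (auto simp: image_iff)
    from this[of "\<lambda>i. - int a - of_bool (i \<in> S)"] have "card ?T4 = card (SIGMA i:{k..l}. {- int a - of_bool (i \<in> S)..int k})"
      by (simp add: card_image inj_on_def)
    also have "\<dots> = (\<Sum>i\<in>{k..l}. card {- int a - of_bool (i \<in> S)..int k})" by simp
    also have "\<dots> = (\<Sum>i\<in>{k..l}. a + k + 1 + of_bool (i \<in> S))" by (intro sum.cong refl) (auto simp: of_bool_def nat_eq_iff)
    also have "\<dots> = ?N * (a + k + 1) + card ({k..l} \<inter> S)" 
    proof -
      have "(\<Sum>i\<in>{k..l}. of_bool (i \<in> S)) = card ({k..l} \<inter> S)" by (simp add: of_bool_def sum.If_cases)
      then show ?thesis unfolding sum.distrib by (simp add: distrib_left)
    qed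
    also have "{k..l} \<inter> S = S" using S by blast
    finally show ?thesis .
  qed
  moreover have "(\<Sum>m = 1..l. l - m) = (\<Sum>m = 1..<k. l - m) + (\<Sum>r<?N. r)"
  proof -
    have "{1..l} = {1..<k} \<union> {k..l}" using k by auto
    then have "(\<Sum>m = 1..l. l - m) = (\<Sum>m\<in>{1..<k} \<union> {k..l}. l - m)" by (simp only:)
    also have "\<dots> = (\<Sum>m = 1..<k. l - m) + (\<Sum>m = k..l. l - m)"
      by (rule sum.union_disjoint) auto
    also have "(\<Sum>m = k..l. l - m) = (\<Sum>r<?N. r)"
      by (rule sum.reindex_bij_witness[of _ "\<lambda>r. l - r" "\<lambda>m. l - m"]) auto
    finally show ?thesis .
  qed
  moreover have "n * (a + k + 1) + card S * n = (\<Sum>r<n. a + k + card S + 1)" for n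
    by (simp add: algebra_simps)
  note this[of ?N]
  moreover have "card S * (?N - 1) + card S = card S * ?N"
    using k by (cases ?N) auto
  moreover have "(\<Sum>r<?N. a + k + card S + r + 1) = (\<Sum>r<?N. a + k + card S + 1) + (\<Sum>r<?N. r)"
    unfolding sum.distrib[symmetric] by (intro sum.cong refl) simp
  moreover have "(\<Sum>m = 1..<k. 2 * m + 1 + (l - m)) = (\<Sum>m = 1..<k. 2 * m + 1) + (\<Sum>m = 1..<k. l - m)"
    by (rule sum.distrib)
  ultimately show ?thesis by linarith
qed

definition lower_poly :: "nat \<Rightarrow> nat option rpoly poly" where
  "lower_poly m = block_poly {- int m..int m} {m<..l} 0"

lemma poly_lower_poly:
  "poly (lower_poly m) x = (\<Prod>c\<in>{- int m..int m}. x - of_int c * Zv) * (\<Prod>j\<in>{m<..l}. x - Xv j)"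
  by (simp add: lower_poly_def poly_block_poly)

lemma lower_poly_above: "m < i \<Longrightarrow> i \<le> l \<Longrightarrow> poly (lower_poly m) (Xv i) = 0"
  by (auto simp: poly_lower_poly)

lemma lower_poly_0: "poly (lower_poly m) 0 = 0"
  by (auto simp: poly_lower_poly intro!: bexI[of _ 0])

lemma lower_poly_weight:
  assumes "- int m \<le> c" "c \<le> int m"
  shows "x - of_int c * Zv dvd poly (lower_poly m) x"
proof -
  have "x - of_int c * Zv dvd (\<Prod>c\<in>{- int m..int m}. x - of_int c * Zv)"
    using assms by (intro dvd_prodI) auto
  then show ?thesis unfolding poly_lower_poly by simp
qed

text \<open>Vanishing at all \<open>x_i\<close> with \<open>i > m\<close> settles every edge, since
  both ends lie in the block, and every weight of a larger vertex. For \<open>i \<le> m\<close> the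
  weights \<open>\<bar>c\<bar> \<le> i\<close> are among the factors.\<close>

lemma lower_poly_dvd:
  assumes m: "m \<in> {1..<k}" and t: "(i, j, c) \<in> T"
  shows "Xv i - Xv j - of_int c * Zv dvd poly (lower_poly m) (Xv i) - poly (lower_poly m) (Xv j)"
proof -
  have P0: "poly (lower_poly m) (Xv 0) = 0"
    by (simp add: lower_poly_0 Xv_def)
  consider "c = 0" | "c = 1" "i \<in> {k..l}" "j \<in> S" | "j = 0" "1 \<le> i" "i < k" "- int i \<le> c" "c \<le> int i"
    | "j = 0" "i \<in> {k..l}"
    using t by (auto simp: CD_gains_def)
  then show ?thesis
  proof cases
    case 1
    then show ?thesis by (simp add: diff_dvd_poly_diff)
  next
    case 2
    then show ?thesis using m S by (auto simp: lower_poly_above)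
  next
    case 3
    show ?thesis
    proof (cases "i \<le> m")
      case True
      then show ?thesis using 3 lower_poly_weight[of m c "Xv i"] P0 by (simp add: Xv_def)
    next
      case False
      then show ?thesis using 3 k P0 by (simp add: lower_poly_above)
    qed
  next
    case 4
    then show ?thesis using m P0 by (simp add: lower_poly_above)
  qed
qed

lemma block_dvd:
  assumes "block {- int a..<int k} S r P" and t: "(i, j, c) \<in> T"
  shows "Xv i - Xv j - of_int c * Zv dvd poly P (Xv i) - poly P (Xv j)"
proof -
  interpret block "{- int a..<int k}" S r P by fact
  have w: "Xv i - of_int c * Zv dvd poly P (Xv i)"
    if "c \<in> {- int a..int k} \<or> c = - int a - 1 \<and> i \<in> S" for c
    by (rule weight_dvd[of "int a" "int k"]) (use that in auto)
  consider "c = 0" | "c = 1" "j \<in> S" | "j = 0" "1 \<le> i" "i < k" "- int i \<le> c" "c \<le> int i"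
    | "j = 0" "- int a - of_bool (i \<in> S) \<le> c" "c \<le> int k"
    using t by (auto simp: CD_gains_def)
  then show ?thesis
  proof cases
    case 1
    then show ?thesis by (simp add: diff_dvd_poly_diff)
  next
    case 2
    then show ?thesis using edge_dvd[of j i] by simp
  next
    case 3
    then show ?thesis using w[of c] P0 a_ge by (simp add: Xv_def)
  next
    case 4
    then have "c \<in> {- int a..int k} \<or> c = - int a - 1 \<and> i \<in> S" by (cases "i \<in> S") auto
    then show ?thesis using 4 w[of c] P0 by (simp add: Xv_def)
  qed
qed

text \<open>The values \<open>l + 2 * i\<close> exceed \<open>k\<close> and hence all integer zeros,
  and having distance 2 they never meet a shifted value \<open>p j + 1\<close>.\<close>

lemma block_roots_independent:
  fixes Q :: "nat \<Rightarrow> nat option rpoly poly" and p :: "nat \<Rightarrow> real"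
  defines "N \<equiv> l + 1 - k"
  assumes Q: "\<And>r. r < N \<Longrightarrow> block {- int a..<int k} S r (Q r)"
    and deg: "\<And>r. r < N \<Longrightarrow> degree (Q r) \<le> a + k + card S + r + 1"
    and p: "\<And>i. p i = real (l + 2 * i)"
    and zero: "\<And>i. i \<in> {k..l} \<Longrightarrow> (\<Sum>r<N. w r * pt_eval p (poly (Q r) (Xv i))) = 0"
  shows "\<forall>r<N. w r = 0"
proof -
  define Q' where "Q' r = map_poly (pt_eval p) (Q r)" for r
  define H :: "real poly" where "H = (\<Prod>c\<in>{- int a..<int k}. [:- of_int c, 1:]) * (\<Prod>j\<in>S. [:- p j, 1:])"
  have Q': "pt_eval p (poly (Q r) x) = poly (Q' r) (pt_eval p x)" for r x
    unfolding Q'_def by (rule poly_map_pt_eval)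
  have ofint: "pt_eval p (of_int c) = of_int c" for c
    by (metis cst_of_int pt_eval_cst)
  have X: "pt_eval p (Xv j) = p j" if "j \<in> S" for j using that S0 by (metis pt_eval_Xv)
  have Hx: "pt_eval p (poly (block_poly {- int a..<int k} S r) (cst s)) = poly H s * s ^ r" for r s
    by (simp add: poly_block_poly H_def poly_prod pt_eval.hom_mult pt_eval.hom_prod pt_eval.hom_minus
        pt_eval.hom_power ofint X)
  have diff: "poly (Q' r) (s + 1) - poly (Q' r) s = poly H s * s ^ r" if "r < N" for r s
  proof -
    interpret block "{- int a..<int k}" S r "Q r" using Q that .
    show ?thesis
      using arg_cong[OF diff[of "cst s"], of "pt_eval p"] Hx[of r s]
      by (simp add: pt_eval.hom_minus pt_eval.hom_add pt_eval.hom_mult Q')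
  qed
  \<comment> \<open>Each difference vanishes at \<open>p j\<close> for \<open>j \<in> S\<close>, so
    the zero at \<open>p j\<close> repeats at \<open>p j + 1\<close>. In total there are
    \<open>a + k + 1 + N + card S\<close> zeros against the degree bound
    \<open>a + k + card S + N\<close>.\<close>
  let ?R = "(of_int ` {- int a..int k}) \<union> (p ` {k..l} \<union> (\<lambda>j. p j + 1) ` S)"
  have "card ?R = card (of_int ` {- int a..int k} :: real set) + (card (p ` {k..l}) + card ((\<lambda>j. p j + 1) ` S))"
  proof (subst card_Un_disjoint; (subst card_Un_disjoint)?)
    show "of_int ` {- int a..int k} \<inter> (p ` {k..l} \<union> (\<lambda>j. p j + 1) ` S) = {}"
    proof -
      have "of_int c < p j" if "c \<le> int k" "k \<le> j" "j \<le> l" for c j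
      proof -
        have "real_of_int c \<le> real k" using that(1) by linarith
        then show ?thesis using k that unfolding p by linarith
      qed
      then show ?thesis using S by fastforce
    qed
    show "p ` {k..l} \<inter> (\<lambda>j. p j + 1) ` S = {}"
    proof -
      have "p i \<noteq> p j + 1" for i j
      proof
        assume "p i = p j + 1"
        then have "real (l + 2 * i) = real (l + 2 * j + 1)" unfolding p by simp
        then have "l + 2 * i = l + 2 * j + 1" by (rule of_nat_eq_iff[THEN iffD1])
        then show False by presburger
      qed
      then show ?thesis by blast
    qed
  qed (auto simp: finS)
  also have "\<dots> = (a + k + 1) + ((l + 1 - k) + card S)"
    by (subst (1 2 3) card_image) (auto simp: inj_on_def p)
  finally have cR: "card ?R = (a + k + 1) + (N + card S)" by (simp add: N_def)
  have zero': "(\<Sum>r<N. w r * poly (Q' r) (p i)) = 0" if "i \<in> {k..l}" for i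
    using zero[OF that] that k by (simp add: Q' pt_eval_Xv)
  have "(\<forall>r<N. w r = 0) \<and> (0::real) = 0"
  proof (rule antidifferences_independent[where Q = Q' and H = H and R = ?R and D = "a + k + card S + N"])
    show "degree (Q' r) \<le> a + k + card S + N" if "r < N" for r
      using deg[OF that] that map_poly_degree_leq[of "pt_eval p" "Q r"] unfolding Q'_def by linarith
    show "H \<noteq> 0" using finS by (simp add: H_def)
    show "finite ?R" using finS by simp
    show "a + k + card S + N < card ?R" unfolding cR by simp
    fix s assume "s \<in> ?R"
    then consider c where "c \<in> {- int a..int k}" "s = of_int c" | i where "i \<in> {k..l}" "s = p i"
      | j where "j \<in> S" "s = p j + 1" by blast
    then show "(\<Sum>r<N. w r * poly (Q' r) s) + 0 = 0"
    proof cases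
      case 1
      have "poly (Q' r) s = 0" if "r < N" for r
      proof -
        interpret block "{- int a..<int k}" S r "Q r" using Q that .
        have "poly (Q r) (of_int c * Zv) = 0"
          by (rule vanishes_at[of "int a" "int k"]) (use 1 in auto)
        then show ?thesis using Q'[of r "of_int c * Zv"] 1 by (simp add: pt_eval.hom_mult ofint)
      qed
      then show ?thesis by simp
    next
      case 2
      then show ?thesis using zero' by simp
    next
      case 3
      have "poly H (p j) = 0" using 3 finS by (auto simp: H_def poly_prod)
      then have "poly (Q' r) s = poly (Q' r) (p j)" if "r < N" for r
        using diff[OF that, of "p j"] 3 by simp
      then have "(\<Sum>r<N. w r * poly (Q' r) s) = (\<Sum>r<N. w r * poly (Q' r) (p j))" by simp
      then show ?thesis using zero'[of j] 3 S by auto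
    qed
  qed (use diff in auto)
  then show ?thesis by blast
qed

theorem free_cone_CD: "free_arrangement (arr_cone (gain_arr {1..l} T))"
proof -
  let ?K = "{- int a..<int k}" and ?N = "l + 1 - k"
  have hd: "poly_homogeneous {1..l} (a + k + card S + r) (block_poly ?K S r)"
    "degree (block_poly ?K S r) \<le> a + k + card S + r" for r
  proof -
    have "card ?K = a + k" by simp
    then show "poly_homogeneous {1..l} (a + k + card S + r) (block_poly ?K S r)"
      "degree (block_poly ?K S r) \<le> a + k + card S + r"
      using poly_homogeneous_block_poly[of ?K S "{1..l}" r] degree_block_poly[of ?K S r] finS SI
      by (simp_all only: finite_atLeastLessThan_int)
  qed
  have "\<exists>P. poly_homogeneous {1..l} (a + k + card S + r + 1) P \<and> degree P \<le> a + k + card S + r + 1 \<and> block ?K S r P" for r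
  proof (rule antidifference[OF hd(1)[of r]])
    fix P assume P: "poly_homogeneous {1..l} (a + k + card S + r + 1) P" "poly P 0 = 0"
      "degree P \<le> degree (block_poly ?K S r) + 1" "\<And>x. poly P (x + Zv) - poly P x = Zv * poly (block_poly ?K S r) x"
    have "block ?K S r P" by unfold_locales (use P finS in auto)
    moreover have "degree P \<le> a + k + card S + r + 1" using P(3) hd(2)[of r] by linarith
    ultimately show ?thesis using P(1) by blast
  qed
  then obtain Q where Q: "\<And>r. poly_homogeneous {1..l} (a + k + card S + r + 1) (Q r)"
    "\<And>r. degree (Q r) \<le> a + k + card S + r + 1" "\<And>r. block ?K S r (Q r)" by metis
  define Ps where "Ps = map Q [0..<?N] @ map lower_poly [1..<k]"
  define ds where "ds = map (\<lambda>r. a + k + card S + r + 1) [0..<?N] @ map (\<lambda>m. 2 * m + 1 + (l - m)) [1..<k]"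
  define p where "p i = real (l + 2 * i)" for i :: nat
  have len: "?N + (k - 1) = card {1..l}" using k by simp
  have Ps_nth: "Ps ! r = (if r < ?N then Q r else lower_poly (r - ?N + 1))"
    and ds_nth: "ds ! r = (if r < ?N then a + k + card S + r + 1 else 2 * (r - ?N + 1) + 1 + (l - (r - ?N + 1)))"
    if "r < card {1..l}" for r
    using that len by (auto simp: Ps_def ds_def nth_append)
  have "free_with_exponents (arr_cone (gain_arr {1..l} T)) (add_mset 1 (mset ds))"
  proof (rule free_cone_gain_arr[OF gains_T, where Ps = Ps and p = p])
    show "length Ps = card {1..l}" "length ds = card {1..l}" using len by (simp_all add: Ps_def ds_def)
    show "Xv i - Xv j - of_int c * Zv dvd poly P (Xv i) - poly P (Xv j)" if "P \<in> set Ps" "(i, j, c) \<in> T" for P i j c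
      using that block_dvd[OF Q(3)] lower_poly_dvd by (auto simp: Ps_def)
    show "poly P 0 = 0" if "P \<in> set Ps" for P
      using that block.P0[OF Q(3)] by (auto simp: Ps_def lower_poly_0)
    show "poly_homogeneous {1..l} (ds ! r) (Ps ! r)" if "r < card {1..l}" for r
    proof (cases "r < ?N")
      case True
      then show ?thesis using that Q(1) by (simp add: Ps_nth ds_nth)
    next
      case False
      define m where "m = r - ?N + 1"
      have "m \<le> l" using that len by (simp add: m_def)
      have "poly_homogeneous {1..l} (card {- int m..int m} + card {m<..l} + 0) (lower_poly m)"
        unfolding lower_poly_def by (rule poly_homogeneous_block_poly) auto
      moreover have "card {- int m..int m} + card {m<..l} + 0 = 2 * m + 1 + (l - m)" by simp
      ultimately have "poly_homogeneous {1..l} (2 * m + 1 + (l - m)) (lower_poly m)" by (simp only:)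
      then show ?thesis using that False by (simp add: Ps_nth ds_nth m_def)
    qed
    have "sum_list (map f [0..<n]) = (\<Sum>r<n. f r)" for f :: "nat \<Rightarrow> nat" and n
      by (simp add: interv_sum_list_conv_sum_set_nat lessThan_atLeast0)
    moreover have "sum_list (map f [1..<n]) = (\<Sum>r = 1..<n. f r)" for f :: "nat \<Rightarrow> nat" and n
      by (simp add: interv_sum_list_conv_sum_set_nat)
    ultimately show "card T = sum_list ds" unfolding ds_def card_T sum_list_append by simp
    fix w :: "nat \<Rightarrow> real"
    assume w: "\<And>i. i \<in> {1..l} \<Longrightarrow> (\<Sum>r<card {1..l}. w r * pt_eval p (poly (Ps ! r) (Xv i))) = 0"
    have w': "(\<Sum>r<?N. w r * pt_eval p (poly (Q r) (Xv i)))
        + (\<Sum>m = 1..<k. w (?N + m - 1) * pt_eval p (poly (lower_poly m) (Xv i))) = 0" if "i \<in> {1..l}" for i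
    proof -
      have "(\<Sum>r<card {1..l}. w r * pt_eval p (poly (Ps ! r) (Xv i)))
          = (\<Sum>r<?N. w r * pt_eval p (poly (Ps ! r) (Xv i))) + (\<Sum>r = ?N..<card {1..l}. w r * pt_eval p (poly (Ps ! r) (Xv i)))"
        unfolding lessThan_atLeast0 using len by (subst sum.atLeastLessThan_concat) auto
      also have "(\<Sum>r<?N. w r * pt_eval p (poly (Ps ! r) (Xv i))) = (\<Sum>r<?N. w r * pt_eval p (poly (Q r) (Xv i)))"
        using len by (intro sum.cong refl) (simp add: Ps_nth)
      also have "(\<Sum>r = ?N..<card {1..l}. w r * pt_eval p (poly (Ps ! r) (Xv i)))
          = (\<Sum>m = 1..<k. w (?N + m - 1) * pt_eval p (poly (lower_poly m) (Xv i)))"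
        using k by (intro sum.reindex_bij_witness[of _ "\<lambda>m. ?N + m - 1" "\<lambda>r. r - ?N + 1"]) (auto simp: Ps_nth)
      finally show ?thesis using w[OF that] by simp
    qed
    \<comment> \<open>All lower polynomials vanish at the coordinates of the block, so the equations
      for \<open>i \<ge> k\<close> isolate the antidifferences.\<close>
    have wN: "\<forall>r<?N. w r = 0"
    proof (rule block_roots_independent[OF Q(3,2)])
      show "p i = real (l + 2 * i)" for i by (simp add: p_def)
      fix i assume i: "i \<in> {k..l}"
      have "poly (lower_poly m) (Xv i) = 0" if "m \<in> {1..<k}" for m
        using i that by (intro lower_poly_above) auto
      then show "(\<Sum>r<?N. w r * pt_eval p (poly (Q r) (Xv i))) = 0" using w'[of i] i k by simp
    qed
    \<comment> \<open>The remaining system is triangular: at \<open>x_m\<close> only the polynomials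
      with index at least \<open>m\<close> survive. The diagonal entry is nonzero because
      \<open>p m\<close> exceeds \<open>m\<close> and differs from all other
      \<open>p j\<close>.\<close>
    have lower: "w (?N + m - 1) = 0" if "m \<in> {1..<k}" for m
      using that
    proof (induction "k - m" arbitrary: m rule: less_induct)
      case less
      have "(\<Sum>m' = 1..<k. w (?N + m' - 1) * pt_eval p (poly (lower_poly m') (Xv m)))
          = (\<Sum>m' = 1..<k. if m' = m then w (?N + m - 1) * pt_eval p (poly (lower_poly m) (Xv m)) else 0)"
      proof (intro sum.cong refl)
        fix m' assume m': "m' \<in> {1..<k}"
        consider "m' < m" | "m' = m" | "m' > m" by linarith
        then show "w (?N + m' - 1) * pt_eval p (poly (lower_poly m') (Xv m))
            = (if m' = m then w (?N + m - 1) * pt_eval p (poly (lower_poly m) (Xv m)) else 0)"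
        proof cases
          case 1
          then show ?thesis using less k by (simp add: lower_poly_above)
        next
          case 3
          then have "w (?N + m' - 1) = 0" using less(1)[of m'] less(2) m' by auto
          then show ?thesis using 3 by simp
        qed simp
      qed
      then have z: "w (?N + m - 1) * pt_eval p (poly (lower_poly m) (Xv m)) = 0"
        using w'[of m] wN less(2) k by simp
      have "pt_eval p (poly (lower_poly m) (Xv m)) \<noteq> 0"
      proof -
        have ofint: "pt_eval p (of_int c) = of_int c" for c by (metis cst_of_int pt_eval_cst)
        have "p m - of_int c \<noteq> 0" if "c \<in> {- int m..int m}" for c
        proof -
          have "real_of_int c \<le> real m" using that by (simp add: of_int_le_iff[symmetric, where 'a = real] del: of_int_le_iff)
          then show ?thesis using less(2) by (simp add: p_def)
        qed
        moreover have "p m - pt_eval p (Xv j) \<noteq> 0" if "j \<in> {m<..l}" for j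
          using that by (simp add: pt_eval_Xv p_def)
        ultimately show ?thesis
          using less(2)
          by (simp add: poly_lower_poly pt_eval.hom_mult pt_eval.hom_prod pt_eval.hom_minus ofint pt_eval_Xv)
      qed
      then show ?case using z by simp
    qed
    show "\<forall>r<card {1..l}. w r = 0"
    proof (intro allI impI)
      fix r assume r: "r < card {1..l}"
      show "w r = 0"
      proof (cases "r < ?N")
        case False
        then show ?thesis using lower[of "r - ?N + 1"] r len k by auto
      qed (use wN in blast)
    qed
  qed
  then show ?thesis by (auto simp: free_arrangement_def)
qed

end

section \<open>The Catalan cone and its exponents\<close>

definition Cat_gains :: "nat \<Rightarrow> (nat \<times> nat \<times> int) set" where
  "Cat_gains n = {(i, j, c). 1 \<le> i \<and> i < j \<and> j \<le> n \<and> c \<in> {-1, 0, 1}}"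

lemma Cat_eq_gain_arr: "Cat n = gain_arr {1..n} (Cat_gains n)"
proof -
  have "{{x \<in> rspace {1..n}. Poly_Mapping.lookup x i - Poly_Mapping.lookup x j = c} | i j c.
      1 \<le> i \<and> i < j \<and> j \<le> n \<and> c \<in> {-1, 0, 1}} = gain_hyp {1..n} ` Cat_gains n" (is "?L = ?R")
  proof (intro subset_antisym subsetI)
    fix H assume "H \<in> ?L"
    then obtain i j and c :: real where "H = {x \<in> rspace {1..n}. Poly_Mapping.lookup x i - Poly_Mapping.lookup x j = c}"
      "1 \<le> i" "i < j" "j \<le> n" and c: "c \<in> {-1, 0, 1}" by auto
    moreover obtain c' :: int where "c = of_int c'" "c' \<in> {-1, 0, 1}"
      using c that[of "-1"] that[of 0] that[of 1] by auto
    ultimately have "H = gain_hyp {1..n} (i, j, c')" "(i, j, c') \<in> Cat_gains n"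
      by (simp_all add: gain_hyp_def Cat_gains_def)
    then show "H \<in> ?R" by blast
  next
    fix H assume "H \<in> ?R"
    then obtain i j c where "(i, j, c) \<in> Cat_gains n" "H = gain_hyp {1..n} (i, j, c)" by auto
    then show "H \<in> ?L"
      by (force simp: gain_hyp_def Cat_gains_def)
  qed
  then show ?thesis by (simp add: Cat_def gain_arr_def)
qed

lemma gains_Cat: "gains {1..n} (Cat_gains n)"
proof -
  have "finite (Cat_gains n)"
    by (rule finite_subset[of _ "{1..n} \<times> {1..n} \<times> {-1, 0, 1}"]) (auto simp: Cat_gains_def)
  then show ?thesis by (auto simp: gains_def Cat_gains_def)
qed

text \<open>Three times the number of pairs is \<open>3 n (n - 1) / 2\<close>, which is also the sum
  of the exponents from \<open>n + 1\<close> to \<open>2 n - 1\<close>.\<close>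

lemma card_Cat_gains:
  assumes "n \<ge> 1"
  shows "card (Cat_gains n) = (\<Sum>r<n - 1. n + r + 1)"
proof -
  have "bij_betw (\<lambda>((j, i), c). (i, j, c)) ((SIGMA j:{1..n}. {1..<j}) \<times> {-1, 0, 1}) (Cat_gains n)"
    by (rule bij_betw_byWitness[where f' = "\<lambda>(i, j, c). ((j, i), c)"]) (auto simp: Cat_gains_def)
  then have "card (Cat_gains n) = card ((SIGMA j:{1..n}. {1..<j}) \<times> {-1, 0, 1 :: int})"
    by (rule bij_betw_same_card[symmetric])
  also have "\<dots> = (\<Sum>j = 1..n. j - 1) * 3" by (simp add: card_cartesian_product)
  also have "(\<Sum>j = 1..n. j - 1) = (\<Sum>r<n. r)"
    by (rule sum.reindex_bij_witness[of _ "\<lambda>r. r + 1" "\<lambda>j. j - 1"]) auto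
  also have "(\<Sum>r<n. r) * 3 = (\<Sum>r<n - 1. n + r + 1)"
    using assms
  proof (induction n rule: nat_induct_at_least)
    case (Suc n)
    obtain m where m: "n = Suc m" using Suc by (cases n) auto
    have "(\<Sum>r<n. Suc n + r + 1) = (\<Sum>r<n - 1. n + r + 1) + (n - 1) + (2 * n + 1)"
      unfolding m by (simp add: sum_Suc)
    then show ?case using Suc by simp
  qed simp
  finally show ?thesis .
qed

text \<open>Every index is a head of edges and there are no weights, hence \<open>S = {1..n}\<close>
  and \<open>K = {}\<close>. The exponent \<open>0\<close> belongs to the constant polynomial
  \<open>1\<close>, the translation along the diagonal; the antidifferences contribute the degrees
  \<open>n + r + 1\<close> with \<open>r < n - 1\<close>.\<close>

theorem free_cone_Cat:
  assumes n: "n \<ge> 1"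
  shows "free_with_exponents (arr_cone (Cat n)) ({#0, 1#} + mset_set {n + 1..2 * n - 1})"
proof -
  let ?S = "{1..n}" and ?N = "n - 1"
  have hd: "poly_homogeneous ?S (n + r) (block_poly {} ?S r)" "degree (block_poly {} ?S r) \<le> n + r" for r
    using poly_homogeneous_block_poly[of "{}" ?S ?S r] degree_block_poly[of "{}" ?S r] by simp_all
  have "\<exists>P. poly_homogeneous ?S (n + r + 1) P \<and> degree P \<le> n + r + 1 \<and> block {} ?S r P" for r
  proof (rule antidifference[OF hd(1)[of r]])
    fix P assume P: "poly_homogeneous ?S (n + r + 1) P" "poly P 0 = 0"
      "degree P \<le> degree (block_poly {} ?S r) + 1" "\<And>x. poly P (x + Zv) - poly P x = Zv * poly (block_poly {} ?S r) x"
    have "block {} ?S r P" by unfold_locales (use P in auto)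
    moreover have "degree P \<le> n + r + 1" using P(3) hd(2)[of r] by linarith
    ultimately show ?thesis using P(1) by blast
  qed
  then obtain Q where Q: "\<And>r. poly_homogeneous ?S (n + r + 1) (Q r)"
    "\<And>r. degree (Q r) \<le> n + r + 1" "\<And>r. block {} ?S r (Q r)" by metis
  define Ps where "Ps = 1 # map Q [0..<?N]"
  define ds where "ds = 0 # map (\<lambda>r. r + (n + 1)) [0..<?N]"
  \<comment> \<open>Even values keep the zeros \<open>p i\<close> and \<open>p j + 1\<close> apart,
    which makes \<open>2 n\<close> zeros against the degree bound \<open>2 n - 1\<close>.\<close>
  define p where "p i = real (2 * i)" for i :: nat
  define Q' where "Q' r = map_poly (pt_eval p) (Q r)" for r
  define H where "H = (\<Prod>j\<in>?S. [:- p j, 1:])"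
  have nS: "card ?S = Suc ?N" using n by simp
  have Q': "pt_eval p (poly (Q r) x) = poly (Q' r) (pt_eval p x)" for r x
    unfolding Q'_def by (rule poly_map_pt_eval)
  have X: "pt_eval p (Xv j) = p j" if "j \<in> ?S" for j using that by (intro pt_eval_Xv) auto
  have Hx: "pt_eval p (poly (block_poly {} ?S r) (cst s)) = poly H s * s ^ r" for r s
    by (simp add: poly_block_poly H_def poly_prod pt_eval.hom_mult pt_eval.hom_prod pt_eval.hom_minus
        pt_eval.hom_power X)
  have diff: "poly (Q' r) (s + 1) - poly (Q' r) s = poly H s * s ^ r" for r s
  proof -
    interpret block "{}" ?S r "Q r" by (rule Q)
    show ?thesis
      using arg_cong[OF diff[of "cst s"], of "pt_eval p"] Hx[of r s]
      by (simp add: pt_eval.hom_minus pt_eval.hom_add pt_eval.hom_mult Q')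
  qed
  have "free_with_exponents (arr_cone (gain_arr ?S (Cat_gains n))) (add_mset 1 (mset ds))"
  proof (rule free_cone_gain_arr[OF gains_Cat, where Ps = Ps and p = p])
    show "length Ps = card ?S" "length ds = card ?S" using n by (simp_all add: Ps_def ds_def)
    show "Xv i - Xv j - of_int c * Zv dvd poly P (Xv i) - poly P (Xv j)"
      if P: "P \<in> set Ps" and t: "(i, j, c) \<in> Cat_gains n" for P i j c
    proof -
      consider "P = 1" | r where "P = Q r" using P by (auto simp: Ps_def)
      then show ?thesis
      proof cases
        case 2
        interpret block "{}" ?S r "Q r" by (rule Q)
        have ij: "i \<in> ?S" "j \<in> ?S" using t by (auto simp: Cat_gains_def)
        \<comment> \<open>Up to sign the offset \<open>-1\<close> is the edge with \<open>i\<close>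
          and \<open>j\<close> exchanged; both directions are available because every index lies in
          \<open>S\<close>.\<close>
        have "- (Xv j - Xv i - Zv) dvd - (poly (Q r) (Xv j) - poly (Q r) (Xv i))"
          using edge_dvd[OF ij(1), of j] by (simp only: minus_dvd_iff dvd_minus_iff)
        then have "Xv i - Xv j + Zv dvd poly (Q r) (Xv i) - poly (Q r) (Xv j)"
          by (simp add: algebra_simps)
        then show ?thesis
          using t 2 edge_dvd[OF ij(2), of i] by (auto simp: Cat_gains_def diff_dvd_poly_diff)
      qed simp
    qed
    show "poly P 0 = 0" if "(i, 0, c) \<in> Cat_gains n" for P :: "nat option rpoly poly" and i c using that by (auto simp: Cat_gains_def)
    show "poly_homogeneous ?S (ds ! r) (Ps ! r)" if "r < card ?S" for r
    proof (cases r)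
      case 0
      then show ?thesis by (simp add: Ps_def ds_def poly_homogeneous_1)
    next
      case (Suc s)
      then have "ds ! r = n + s + 1" "Ps ! r = Q s" using that by (simp_all add: Ps_def ds_def)
      then show ?thesis using Q(1)[of s] by simp
    qed
    have "sum_list (map f [0..<m]) = (\<Sum>r<m. f r)" for f :: "nat \<Rightarrow> nat" and m
      by (simp add: interv_sum_list_conv_sum_set_nat lessThan_atLeast0)
    then show "card (Cat_gains n) = sum_list ds"
      unfolding card_Cat_gains[OF n] ds_def by (simp add: add_ac)
    fix w :: "nat \<Rightarrow> real"
    assume w: "\<And>i. i \<in> ?S \<Longrightarrow> (\<Sum>r<card ?S. w r * pt_eval p (poly (Ps ! r) (Xv i))) = 0"
    have w': "(\<Sum>r<?N. w (Suc r) * poly (Q' r) (p i)) + w 0 = 0" if "i \<in> ?S" for i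
    proof -
      have "(\<Sum>r<card ?S. w r * pt_eval p (poly (Ps ! r) (Xv i)))
          = w 0 * pt_eval p (poly (Ps ! 0) (Xv i)) + (\<Sum>r<?N. w (Suc r) * pt_eval p (poly (Ps ! Suc r) (Xv i)))"
        unfolding nS by (rule sum.lessThan_Suc_shift)
      also have "\<dots> = w 0 + (\<Sum>r<?N. w (Suc r) * poly (Q' r) (p i))"
        by (simp add: Ps_def Q' X[OF that])
      finally show ?thesis using w[OF that] by simp
    qed
    let ?R = "p ` ?S \<union> (\<lambda>j. p j + 1) ` ?S"
    have "p i \<noteq> p j + 1" for i j
    proof
      assume "p i = p j + 1"
      then have "real (2 * i) = real (2 * j + 1)" unfolding p_def by simp
      then have "2 * i = 2 * j + 1" by (rule of_nat_eq_iff[THEN iffD1])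
      then show False by presburger
    qed
    then have "card ?R = card (p ` ?S) + card ((\<lambda>j. p j + 1) ` ?S)" by (intro card_Un_disjoint) auto
    also have "\<dots> = n + n" by (subst (1 2) card_image) (auto simp: inj_on_def p_def)
    finally have cR: "card ?R = n + n" .
    have "(\<forall>r<?N. w (Suc r) = 0) \<and> w 0 = 0"
    proof (rule antidifferences_independent[where Q = Q' and H = H and R = ?R and D = "n + ?N"])
      show "degree (Q' r) \<le> n + ?N" if "r < ?N" for r
        using Q(2)[of r] that map_poly_degree_leq[of "pt_eval p" "Q r"] unfolding Q'_def by linarith
      show "H \<noteq> 0" by (simp add: H_def)
      show "n + ?N < card ?R" unfolding cR using n by simp
      fix s assume "s \<in> ?R"
      then consider i where "i \<in> ?S" "s = p i" | j where "j \<in> ?S" "s = p j + 1" by blast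
      then show "(\<Sum>r<?N. w (Suc r) * poly (Q' r) s) + w 0 = 0"
      proof cases
        case 1
        then show ?thesis using w' by simp
      next
        case 2
        have "poly H (p j) = 0" using 2 by (auto simp: H_def poly_prod)
        then have "poly (Q' r) s = poly (Q' r) (p j)" for r
          using diff[of r "p j"] 2 by simp
        then show ?thesis using w'[of j] 2 by simp
      qed
    qed (use diff in auto)
    then show "\<forall>r<card ?S. w r = 0" unfolding nS by (auto simp: less_Suc_eq_0_disj)
  qed
  moreover have "add_mset 1 (mset ds) = {#0, 1#} + mset_set {n + 1..2 * n - 1}"
  proof -
    have "map (\<lambda>r. r + (n + 1)) [0..<?N] = [n + 1..<2 * n]"
      using n by (simp only: map_add_upt) (simp add: mult_2)
    moreover have "{n + 1..<2 * n} = {n + 1..2 * n - 1}" using n by auto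
    ultimately show ?thesis by (simp only: ds_def mset.simps mset_upt) simp
  qed
  ultimately show ?thesis by (simp only: Cat_eq_gain_arr)
qed

section \<open>The arrangements of the digraphs\<close>

lemma wdig_arr_eq_gain_arr:
  assumes "0 \<notin> vertices G"
  shows "wdig_arr G = gain_arr (vertices G)
     ({(i, j, 0) | i j. i \<in> vertices G \<and> j \<in> vertices G \<and> i < j}
    \<union> {(i, j, 1) | i j. (i, j) \<in> edges G}
    \<union> {(i, 0, c) | i c. i \<in> vertices G \<and> c \<in> {fst (weight G i)..snd (weight G i)}})"
proof -
  let ?V = "vertices G"
  have "{{x \<in> rspace ?V. Poly_Mapping.lookup x i - Poly_Mapping.lookup x j = 0} | i j. i \<in> ?V \<and> j \<in> ?V \<and> i < j}
      = gain_hyp ?V ` {(i, j, 0) | i j. i \<in> ?V \<and> j \<in> ?V \<and> i < j}"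
    by (force simp: gain_hyp_def image_iff)
  moreover have "{{x \<in> rspace ?V. Poly_Mapping.lookup x i - Poly_Mapping.lookup x j = 1} | i j. (i, j) \<in> edges G}
      = gain_hyp ?V ` {(i, j, 1) | i j. (i, j) \<in> edges G}"
    by (force simp: gain_hyp_def image_iff)
  moreover have "{{x \<in> rspace ?V. Poly_Mapping.lookup x i = of_int c}
         | i c. i \<in> ?V \<and> c \<in> {fst (weight G i)..snd (weight G i)}}
      = gain_hyp ?V ` {(i, 0, c) | i c. i \<in> ?V \<and> c \<in> {fst (weight G i)..snd (weight G i)}}"
  proof -
    have "gain_hyp ?V (i, 0, c) = {x \<in> rspace ?V. Poly_Mapping.lookup x i = of_int c}" for i c
      using assms by (auto simp: gain_hyp_def lookup_rspace_0)
    then show ?thesis by (force simp: image_iff)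
  qed
  ultimately show ?thesis
    unfolding wdig_arr_def gain_arr_def image_Un by simp
qed

lemma triples_split:
  "(\<And>i c. P i c \<longleftrightarrow> Q i c \<or> R i c) \<Longrightarrow>
    {(i, j::nat, c::int) | i c. P i c} = {(i, j, c) | i c. Q i c} \<union> {(i, j, c) | i c. R i c}"
  by blast

text \<open>For \<open>S = {k..l}\<close> the additional weight of heads lowers the bound
  \<open>-(k - 1)\<close> to \<open>-k\<close> on the whole block.\<close>

lemma wdig_arr_C:
  assumes "1 \<le> k" "k \<le> l"
  shows "wdig_arr (C_dig l k) = gain_arr {1..l} (CD_gains l k {k..l} (k - 1))"
proof -
  have 1: "{(i, 0::nat, c) | i c. i \<in> {1..l} \<and> c \<in> {- int (min i k)..int (min i k)}}
      = {(i, 0, c) | i c. 1 \<le> i \<and> i < k \<and> - int i \<le> c \<and> c \<le> int i}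
      \<union> {(i, 0, c) | i c. i \<in> {k..l} \<and> - int (k - 1) - of_bool (i \<in> {k..l}) \<le> c \<and> c \<le> int k}"
    by (rule triples_split) (use assms in \<open>auto simp: min_def of_bool_def split: if_splits\<close>)
  have 2: "{(i, 0::nat, c) | i c. i \<in> vertices (C_dig l k) \<and> c \<in> {fst (weight (C_dig l k) i)..snd (weight (C_dig l k) i)}}
      = {(i, 0, c) | i c. i \<in> {1..l} \<and> c \<in> {- int (min i k)..int (min i k)}}"
    by (auto simp: C_dig_def)
  show ?thesis
    by (subst wdig_arr_eq_gain_arr) (unfold 2 1, auto simp: C_dig_def CD_gains_def intro!: arg_cong[of _ _ "gain_arr {Suc 0..l}"])
qed

lemma wdig_arr_D:
  assumes "1 \<le> k" "k \<le> l"
  shows "wdig_arr (D_dig l k) = gain_arr {1..l} (CD_gains l k {k+1..l} k)"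
proof -
  have 1: "{(i, 0::nat, c) | i c. i \<in> {1..l} \<and> c \<in> {(if i \<le> k then - int (min i k) else - int (min i k) - 1)..int (min i k)}}
      = {(i, 0, c) | i c. 1 \<le> i \<and> i < k \<and> - int i \<le> c \<and> c \<le> int i}
      \<union> {(i, 0, c) | i c. i \<in> {k..l} \<and> - int k - of_bool (i \<in> {k+1..l}) \<le> c \<and> c \<le> int k}"
    by (rule triples_split) (use assms in \<open>auto simp: min_def of_bool_def split: if_splits\<close>)
  have 2: "{(i, 0::nat, c) | i c. i \<in> vertices (D_dig l k) \<and> c \<in> {fst (weight (D_dig l k) i)..snd (weight (D_dig l k) i)}}
      = {(i, 0, c) | i c. i \<in> {1..l} \<and> c \<in> {(if i \<le> k then - int (min i k) else - int (min i k) - 1)..int (min i k)}}"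
    by (auto simp: D_dig_def)
  have 3: "{(i, j, 1::int) | i j. (i, j) \<in> edges (D_dig l k)} = {(i, j, 1) | i j. i \<in> {k..l} \<and> j \<in> {k+1..l} \<and> i \<noteq> j}"
    using assms by (auto simp: D_dig_def)
  show ?thesis
    by (subst wdig_arr_eq_gain_arr) (unfold 3 2 1, auto simp: D_dig_def CD_gains_def intro!: arg_cong[of _ _ "gain_arr {Suc 0..l}"])
qed

lemma CD_C: "1 \<le> k \<Longrightarrow> k \<le> l \<Longrightarrow> CD l k (k - 1) {k..l}"
  and CD_D: "1 \<le> k \<Longrightarrow> k \<le> l \<Longrightarrow> CD l k k {k+1..l}"
  by (unfold_locales; auto)+

section \<open>The finite field method for gain graphs\<close>

text \<open>A system of equations \<open>y\<^sub>i - y\<^sub>j = c\<close>, over the reals or modulo \<open>q\<close>, is brought into the solved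
  form \<open>y\<^sub>m = y\<^bsub>r m\<^esub> + s m\<close>. The last component of the result bounds the offsets that have
  to be nonzero modulo \<open>q\<close> for an inconsistent system to stay inconsistent.\<close>

fun solve_gains :: "(nat \<times> nat \<times> int) list \<Rightarrow> bool \<times> (nat \<Rightarrow> nat) \<times> (nat \<Rightarrow> int) \<times> int" where
  "solve_gains [] = (True, id, \<lambda>_. 0, 0)"
| "solve_gains ((i, j, c) # ts) = (case solve_gains ts of (ok, r, s, b) \<Rightarrow>
     if r i = r j then (ok \<and> s i - s j = c, r, s, max b \<bar>s i - s j - c\<bar>)
     else if r i \<noteq> 0 then
       (ok, \<lambda>m. if r m = r i then r j else r m, \<lambda>m. if r m = r i then s m + (c + s j - s i) else s m, b)
     else
       (ok, \<lambda>m. if r m = r j then r i else r m, \<lambda>m. if r m = r j then s m + (- c + s i - s j) else s m, b))"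

text \<open>Merging two classes always discards a representative other than \<open>0\<close>, so the
  class of the fixed coordinate keeps \<open>0\<close> as its representative.\<close>

lemma solve_gains_invariant:
  assumes "solve_gains ts = (ok, r, s, b)" "0 \<in> J" "\<And>i j c. (i, j, c) \<in> set ts \<Longrightarrow> i \<in> J \<and> j \<in> J"
  shows "r 0 = 0 \<and> (\<forall>m. r (r m) = r m \<and> s (r m) = 0) \<and> (\<forall>m\<in>J. r m \<in> J) \<and> (\<forall>m. m \<notin> J \<longrightarrow> r m = m \<and> s m = 0)"
  using assms
proof (induction ts arbitrary: ok r s b)
  case (Cons t ts)
  obtain i j c where t: "t = (i, j, c)" by (cases t)
  obtain ok' r' s' b' where rec: "solve_gains ts = (ok', r', s', b')" by (cases "solve_gains ts")
  have IH: "r' 0 = 0" "\<And>m. r' (r' m) = r' m" "\<And>m. s' (r' m) = 0" "\<And>m. m \<in> J \<Longrightarrow> r' m \<in> J"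
    "\<And>m. m \<notin> J \<Longrightarrow> r' m = m \<and> s' m = 0"
    using Cons.IH[OF rec Cons.prems(2)] Cons.prems(3) by auto
  have ij: "i \<in> J" "j \<in> J" using Cons.prems(3)[of i j c] t by auto
  have J: "r' m \<noteq> r' i" "r' m \<noteq> r' j" if "m \<notin> J" for m using IH(4)[OF ij(1)] IH(4)[OF ij(2)] IH(5)[OF that] that by auto
  consider "r' i = r' j" | "r' i \<noteq> r' j" "r' i \<noteq> 0" | "r' i \<noteq> r' j" "r' i = 0" by blast
  then show ?case
  proof cases
    case 1
    then show ?thesis using Cons.prems(1) IH by (auto simp: t rec)
  next
    case 2
    then have "r = (\<lambda>m. if r' m = r' i then r' j else r' m)"
      "s = (\<lambda>m. if r' m = r' i then s' m + (c + s' j - s' i) else s' m)"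
      using Cons.prems(1) by (auto simp: t rec)
    then show ?thesis using 2 IH ij J by auto
  next
    case 3
    then have "r = (\<lambda>m. if r' m = r' j then r' i else r' m)"
      "s = (\<lambda>m. if r' m = r' j then s' m + (- c + s' i - s' j) else s' m)"
      using Cons.prems(1) by (auto simp: t rec)
    moreover have "s' 0 = 0" using IH(3)[of 0] IH(1) by simp
    ultimately show ?thesis using 3 IH ij J Cons.prems(2) by auto
  qed
qed auto

text \<open>\<open>N\<close> is an additive subgroup, \<open>{0}\<close> in the reals or the
  multiples of \<open>q\<close> in the integers, so one argument serves both systems. The class of
  \<open>i\<close> is re-expressed through the representative of \<open>j\<close>.\<close>

lemma solve_gains_merge:
  fixes y :: "nat \<Rightarrow> 'g::ring_1"
  assumes N: "0 \<in> N" "\<And>u v. u \<in> N \<Longrightarrow> v \<in> N \<Longrightarrow> u - v \<in> N"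
    and r: "\<And>m. r (r m) = r m" "\<And>m. s (r m) = 0" and ij: "r i \<noteq> r j"
  shows "(\<forall>m. y m - y (if r m = r i then r j else r m)
        - of_int (if r m = r i then s m + (c + s j - s i) else s m) \<in> N)
    \<longleftrightarrow> y i - y j - of_int c \<in> N \<and> (\<forall>m. y m - y (r m) - of_int (s m) \<in> N)" (is "?L \<longleftrightarrow> ?R")
proof -
  have Nm: "- u \<in> N" if "u \<in> N" for u using N(2)[OF N(1) that] by simp
  have Na: "u + v \<in> N" if "u \<in> N" "v \<in> N" for u v using N(2)[OF that(1) Nm[OF that(2)]] by simp
  show ?thesis
  proof
    assume L: ?L
    have i: "y i - y (r j) - of_int (c + s j) \<in> N" using spec[OF L, of i] by (simp add: algebra_simps)
    have j: "y j - y (r j) - of_int (s j) \<in> N" using spec[OF L, of j] ij by (simp add: eq_commute)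
    have ri: "y (r i) - y (r j) - of_int (c + s j - s i) \<in> N" using spec[OF L, of "r i"] r by simp
    have "y i - y j - of_int c = (y i - y (r j) - of_int (c + s j)) - (y j - y (r j) - of_int (s j))"
      by (simp add: algebra_simps)
    then have "y i - y j - of_int c \<in> N" using N(2)[OF i j] by (simp only:)
    moreover have "y m - y (r m) - of_int (s m) \<in> N" for m
    proof (cases "r m = r i")
      case True
      then have m: "y m - y (r j) - of_int (s m + (c + s j - s i)) \<in> N" using spec[OF L, of m] by simp
      have "y m - y (r m) - of_int (s m)
          = (y m - y (r j) - of_int (s m + (c + s j - s i))) - (y (r i) - y (r j) - of_int (c + s j - s i))"
        using True by (simp add: algebra_simps)
      then show ?thesis using N(2)[OF m ri] by (simp only:)
    next
      case False
      then show ?thesis using spec[OF L, of m] by simp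
    qed
    ultimately show ?R by blast
  next
    assume R: ?R
    have i: "y i - y (r i) - of_int (s i) \<in> N" and j: "y j - y (r j) - of_int (s j) \<in> N"
      and ij: "y i - y j - of_int c \<in> N" using R by auto
    have "y m - y (r j) - of_int (s m + (c + s j - s i)) \<in> N" if "r m = r i" for m
    proof -
      have m: "y m - y (r i) - of_int (s m) \<in> N" using R that by metis
      have "y m - y (r j) - of_int (s m + (c + s j - s i))
        = (y m - y (r i) - of_int (s m)) + ((y i - y j - of_int c) - (y i - y (r i) - of_int (s i))
          + (y j - y (r j) - of_int (s j)))" by (simp add: algebra_simps)
      then show ?thesis using Na[OF m Na[OF N(2)[OF ij i] j]] by (simp only:)
    qed
    then show ?L using R by simp
  qed
qed

text \<open>An equation inside one class only asks for the integer \<open>s i - s j - c\<close> to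
  lie in \<open>N\<close>. The bound \<open>b\<close> majorises all integers of this kind, so
  membership amounts to being zero and consistency is the same for every such
  \<open>N\<close>.\<close>

lemma solve_gains_correct:
  fixes y :: "nat \<Rightarrow> 'g::ring_1"
  assumes N: "0 \<in> N" "\<And>u v. u \<in> N \<Longrightarrow> v \<in> N \<Longrightarrow> u - v \<in> N"
    and "solve_gains ts = (ok, r, s, b)" and "\<And>d. d \<noteq> 0 \<Longrightarrow> \<bar>d\<bar> \<le> b \<Longrightarrow> of_int d \<notin> N"
  shows "(\<forall>(i, j, c)\<in>set ts. y i - y j - of_int c \<in> N) \<longleftrightarrow> ok \<and> (\<forall>m. y m - y (r m) - of_int (s m) \<in> N)"
  using assms(3,4)
proof (induction ts arbitrary: ok r s b)
  case Nil
  then show ?case using N(1) by auto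
next
  case (Cons t ts)
  obtain i j c where t: "t = (i, j, c)" by (cases t)
  obtain ok' r' s' b' where rec: "solve_gains ts = (ok', r', s', b')" by (cases "solve_gains ts")
  have inv: "\<And>m. r' (r' m) = r' m" "\<And>m. s' (r' m) = 0"
    using solve_gains_invariant[OF rec, of UNIV] by auto
  have Nm: "- u \<in> N" if "u \<in> N" for u using N(2)[OF N(1) that] by simp
  have Na: "u + v \<in> N" if "u \<in> N" "v \<in> N" for u v using N(2)[OF that(1) Nm[OF that(2)]] by simp
  have IH: "(\<forall>(i, j, c)\<in>set ts. y i - y j - of_int c \<in> N) \<longleftrightarrow> ok' \<and> (\<forall>m. y m - y (r' m) - of_int (s' m) \<in> N)"
    if "b' \<le> b"
    using Cons.IH[OF rec] Cons.prems(2) that by force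
  consider "r' i = r' j" | "r' i \<noteq> r' j" "r' i \<noteq> 0" | "r' i \<noteq> r' j" "r' i = 0" by blast
  then show ?case
  proof cases
    case 1
    then have eqs: "ok = (ok' \<and> s' i - s' j = c)" "r = r'" "s = s'" "b = max b' \<bar>s' i - s' j - c\<bar>"
      using Cons.prems(1) by (auto simp: t rec)
    have "y i - y j - of_int c \<in> N \<longleftrightarrow> s' i - s' j = c"
      if R: "\<forall>m. y m - y (r' m) - of_int (s' m) \<in> N"
    proof -
      have i: "y i - y (r' i) - of_int (s' i) \<in> N" and j: "y j - y (r' i) - of_int (s' j) \<in> N"
        using R 1 by metis+
      have eq: "y i - y j - of_int c = ((y i - y (r' i) - of_int (s' i)) - (y j - y (r' i) - of_int (s' j)))
          + of_int (s' i - s' j - c)" by (simp add: algebra_simps)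
      have "y i - y j - of_int c \<in> N \<longleftrightarrow> of_int (s' i - s' j - c) \<in> N"
      proof
        assume "y i - y j - of_int c \<in> N"
        then have "(y i - y j - of_int c) - ((y i - y (r' i) - of_int (s' i)) - (y j - y (r' i) - of_int (s' j))) \<in> N"
          using N(2)[OF _ N(2)[OF i j]] by blast
        then show "of_int (s' i - s' j - c) \<in> N" unfolding eq add_diff_cancel_left' .
      next
        assume "of_int (s' i - s' j - c) \<in> N"
        then show "y i - y j - of_int c \<in> N" unfolding eq by (rule Na[OF N(2)[OF i j]])
      qed
      also have "\<dots> \<longleftrightarrow> s' i - s' j - c = 0"
        using Cons.prems(2)[of "s' i - s' j - c"] N(1) unfolding eqs by auto
      finally show ?thesis by auto
    qed
    then show ?thesis using IH unfolding eqs t by auto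
  next
    case 2
    then have eqs: "ok = ok'" "r = (\<lambda>m. if r' m = r' i then r' j else r' m)"
      "s = (\<lambda>m. if r' m = r' i then s' m + (c + s' j - s' i) else s' m)" "b = b'"
      using Cons.prems(1) by (auto simp: t rec)
    have "(\<forall>m. y m - y (r m) - of_int (s m) \<in> N)
        \<longleftrightarrow> y i - y j - of_int c \<in> N \<and> (\<forall>m. y m - y (r' m) - of_int (s' m) \<in> N)"
      unfolding eqs by (rule solve_gains_merge[where r = r' and s = s', OF N inv 2(1)])
    then show ?thesis using IH eqs unfolding t by auto
  next
    case 3
    then have eqs: "ok = ok'" "r = (\<lambda>m. if r' m = r' j then r' i else r' m)"
      "s = (\<lambda>m. if r' m = r' j then s' m + (- c + s' i - s' j) else s' m)" "b = b'"
      using Cons.prems(1) by (auto simp: t rec)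
    have "(\<forall>m. y m - y (r m) - of_int (s m) \<in> N)
        \<longleftrightarrow> y j - y i - of_int (- c) \<in> N \<and> (\<forall>m. y m - y (r' m) - of_int (s' m) \<in> N)"
      unfolding eqs by (rule solve_gains_merge[where r = r' and s = s', OF N inv 3(1)[symmetric]])
    moreover have "y j - y i - of_int (- c) = - (y i - y j - of_int c)" by simp
    then have "y j - y i - of_int (- c) \<in> N \<longleftrightarrow> y i - y j - of_int c \<in> N" by (metis Nm minus_minus)
    ultimately show ?thesis using IH eqs unfolding t by auto
  qed
qed

section \<open>Counting solutions over the reals and modulo \<open>q\<close>\<close>

definition gain_sol :: "nat set \<Rightarrow> (nat \<times> nat \<times> int) set \<Rightarrow> (nat \<Rightarrow>\<^sub>0 real) set" where
  "gain_sol I B = {x \<in> rspace I. \<forall>(i, j, c)\<in>B. Poly_Mapping.lookup x i - Poly_Mapping.lookup x j = of_int c}"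

text \<open>Points of \<open>(\<int>/q)\<^sup>I\<close> as functions with values in \<open>{0..<q}\<close>, extended by \<open>0\<close>.\<close>

definition mod_points :: "nat set \<Rightarrow> nat \<Rightarrow> (nat \<Rightarrow> int) set" where
  "mod_points I q = {y. (\<forall>i\<in>I. y i \<in> {0..<int q}) \<and> (\<forall>i. i \<notin> I \<longrightarrow> y i = 0)}"

definition mod_sol :: "nat set \<Rightarrow> nat \<Rightarrow> (nat \<times> nat \<times> int) set \<Rightarrow> (nat \<Rightarrow> int) set" where
  "mod_sol I q B = {y \<in> mod_points I q. \<forall>(i, j, c)\<in>B. int q dvd y i - y j - c}"

lemma finite_mod_points:
  assumes "finite I"
  shows "finite (mod_points I q)"
proof -
  have "mod_points I q \<subseteq> {y. \<forall>i. (i \<in> I \<longrightarrow> y i \<in> {0..<int q}) \<and> (i \<notin> I \<longrightarrow> y i = 0)}"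
    by (auto simp: mod_points_def)
  then show ?thesis
    using finite_set_of_finite_funs[OF assms, of "{0..<int q}" 0] finite_subset by blast
qed

lemma lookup_sum_single:
  "finite K \<Longrightarrow> Poly_Mapping.lookup (\<Sum>m\<in>K. Poly_Mapping.single m (f m)) k = (if k \<in> K then f k else (0::real))"
  by (simp add: lookup_sum lookup_single when_def)

lemma rspace_sum_single: "(\<Sum>m\<in>I. Poly_Mapping.single m (f m)) \<in> rspace I"
  unfolding rspace_def using keys_sum[of "\<lambda>m. Poly_Mapping.single m (f m)" I] by (auto split: if_splits)

text \<open>The indicator vectors of the classes other than that of \<open>0\<close> form a basis,
  the coordinates in the class of \<open>0\<close> being forced to vanish.\<close>

lemma dim_blockwise_constant:
  fixes I :: "nat set"
  assumes I: "finite I" and r: "\<And>m. r (r m) = r m" "\<And>m. m \<in> I \<Longrightarrow> r m \<in> insert 0 I" "0 \<notin> I"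
    "\<And>m. m \<notin> I \<Longrightarrow> r m = m"
  shows "dim {w \<in> rspace I. \<forall>m. Poly_Mapping.lookup w m = Poly_Mapping.lookup w (r m)} = card {m \<in> I. r m = m}"
    (is "dim ?W = card ?R")
proof -
  define v :: "nat \<Rightarrow> nat \<Rightarrow>\<^sub>0 real" where "v p = (\<Sum>m\<in>{m \<in> I. r m = p}. Poly_Mapping.single m 1)" for p
  have v: "Poly_Mapping.lookup (v p) m = (if m \<in> I \<and> r m = p then 1 else 0)" for p m
    using I by (simp add: v_def lookup_sum_single)
  have fR: "finite ?R" using I by simp
  have comb: "Poly_Mapping.lookup (\<Sum>p\<in>?R. u p *\<^sub>R v p) m = (if r m \<in> ?R \<and> m \<in> I then u (r m) else 0)" for u m
  proof -
    have "Poly_Mapping.lookup (\<Sum>p\<in>?R. u p *\<^sub>R v p) m = (\<Sum>p\<in>?R. if r m = p then (if m \<in> I then u p else 0) else 0)"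
      unfolding lookup_sum lookup_scaleR v by (intro sum.cong) auto
    then show ?thesis using fR by simp
  qed
  have inj: "inj_on v ?R"
  proof (rule inj_onI)
    fix p p' assume "p \<in> ?R" "p' \<in> ?R" "v p = v p'"
    then have "Poly_Mapping.lookup (v p') p = 1" using v[of p p] by simp
    then show "p = p'" using \<open>p \<in> ?R\<close> v[of p' p] by (auto split: if_splits)
  qed
  have ind: "independent (v ` ?R)"
  proof (rule independent_if_scalars_zero)
    show "finite (v ` ?R)" using fR by simp
    fix f x assume "(\<Sum>x\<in>v ` ?R. f x *\<^sub>R x) = 0" and "x \<in> v ` ?R"
    then obtain p where p: "p \<in> ?R" "x = v p" and "(\<Sum>p\<in>?R. f (v p) *\<^sub>R v p) = 0"
      by (auto simp: sum.reindex[OF inj])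
    then show "f x = 0" using comb[of "\<lambda>p. f (v p)" p] by simp
  qed
  have span: "span (v ` ?R) = ?W"
  proof (intro subset_antisym subsetI)
    fix w assume "w \<in> span (v ` ?R)"
    then show "w \<in> ?W"
    proof (induction rule: span_induct_alt)
      case (step c x y)
      then obtain p where p: "p \<in> ?R" "x = v p" by auto
      have "p \<noteq> 0" using p r(3) by (metis (mono_tags) mem_Collect_eq)
      then have "Poly_Mapping.lookup x m = Poly_Mapping.lookup x (r m)" for m
        using p r by (cases "m \<in> I") (auto simp: v)
      moreover have "x \<in> rspace I" using p by (auto simp: rspace_def in_keys_iff v split: if_splits)
      moreover from this have "c *\<^sub>R x + y \<in> rspace I"
        using step rspace_diff[of y I "(- c) *\<^sub>R x"] rspace_scaleR[of x I "- c"] by (simp add: add.commute)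
      ultimately show ?case using step by (simp add: lookup_add lookup_scaleR)
    qed (simp add: rspace_def)
  next
    fix w assume w: "w \<in> ?W"
    have "w = (\<Sum>p\<in>?R. Poly_Mapping.lookup w p *\<^sub>R v p)"
    proof (rule poly_mapping_eqI)
      fix m
      have "Poly_Mapping.lookup w m = 0" if "m \<notin> I" using w that by (auto simp: lookup_rspace_0)
      moreover have "Poly_Mapping.lookup w m = 0" if "m \<in> I" "r m \<notin> ?R"
      proof -
        have "r m = 0" using r that by auto
        moreover have "Poly_Mapping.lookup w m = Poly_Mapping.lookup w (r m)" using w by blast
        moreover have "w \<in> rspace I" using w by blast
        ultimately show ?thesis using lookup_rspace_0[OF _ r(3)] by simp
      qed
      ultimately show "Poly_Mapping.lookup w m = Poly_Mapping.lookup (\<Sum>p\<in>?R. Poly_Mapping.lookup w p *\<^sub>R v p) m"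
        unfolding comb using w by auto
    qed
    moreover have "\<dots> \<in> span (v ` ?R)" by (intro span_sum span_scale span_base) auto
    ultimately show "w \<in> span (v ` ?R)" by simp
  qed
  have "dim ?W = card (v ` ?R)"
    unfolding span[symmetric] by (rule dim_eq_card[OF _ ind]) (simp add: span_span)
  then show ?thesis using inj by (simp add: card_image)
qed

text \<open>The values at the representatives are free and determine all others; \<open>F\<close>
  reconstructs the point from them.\<close>

lemma card_mod_solved:
  assumes I: "finite I" and q: "q > 0" and r: "\<And>m. r (r m) = r m" "\<And>m. s (r m) = 0"
    "\<And>m. m \<in> I \<Longrightarrow> r m \<in> insert 0 I" "\<And>m. m \<notin> I \<Longrightarrow> r m = m \<and> s m = 0"
  shows "card {y \<in> mod_points I q. \<forall>m. int q dvd y m - y (r m) - s m} = q ^ card {m \<in> I. r m = m}"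
    (is "card ?Y = q ^ card ?R")
proof -
  define F where "F u m = (if m \<in> I then ((if r m \<in> I then u (r m) else 0) + s m) mod int q else 0)" for u m
  have "bij_betw (\<lambda>y. restrict y ?R) ?Y (?R \<rightarrow>\<^sub>E {0..<int q})"
  proof (rule bij_betw_byWitness[where f' = F])
    show "\<forall>y\<in>?Y. F (restrict y ?R) = y"
    proof (intro ballI ext)
      fix y m assume y: "y \<in> ?Y"
      show "F (restrict y ?R) m = y m"
      proof (cases "m \<in> I")
        case True
        then have range: "y m \<in> {0..<int q}" using y by (auto simp: mod_points_def)
        have "int q dvd y m - y (r m) - s m" using y by blast
        then have "int q dvd y m - (y (r m) + s m)" by (simp only: diff_diff_eq)
        then have "y m mod int q = (y (r m) + s m) mod int q" by (simp add: mod_eq_dvd_iff)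
        then have "y m = (y (r m) + s m) mod int q" using range by simp
        moreover have "y (r m) = 0" if "r m \<notin> I" using y that by (auto simp: mod_points_def)
        ultimately show ?thesis using True r by (auto simp: F_def)
      next
        case False
        then show ?thesis using y by (auto simp: F_def mod_points_def)
      qed
    qed
    show "\<forall>u\<in>?R \<rightarrow>\<^sub>E {0..<int q}. restrict (F u) ?R = u"
    proof
      fix u assume u: "u \<in> ?R \<rightarrow>\<^sub>E {0..<int q}"
      show "restrict (F u) ?R = u"
      proof
        fix m
        show "restrict (F u) ?R m = u m"
        proof (cases "m \<in> ?R")
          case True
          then have "u m \<in> {0..<int q}" using u by auto
          moreover have "s m = 0" using True r(2)[of m] by simp
          ultimately show ?thesis using True by (simp add: F_def)
        next
          case False
          then show ?thesis using u by (auto simp: PiE_def extensional_def)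
        qed
      qed
    qed
    show "(\<lambda>y. restrict y ?R) ` ?Y \<subseteq> ?R \<rightarrow>\<^sub>E {0..<int q}"
      by (rule image_subsetI, rule restrict_PiE_iff[THEN iffD2]) (auto simp: mod_points_def)
    show "F ` (?R \<rightarrow>\<^sub>E {0..<int q}) \<subseteq> ?Y"
    proof safe
      fix u assume u: "u \<in> ?R \<rightarrow>\<^sub>E {0..<int q}"
      show "F u \<in> mod_points I q" using q by (auto simp: mod_points_def F_def)
      fix m
      show "int q dvd F u m - F u (r m) - s m"
      proof (cases "m \<in> I")
        case True
        show ?thesis
        proof (cases "r m \<in> I")
          case rI: True
          then have "u (r m) \<in> {0..<int q}" using u r by (auto simp: PiE_def Pi_def)
          then have "F u (r m) = u (r m)" using rI r by (simp add: F_def)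
          moreover have "int q dvd (u (r m) + s m) mod int q - (u (r m) + s m)"
            by (simp flip: mod_eq_dvd_iff)
          ultimately show ?thesis using True rI by (simp add: F_def algebra_simps)
        next
          case False
          then show ?thesis using True by (simp add: F_def flip: mod_eq_dvd_iff)
        qed
      next
        case False
        then show ?thesis using r(4) by (simp add: F_def)
      qed
    qed
  qed
  then have "card ?Y = card (?R \<rightarrow>\<^sub>E {0..<int q})" by (rule bij_betw_same_card)
  also have "\<dots> = q ^ card ?R" using I by (simp add: card_PiE)
  finally show ?thesis .
qed

text \<open>The same solved form holds over the reals and modulo every \<open>q > b\<close>. In the
  consistent case the number of representatives is the dimension of the real solution space and the
  exponent of \<open>q\<close>.\<close>

lemma mod_sol_count:
  assumes I: "finite I" "0 \<notin> I" and B: "finite B" "\<And>i j c. (i, j, c) \<in> B \<Longrightarrow> i \<in> insert 0 I \<and> j \<in> insert 0 I"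
  shows "\<exists>b. \<forall>q>b. card (mod_sol I q B) = (if gain_sol I B = {} then 0 else q ^ flat_dim (gain_sol I B))"
proof -
  obtain ts where ts: "set ts = B" using B(1) finite_list by blast
  obtain ok r s b where sol: "solve_gains ts = (ok, r, s, b)" by (cases "solve_gains ts")
  have inv: "r 0 = 0" "\<And>m. r (r m) = r m" "\<And>m. s (r m) = 0" "\<And>m. m \<in> insert 0 I \<Longrightarrow> r m \<in> insert 0 I"
    "\<And>m. m \<notin> insert 0 I \<Longrightarrow> r m = m \<and> s m = 0"
    using solve_gains_invariant[OF sol, of "insert 0 I"] B(2) ts by auto
  have inv': "\<And>m. m \<notin> I \<Longrightarrow> r m = m \<and> s m = 0"
    using inv(1,5) inv(3)[of 0] by (metis insertE)
  have real: "gain_sol I B = {x \<in> rspace I. ok \<and> (\<forall>m. Poly_Mapping.lookup x m - Poly_Mapping.lookup x (r m) - of_int (s m) = 0)}"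
    unfolding gain_sol_def
    using solve_gains_correct[of "{0::real}", OF _ _ sol] ts by auto
  have modq: "mod_sol I q B = {y \<in> mod_points I q. ok \<and> (\<forall>m. int q dvd y m - y (r m) - s m)}" if "q > nat b" for q
  proof -
    have "\<not> int q dvd d" if "d \<noteq> 0" "\<bar>d\<bar> \<le> b" for d
      using dvd_imp_le_int[OF that(1)] that(2) \<open>q > nat b\<close> by fastforce
    then have "(\<forall>(i, j, c)\<in>B. int q dvd y i - y j - c) \<longleftrightarrow> ok \<and> (\<forall>m. int q dvd y m - y (r m) - s m)" for y
      using solve_gains_correct[of "{d. int q dvd d}", OF _ _ sol, of y] ts by simp
    then show ?thesis by (auto simp: mod_sol_def)
  qed
  show ?thesis
  proof (cases ok)
    case True
    \<comment> \<open>The particular solution that is zero at every representative, as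
      \<open>s\<close> vanishes there.\<close>
    define x0 where "x0 = (\<Sum>m\<in>I. Poly_Mapping.single m (real_of_int (s m)))"
    have x0: "Poly_Mapping.lookup x0 m = of_int (s m)" for m
      using I inv' by (simp add: x0_def lookup_sum_single)
    have x0s: "x0 \<in> gain_sol I B"
      unfolding real using True inv(3) rspace_sum_single[of _ I] by (simp add: x0) (simp add: x0_def)
    have "{x - y | x y. x \<in> gain_sol I B \<and> y \<in> gain_sol I B}
        = {w \<in> rspace I. \<forall>m. Poly_Mapping.lookup w m = Poly_Mapping.lookup w (r m)}" (is "?L = ?W")
    proof (intro subset_antisym subsetI)
      fix w assume "w \<in> ?L"
      then obtain x y where w: "w = x - y" and x: "x \<in> gain_sol I B" and y: "y \<in> gain_sol I B" by blast
      have "Poly_Mapping.lookup w m = Poly_Mapping.lookup w (r m)" for m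
      proof -
        have "Poly_Mapping.lookup x m - Poly_Mapping.lookup x (r m) - of_int (s m) = 0"
          "Poly_Mapping.lookup y m - Poly_Mapping.lookup y (r m) - of_int (s m) = 0"
          using x y unfolding real by auto
        then show ?thesis unfolding w lookup_minus by linarith
      qed
      moreover have "w \<in> rspace I" using x y unfolding w real by (auto intro: rspace_diff)
      ultimately show "w \<in> ?W" by simp
    next
      fix w assume w: "w \<in> ?W"
      have "x0 + w \<in> rspace I"
        using rspace_diff[of x0 I "- w"] x0s w by (auto simp: real rspace_def)
      moreover have "Poly_Mapping.lookup (x0 + w) m - Poly_Mapping.lookup (x0 + w) (r m) - of_int (s m) = 0" for m
      proof -
        have "Poly_Mapping.lookup w m = Poly_Mapping.lookup w (r m)" using w by simp
        then show ?thesis by (simp add: lookup_add x0 inv(3))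
      qed
      ultimately have "x0 + w \<in> gain_sol I B" using True unfolding real by simp
      moreover have "w = (x0 + w) - x0" by simp
      ultimately show "w \<in> ?L" using x0s by blast
    qed
    then have "flat_dim (gain_sol I B) = card {m \<in> I. r m = m}"
      unfolding flat_dim_def
      using dim_blockwise_constant[where r = r, OF I(1) inv(2) _ I(2)] inv(4) inv' by simp
    moreover have "card (mod_sol I q B) = q ^ card {m \<in> I. r m = m}" if "q > nat b" for q
      unfolding modq[OF that] using True card_mod_solved[of I q r s, OF I(1) _ inv(2,3)] inv(4) inv' that by simp
    ultimately show ?thesis using x0s by (intro exI[of _ "nat b"]) auto
  next
    case False
    then show ?thesis using modq unfolding real by (intro exI[of _ "nat b"]) auto
  qed
qed

section \<open>Moebius inversion over the points modulo \<open>q\<close>\<close>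

lemma sum_moebius:
  assumes L: "finite L" "V \<in> L" "\<And>Y. Y \<in> L \<Longrightarrow> Y \<subseteq> V" and X: "X \<in> L"
  shows "(\<Sum>Y\<in>{Y \<in> L. X \<subseteq> Y}. moebius L V Y) = (if X = V then 1 else 0)"
proof -
  have "{Y \<in> L. X \<subseteq> Y} = insert X {Y \<in> L. X \<subset> Y}" using X by auto
  then have *: "(\<Sum>Y\<in>{Y \<in> L. X \<subseteq> Y}. moebius L V Y) = moebius L V X + (\<Sum>Y\<in>{Y \<in> L. X \<subset> Y}. moebius L V Y)"
    using L(1) by simp
  show ?thesis
  proof (cases "X = V")
    case True
    then have "{Y \<in> L. X \<subset> Y} = {}" using L(3) by auto
    moreover have "moebius L V X = 1" using True L(1) by (subst moebius.simps) simp
    ultimately show ?thesis unfolding * using True by (simp only: sum.empty) simp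
  next
    case False
    then have "moebius L V X = - (\<Sum>Y\<in>{Y \<in> L. X \<subset> Y}. moebius L V Y)"
      using L(1) by (subst moebius.simps) simp
    then show ?thesis unfolding * using False by simp
  qed
qed

lemma flats_gain_arr: "flats (gain_arr I T) = gain_sol I ` Pow T - {{}}"
proof -
  have "{rspace I \<inter> \<Inter>B | B. B \<subseteq> gain_hyp I ` T} = gain_sol I ` Pow T"
  proof -
    have "rspace I \<inter> \<Inter>(gain_hyp I ` B) = gain_sol I B" for B
      by (auto simp: gain_sol_def gain_hyp_def)
    then show ?thesis unfolding subset_image_iff by (auto simp: image_iff)
  qed
  then show ?thesis by (simp add: flats_def)
qed

text \<open>A point \<open>y\<close> modulo \<open>q\<close> is assigned the real flat
  \<open>X y\<close> of all equations that \<open>y\<close> satisfies. Then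
  \<open>q ^ flat_dim Y\<close> counts the \<open>y\<close> with \<open>X y \<subseteq> Y\<close>.
  After exchanging sums the Moebius values of the flats containing \<open>X y\<close> cancel unless
  \<open>X y\<close> is the whole space, that is, unless \<open>y\<close> lies on no
  hyperplane.\<close>

theorem char_poly_eq_count:
  assumes gains: "gains I T"
  shows "\<exists>b. \<forall>q>b. poly (arr_char_poly (gain_arr I T)) (int q)
    = int (card {y \<in> mod_points I q. \<forall>(i, j, c)\<in>T. \<not> int q dvd y i - y j - c})"
proof -
  note f = finite_gains[OF gains]
  have "\<exists>b. \<forall>q>b. card (mod_sol I q B) = (if gain_sol I B = {} then 0 else q ^ flat_dim (gain_sol I B))"
    if "B \<subseteq> T" for B
  proof (rule mod_sol_count[OF f(1,3) finite_subset[OF that f(2)]])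
    show "i \<in> insert 0 I \<and> j \<in> insert 0 I" if "(i, j, c) \<in> B" for i j c
      using gains_tripleD[OF gains subsetD[OF \<open>B \<subseteq> T\<close> that]] by blast
  qed
  then obtain b where b: "\<And>B q. B \<subseteq> T \<Longrightarrow> q > b B \<Longrightarrow>
      card (mod_sol I q B) = (if gain_sol I B = {} then 0 else q ^ flat_dim (gain_sol I B))" by metis
  define b0 where "b0 = Max (b ` Pow T)"
  have b0: "b B \<le> b0" if "B \<subseteq> T" for B using that f(2) by (auto simp: b0_def)
  have "poly (arr_char_poly (gain_arr I T)) (int q)
    = int (card {y \<in> mod_points I q. \<forall>(i, j, c)\<in>T. \<not> int q dvd y i - y j - c})" if q: "q > b0" for q
  proof -
    let ?L = "flats (gain_arr I T)" and ?P = "mod_points I q" and ?V = "rspace I"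
    have cnt: "card (mod_sol I q B) = (if gain_sol I B = {} then 0 else q ^ flat_dim (gain_sol I B))" if "B \<subseteq> T" for B
      using b[OF that] b0[OF that] q by simp
    have fP: "finite ?P" by (rule finite_mod_points[OF f(1)])
    have fL: "finite ?L" unfolding flats_gain_arr using f(2) by simp
    have V: "?V = gain_sol I {}" by (simp add: gain_sol_def)
    have VL: "?V \<in> ?L"
    proof -
      have "0 \<in> ?V" by (simp add: rspace_def)
      then show ?thesis unfolding flats_gain_arr V by blast
    qed
    have LV: "Y \<subseteq> ?V" if "Y \<in> ?L" for Y using that unfolding flats_gain_arr by (auto simp: gain_sol_def)
    define S where "S y = {t \<in> T. case t of (i, j, c) \<Rightarrow> int q dvd y i - y j - c}" for y
    define X where "X y = gain_sol I (S y)" for y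
    have ST: "S y \<subseteq> T" for y by (auto simp: S_def)
    have mem: "y \<in> mod_sol I q B \<longleftrightarrow> B \<subseteq> S y" if "y \<in> ?P" "B \<subseteq> T" for y B
      using that by (auto simp: mod_sol_def S_def)
    have fin: "finite (mod_sol I q B)" for B using fP by (auto simp: mod_sol_def)
    have XL: "X y \<in> ?L" if "y \<in> ?P" for y
    proof -
      have "y \<in> mod_sol I q (S y)" using mem[OF that ST] by simp
      then have "card (mod_sol I q (S y)) \<noteq> 0" using fin by auto
      then have "gain_sol I (S y) \<noteq> {}" using cnt[OF ST] by auto
      then show ?thesis unfolding flats_gain_arr X_def using ST by auto
    qed
    have key: "y \<in> mod_sol I q B \<longleftrightarrow> X y \<subseteq> gain_sol I B" if y: "y \<in> ?P" and B: "B \<subseteq> T" for y B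
    proof
      assume "y \<in> mod_sol I q B"
      then have "B \<subseteq> S y" using mem[OF y B] by simp
      then show "X y \<subseteq> gain_sol I B" unfolding X_def by (auto simp: gain_sol_def)
    next
      assume sub: "X y \<subseteq> gain_sol I B"
      moreover have "gain_sol I (S y \<union> B) = gain_sol I (S y) \<inter> gain_sol I B"
        by (auto simp: gain_sol_def ball_Un)
      ultimately have "gain_sol I (S y \<union> B) = gain_sol I (S y)" unfolding X_def by blast
      \<comment> \<open>Counts depend only on the real flat, and nested solution sets with equal
        counts coincide. So consequences valid over the reals carry over to residues.\<close>
      then have "card (mod_sol I q (S y \<union> B)) = card (mod_sol I q (S y))"
        using cnt[of "S y \<union> B"] cnt[of "S y"] ST B by simp
      moreover have "mod_sol I q (S y \<union> B) \<subseteq> mod_sol I q (S y)" by (auto simp: mod_sol_def ball_Un)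
      ultimately have "mod_sol I q (S y \<union> B) = mod_sol I q (S y)" using fin by (metis card_subset_eq)
      moreover have "y \<in> mod_sol I q (S y)" using mem[OF y ST] by simp
      ultimately have "S y \<union> B \<subseteq> S y" using mem[OF y, of "S y \<union> B"] ST B by auto
      then show "y \<in> mod_sol I q B" using mem[OF y B] by simp
    qed
    have dimY: "int q ^ flat_dim Y = (\<Sum>y\<in>?P. if X y \<subseteq> Y then 1 else 0)" if Y: "Y \<in> ?L" for Y
    proof -
      obtain B where B: "B \<subseteq> T" "Y = gain_sol I B" "Y \<noteq> {}" using Y unfolding flats_gain_arr by auto
      have "int q ^ flat_dim Y = int (card (mod_sol I q B))" using cnt[OF B(1)] B by simp
      also have "mod_sol I q B = {y \<in> ?P. X y \<subseteq> Y}"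
      proof -
        have "mod_sol I q B \<subseteq> ?P" by (auto simp: mod_sol_def)
        then show ?thesis using key[OF _ B(1)] B(2) by blast
      qed
      finally show ?thesis using fP by (simp add: sum.If_cases Int_def)
    qed
    have XV: "X y = ?V \<longleftrightarrow> S y = {}" for y
    proof
      assume XV: "X y = ?V"
      show "S y = {}"
      proof (rule ccontr)
        assume "S y \<noteq> {}"
        then obtain i j c where t: "(i, j, c) \<in> S y" by auto
        note d = gains_tripleD[OF gains subsetD[OF ST t]]
        let ?x = "Poly_Mapping.single i (of_int c + 1 :: real)"
        have "?x \<in> X y" unfolding XV using d by (simp add: rspace_def)
        then have "Poly_Mapping.lookup ?x i - Poly_Mapping.lookup ?x j = of_int c"
          using t unfolding X_def gain_sol_def by auto
        then show False using d by (simp add: lookup_single)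
      qed
    qed (simp add: X_def V)
    have "poly (arr_char_poly (gain_arr I T)) (int q) = (\<Sum>Y\<in>?L. moebius ?L ?V Y * int q ^ flat_dim Y)"
      by (simp add: arr_char_poly_def poly_sum poly_monom)
    also have "\<dots> = (\<Sum>Y\<in>?L. \<Sum>y\<in>?P. if X y \<subseteq> Y then moebius ?L ?V Y else 0)"
      by (intro sum.cong refl) (auto simp: dimY sum_distrib_left intro!: sum.cong)
    also have "\<dots> = (\<Sum>y\<in>?P. \<Sum>Y\<in>?L. if X y \<subseteq> Y then moebius ?L ?V Y else 0)" by (rule sum.swap)
    also have "\<dots> = (\<Sum>y\<in>?P. if X y = ?V then 1 else 0)"
    proof (intro sum.cong refl)
      fix y assume "y \<in> ?P"
      then show "(\<Sum>Y\<in>?L. if X y \<subseteq> Y then moebius ?L ?V Y else 0) = (if X y = ?V then 1 else 0)"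
        using sum_moebius[OF fL VL LV XL] fL by (simp add: sum.inter_filter[symmetric])
    qed
    also have "\<dots> = int (card {y \<in> ?P. S y = {}})" using fP by (simp add: XV sum.If_cases Int_def)
    also have "{y \<in> ?P. S y = {}} = {y \<in> ?P. \<forall>(i, j, c)\<in>T. \<not> int q dvd y i - y j - c}"
      by (auto simp: S_def)
    finally show ?thesis .
  qed
  then show ?thesis by blast
qed

section \<open>The characteristic polynomials\<close>

lemma card_fibration:
  fixes F F' :: "(nat \<Rightarrow> int) set"
  assumes "finite F'" and mem: "\<And>y. y \<in> F \<longleftrightarrow> y(m := 0) \<in> F' \<and> y m \<in> Al (y(m := 0))"
    and z: "\<And>y. y \<in> F' \<Longrightarrow> y m = 0" and Al: "\<And>y. y \<in> F' \<Longrightarrow> finite (Al y) \<and> card (Al y) = c"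
  shows "finite F \<and> card F = c * card F'"
proof -
  have "bij_betw (\<lambda>(y, v). y(m := v)) (Sigma F' Al) F"
  proof (rule bij_betw_byWitness[where f' = "\<lambda>y. (y(m := 0), y m)"])
    show "\<forall>a\<in>Sigma F' Al. (((\<lambda>(y, v). y(m := v)) a)(m := 0), ((\<lambda>(y, v). y(m := v)) a) m) = a"
      using z by (auto simp: fun_eq_iff)
    show "(\<lambda>(y, v). y(m := v)) ` Sigma F' Al \<subseteq> F"
    proof (rule image_subsetI, clarify)
      fix y v assume y: "y \<in> F'" "v \<in> Al y"
      then have "y(m := 0) = y" using z by auto
      then show "y(m := v) \<in> F" using y unfolding mem by simp
    qed
  qed (use mem in auto)
  moreover have "finite (Sigma F' Al)" "card (Sigma F' Al) = c * card F'"
    using assms(1) Al by auto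
  ultimately show ?thesis using bij_betw_same_card bij_betw_finite by metis
qed

definition inj_points :: "nat \<Rightarrow> nat \<Rightarrow> int set \<Rightarrow> (nat \<Rightarrow> int) set" where
  "inj_points l m W = {z. (\<forall>i. i \<notin> {m..l} \<longrightarrow> z i = 0) \<and> (\<forall>i\<in>{m..l}. z i \<in> W) \<and> inj_on z {m..l}}"

lemma card_inj_points:
  assumes W: "finite W" and "m \<le> l + 1"
  shows "finite (inj_points l m W) \<and> card (inj_points l m W) = (\<Prod>i = m..l. card W - (l - i))"
  using assms(2)
proof (induction m rule: inc_induct)
  case base
  have "inj_points l (l + 1) W = {\<lambda>_. 0}" by (auto simp: inj_points_def)
  then show ?case by simp
next
  case (step m)
  let ?Al = "\<lambda>y. W - y ` {Suc m..l}"
  have ml: "{m..l} = insert m {Suc m..l}" using step by auto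
  have "finite (inj_points l m W) \<and> card (inj_points l m W) = (card W - (l - m)) * card (inj_points l (Suc m) W)"
  proof (rule card_fibration)
    show "finite (inj_points l (Suc m) W)" using step by simp
    show "y m = 0" if "y \<in> inj_points l (Suc m) W" for y using that by (auto simp: inj_points_def)
    show "finite (?Al y) \<and> card (?Al y) = card W - (l - m)" if "y \<in> inj_points l (Suc m) W" for y
    proof -
      have "card (y ` {Suc m..l}) = l - m" using that by (subst card_image) (auto simp: inj_points_def)
      moreover have "y ` {Suc m..l} \<subseteq> W" using that by (auto simp: inj_points_def)
      ultimately show ?thesis using W by (simp add: card_Diff_subset)
    qed
    fix y :: "nat \<Rightarrow> int"
    have "inj_on (y(m := 0)) {Suc m..l} \<longleftrightarrow> inj_on y {Suc m..l}" by (auto simp: inj_on_def)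
    moreover have "(y(m := 0)) ` {Suc m..l} = y ` {Suc m..l}" by auto
    ultimately show "y \<in> inj_points l m W \<longleftrightarrow> y(m := 0) \<in> inj_points l (Suc m) W \<and> y m \<in> ?Al (y(m := 0))"
      unfolding inj_points_def ml by auto
  qed
  moreover have "(\<Prod>i = m..l. card W - (l - i)) = (card W - (l - m)) * (\<Prod>i = Suc m..l. card W - (l - i))"
    unfolding ml by simp
  ultimately show ?case using step by simp
qed

text \<open>The integers \<open>y j\<close> and \<open>y j + 1\<close> for \<open>j \<in> J\<close>
  are all distinct and fit between \<open>lo\<close> and \<open>hi\<close>.\<close>

lemma card_spaced_le:
  fixes y :: "nat \<Rightarrow> int"
  assumes J: "finite J" "inj_on y J" "\<And>i j. i \<in> J \<Longrightarrow> j \<in> J \<Longrightarrow> y i - y j \<noteq> 1"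
    and rng: "\<And>j. j \<in> J \<Longrightarrow> lo \<le> y j \<and> y j + 1 < hi" and "lo \<le> hi"
  shows "2 * int (card J) \<le> hi - lo"
proof -
  have "card (y ` J \<union> (\<lambda>j. y j + 1) ` J) = card (y ` J) + card ((\<lambda>j. y j + 1) ` J)"
  proof (rule card_Un_disjoint)
    have "y i \<noteq> y j + 1" if "i \<in> J" "j \<in> J" for i j using J(3)[OF that] by auto
    then show "y ` J \<inter> (\<lambda>j. y j + 1) ` J = {}" by blast
  qed (use J in auto)
  moreover have "card ((\<lambda>j. y j + 1) ` J) = card J" "card (y ` J) = card J"
    using J(2) by (auto intro!: card_image simp: inj_on_def)
  moreover have "card (y ` J \<union> (\<lambda>j. y j + 1) ` J) \<le> card {lo..<hi}"
    using rng by (intro card_mono) force+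
  ultimately show ?thesis using assms(5) by simp
qed

context CD
begin

text \<open>Modulo \<open>q\<close> the forbidden weights are the residues up to \<open>k\<close>
  and the last \<open>a + of_bool (i \<in> S)\<close> ones, so an interval is left. Within it no
  difference becomes \<open>1\<close> by wrapping around.\<close>

definition block_points :: "nat \<Rightarrow> (nat \<Rightarrow> int) set" where
  "block_points q = {y. (\<forall>i. i \<notin> {k..l} \<longrightarrow> y i = 0)
     \<and> (\<forall>i\<in>{k..l}. int k + 1 \<le> y i \<and> y i \<le> int q - 1 - int a - of_bool (i \<in> S))
     \<and> inj_on y {k..l} \<and> (\<forall>i\<in>{k..l}. \<forall>j\<in>S. y i - y j \<noteq> 1)}"

abbreviation below :: "(nat \<Rightarrow> int) \<Rightarrow> nat \<Rightarrow> int" where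
  "below z i \<equiv> int (card {j \<in> S. z j < z i})"

definition spread :: "(nat \<Rightarrow> int) \<Rightarrow> nat \<Rightarrow> int" where
  "spread z i = (if i \<in> {k..l} then z i + below z i else 0)"

definition compress :: "(nat \<Rightarrow> int) \<Rightarrow> nat \<Rightarrow> int" where
  "compress y i = (if i \<in> {k..l} then y i - below y i else 0)"

text \<open>If \<open>i \<in> S\<close>, then \<open>i\<close> itself is counted for
  \<open>i'\<close> but not for \<open>i\<close>. So every coordinate above a head of edges ends up
  at distance at least 2, which excludes the difference 1.\<close>

lemma spread_less:
  assumes "i \<in> {k..l}" "i' \<in> {k..l}" "z i < z i'"
  shows "spread z i + 1 + of_bool (i \<in> S) \<le> spread z i'"
proof -
  have "card {j \<in> S. z j < z i} + of_bool (i \<in> S) \<le> card {j \<in> S. z j < z i'}"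
  proof (cases "i \<in> S")
    case True
    have "{j \<in> S. z j < z i} \<subset> {j \<in> S. z j < z i'}" using assms True by auto
    then have "card {j \<in> S. z j < z i} < card {j \<in> S. z j < z i'}" by (rule psubset_card_mono[rotated]) (simp add: finS)
    then show ?thesis using True by simp
  next
    case False
    then show ?thesis using assms finS by (auto intro!: card_mono)
  qed
  then have "below z i + of_bool (i \<in> S) \<le> below z i'" by (cases "i \<in> S") auto
  then show ?thesis using assms by (simp add: spread_def)
qed

lemma spread_less_iff:
  assumes "i \<in> {k..l}" "i' \<in> {k..l}"
  shows "spread z i < spread z i' \<longleftrightarrow> z i < z i'"
proof -
  have "spread z i = spread z i'" if "z i = z i'" using that assms by (simp add: spread_def)
  then show ?thesis
    using spread_less[OF assms, of z] spread_less[OF assms(2,1), of z]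
    by (cases "z i" "z i'" rule: linorder_cases) (auto simp: of_bool_def split: if_splits)
qed

text \<open>The subtracted counts differ by the number of coordinates from \<open>S\<close> in the
  half-open interval from \<open>y i\<close> to \<open>y i'\<close>. These are spaced by at least 2,
  so they number at most half of its length and the order survives.\<close>

lemma compress_less:
  assumes y: "y \<in> block_points q" and i: "i \<in> {k..l}" "i' \<in> {k..l}" "y i < y i'"
  shows "compress y i < compress y i'"
proof -
  let ?J = "{j \<in> S. y i \<le> y j \<and> y j < y i'}"
  have J: "?J \<subseteq> {k..l}" using S by auto
  have "2 * int (card ?J) \<le> y i' - y i"
  proof (rule card_spaced_le)
    show "inj_on y ?J" using y J by (auto simp: block_points_def intro: inj_on_subset)
    show "y j - y j' \<noteq> 1" if "j \<in> ?J" "j' \<in> ?J" for j j' using that y J by (auto simp: block_points_def)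
    show "y i \<le> y j \<and> y j + 1 < y i'" if "j \<in> ?J" for j
    proof -
      have "y i' - y j \<noteq> 1" using that y i by (auto simp: block_points_def)
      then show ?thesis using that by auto
    qed
  qed (use finS i in auto)
  moreover have "card {j \<in> S. y j < y i'} = card {j \<in> S. y j < y i} + card ?J"
  proof -
    have "{j \<in> S. y j < y i'} = {j \<in> S. y j < y i} \<union> ?J" using i by auto
    moreover have "card ({j \<in> S. y j < y i} \<union> ?J) = card {j \<in> S. y j < y i} + card ?J"
      by (rule card_Un_disjoint) (use finS in auto)
    ultimately show ?thesis by (simp only:)
  qed
  ultimately show ?thesis using i by (simp add: compress_def)
qed

lemma compress_less_iff:
  assumes "y \<in> block_points q" "i \<in> {k..l}" "i' \<in> {k..l}"
  shows "compress y i < compress y i' \<longleftrightarrow> y i < y i'"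
proof -
  have "compress y i = compress y i'" if "y i = y i'" using that assms by (simp add: compress_def)
  then show ?thesis
    using compress_less[OF assms] compress_less[OF assms(1,3,2)]
    by (cases "y i" "y i'" rule: linorder_cases) auto
qed

lemma spread_in_block_points:
  assumes z: "z \<in> inj_points l k {int k + 1..int q - 1 - int l}"
  shows "spread z \<in> block_points q"
proof -
  have zi: "int k + 1 \<le> z i" "z i \<le> int q - 1 - int l" if "i \<in> {k..l}" for i
    using z that by (auto simp: inj_points_def)
  have "spread z i \<le> int q - 1 - int a - of_bool (i \<in> S)" if i: "i \<in> {k..l}" for i
  proof -
    \<comment> \<open>The shift is at most \<open>card S\<close>, or one less for
      \<open>i \<in> S\<close>; since \<open>a + card S = l\<close>, it raises the top
      \<open>q - 1 - l\<close> exactly to the required bound.\<close>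
    have "card {j \<in> S. z j < z i} \<le> card (S - {i})" using finS by (intro card_mono) auto
    also have "int \<dots> = int (card S) - of_bool (i \<in> S)"
      using finS card_gt_0_iff[of S] by (auto simp: card_Diff_singleton_if Suc_leI)
    finally show ?thesis using zi(2)[OF i] a i by (simp add: spread_def)
  qed
  moreover have "inj_on (spread z) {k..l}"
  proof (rule inj_onI)
    fix i j assume ij: "i \<in> {k..l}" "j \<in> {k..l}" "spread z i = spread z j"
    then have "z i = z j" using spread_less_iff[of i j z] spread_less_iff[of j i z] by auto
    then show "i = j" using z ij by (auto simp: inj_points_def inj_on_def)
  qed
  moreover have "spread z i - spread z j \<noteq> 1" if "i \<in> {k..l}" "j \<in> S" for i j
  proof (cases "z j < z i")
    case True
    then show ?thesis using spread_less[of j i z] that S by auto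
  next
    case False
    then show ?thesis using spread_less_iff[of j i z] that S by auto
  qed
  moreover have "int k + 1 \<le> spread z i" if "i \<in> {k..l}" for i
    using zi(1)[OF that] that by (simp add: spread_def)
  ultimately show ?thesis by (auto simp: block_points_def spread_def)
qed

lemma compress_in_inj_points:
  assumes y: "y \<in> block_points q"
  shows "compress y \<in> inj_points l k {int k + 1..int q - 1 - int l}"
proof -
  have yi: "int k + 1 \<le> y i" "y i \<le> int q - 1 - int a - of_bool (i \<in> S)" if "i \<in> {k..l}" for i
    using y that by (auto simp: block_points_def)
  have sp: "y i - y j \<noteq> 1" if "i \<in> {k..l}" "j \<in> S" for i j using y that by (auto simp: block_points_def)
  have inj: "inj_on y {k..l}" using y by (auto simp: block_points_def)
  have "int k + 1 \<le> compress y i" if i: "i \<in> {k..l}" for i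
  proof -
    have "2 * int (card {j \<in> S. y j < y i}) \<le> y i - (int k + 1)"
    proof (rule card_spaced_le)
      show "inj_on y {j \<in> S. y j < y i}" using inj S by (auto intro: inj_on_subset)
      show "int k + 1 \<le> y j \<and> y j + 1 < y i" if "j \<in> {j \<in> S. y j < y i}" for j
        using that yi(1)[of j] sp[OF i, of j] S by auto
      show "y j - y j' \<noteq> 1" if "j \<in> {j \<in> S. y j < y i}" "j' \<in> {j \<in> S. y j < y i}" for j j'
        using that sp S by auto
    qed (use finS yi[OF i] in auto)
    then show ?thesis using i by (simp add: compress_def)
  qed
  moreover have "compress y i \<le> int q - 1 - int l" if i: "i \<in> {k..l}" for i
  proof -
    \<comment> \<open>The upper bound is obtained from the coordinates above \<open>y i\<close>:
      they are spaced in the remaining room, and together with those below and possibly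
      \<open>i\<close> itself they make up \<open>S\<close>. For \<open>i \<in> S\<close> the next
      one is at least \<open>y i + 2\<close>, hence \<open>?e\<close>.\<close>
    let ?U = "{j \<in> S. y i < y j}" and ?e = "of_bool (i \<in> S) :: int"
    have "2 * int (card ?U) \<le> (int q - int a) - (y i + 1 + ?e)"
    proof (rule card_spaced_le)
      show "inj_on y ?U" using inj S by (auto intro: inj_on_subset)
      show "y i + 1 + ?e \<le> y j \<and> y j + 1 < int q - int a" if "j \<in> ?U" for j
      proof -
        have "y j - y i \<noteq> 1" if "i \<in> S" using sp[of j i] \<open>j \<in> ?U\<close> S that by auto
        moreover have "y j \<le> int q - 1 - int a - 1" using yi(2)[of j] \<open>j \<in> ?U\<close> S by auto
        ultimately show ?thesis using that by auto
      qed
      show "y j - y j' \<noteq> 1" if "j \<in> ?U" "j' \<in> ?U" for j j' using that sp S by auto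
    qed (use finS yi(2)[OF i] in auto)
    moreover have "int (card S) = below y i + int (card ?U) + ?e"
    proof -
      have "S = {j \<in> S. y j < y i} \<union> (?U \<union> {j \<in> S. j = i})"
        using inj i S by (auto simp: inj_on_def) (metis linorder_less_linear subsetD atLeastAtMost_iff)
      then have "card S = card ({j \<in> S. y j < y i} \<union> (?U \<union> {j \<in> S. j = i}))" by simp
      also have "\<dots> = card {j \<in> S. y j < y i} + (card ?U + card {j \<in> S. j = i})"
        using finS by (subst card_Un_disjoint; (subst card_Un_disjoint)?) auto
      also have "{j \<in> S. j = i} = (if i \<in> S then {i} else {})" by auto
      finally show ?thesis by simp
    qed
    ultimately show ?thesis using i a by (simp add: compress_def)
  qed
  moreover have "inj_on (compress y) {k..l}"
  proof (rule inj_onI)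
    fix i j assume ij: "i \<in> {k..l}" "j \<in> {k..l}" "compress y i = compress y j"
    then have "y i = y j" using compress_less_iff[OF y, of i j] compress_less_iff[OF y, of j i] by auto
    then show "i = j" using inj ij by (auto simp: inj_on_def)
  qed
  ultimately show ?thesis by (auto simp: inj_points_def compress_def)
qed

lemma card_block_points:
  assumes q: "q > 2 * l + 2"
  shows "finite (block_points q) \<and> card (block_points q) = (\<Prod>i = k..l. q - 1 - l - i)"
proof -
  let ?W = "{int k + 1..int q - 1 - int l}"
  have "bij_betw spread (inj_points l k ?W) (block_points q)"
  proof (rule bij_betw_byWitness[where f' = compress])
    show "\<forall>z\<in>inj_points l k ?W. compress (spread z) = z"
    proof (intro ballI ext)
      fix z i assume z: "z \<in> inj_points l k ?W"
      show "compress (spread z) i = z i"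
      proof (cases "i \<in> {k..l}")
        case True
        have "{j \<in> S. spread z j < spread z i} = {j \<in> S. z j < z i}"
          using spread_less_iff[of _ i z] S True by auto
        then show ?thesis using True by (simp add: compress_def) (simp add: spread_def)
      next
        case False
        then show ?thesis using z by (auto simp: compress_def inj_points_def)
      qed
    qed
    show "\<forall>y\<in>block_points q. spread (compress y) = y"
    proof (intro ballI ext)
      fix y i assume y: "y \<in> block_points q"
      show "spread (compress y) i = y i"
      proof (cases "i \<in> {k..l}")
        case True
        have "{j \<in> S. compress y j < compress y i} = {j \<in> S. y j < y i}"
          using compress_less_iff[OF y, of _ i] S True by auto
        then show ?thesis using True by (simp add: spread_def) (simp add: compress_def)
      next
        case False
        then show ?thesis using y by (auto simp: spread_def block_points_def)
      qed
    qed
  qed (use spread_in_block_points compress_in_inj_points in auto)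
  moreover have "finite (inj_points l k ?W) \<and> card (inj_points l k ?W) = (\<Prod>i = k..l. card ?W - (l - i))"
    using k by (intro card_inj_points) auto
  \<comment> \<open>The window has \<open>q - 1 - l - k\<close> elements; reversing
    \<open>k..l\<close> turns \<open>q - 1 - l - k - (l - i)\<close> into the factor for
    \<open>l + k - i\<close>.\<close>
  moreover have "(\<Prod>i = k..l. card ?W - (l - i)) = (\<Prod>i = k..l. q - 1 - l - i)"
    using q k by (intro prod.reindex_bij_witness[of _ "\<lambda>i. l + k - i" "\<lambda>i. l + k - i"]) auto
  ultimately show ?thesis using bij_betw_same_card bij_betw_finite by metis
qed

section \<open>Choosing the coordinates below the block\<close>

definition lower_points :: "nat \<Rightarrow> nat \<Rightarrow> (nat \<Rightarrow> int) set" where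
  "lower_points q m = {y. (\<forall>i. i \<notin> {m..l} \<longrightarrow> y i = 0)
     \<and> (\<forall>i\<in>{m..<k}. int i + 1 \<le> y i \<and> y i \<le> int q - 1 - int i)
     \<and> (\<forall>i\<in>{k..l}. int k + 1 \<le> y i \<and> y i \<le> int q - 1 - int a - of_bool (i \<in> S))
     \<and> inj_on y {m..l} \<and> (\<forall>i\<in>{k..l}. \<forall>j\<in>S. y i - y j \<noteq> 1)}"

text \<open>Windows shrink with growing index, and by \<open>a_ge\<close> those of the block are
  covered too. So the \<open>l - m\<close> values chosen before lie in the window of
  \<open>m\<close>, which has \<open>q - 1 - 2 m\<close> elements, and \<open>q - 1 - l - m\<close>
  choices remain whatever these values are.\<close>

lemma card_lower_points:
  assumes q: "q > 2 * l + 2" and "m \<le> k"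
  shows "finite (lower_points q m) \<and> card (lower_points q m) = (\<Prod>i = m..l. q - 1 - l - i)"
  using assms(2)
proof (induction m rule: inc_induct)
  case base
  have "lower_points q k = block_points q" by (auto simp: lower_points_def block_points_def)
  then show ?case using card_block_points[OF q] by simp
next
  case (step m)
  let ?W = "{int m + 1..int q - 1 - int m}"
  let ?Al = "\<lambda>y. ?W - y ` {Suc m..l}"
  have mk: "m < k" "m \<le> l" using step k by auto
  have ml: "{m..l} = insert m {Suc m..l}" and mk': "{m..<k} = insert m {Suc m..<k}" using mk by auto
  have "finite (lower_points q m) \<and> card (lower_points q m) = (q - 1 - l - m) * card (lower_points q (Suc m))"
  proof (rule card_fibration)
    show "finite (lower_points q (Suc m))" using step by simp
    show "y m = 0" if "y \<in> lower_points q (Suc m)" for y using that by (auto simp: lower_points_def)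
    show "finite (?Al y) \<and> card (?Al y) = q - 1 - l - m" if y: "y \<in> lower_points q (Suc m)" for y
    proof -
      have "card (y ` {Suc m..l}) = l - m" using y by (subst card_image) (auto simp: lower_points_def)
      moreover have "y ` {Suc m..l} \<subseteq> ?W"
      proof (rule image_subsetI)
        fix i assume i: "i \<in> {Suc m..l}"
        show "y i \<in> ?W"
        proof (cases "i < k")
          case True
          then have "int i + 1 \<le> y i" "y i \<le> int q - 1 - int i" using y i by (auto simp: lower_points_def)
          then show ?thesis using i by auto
        next
          case False
          then have "int k + 1 \<le> y i" "y i \<le> int q - 1 - int a - of_bool (i \<in> S)"
            using y i by (auto simp: lower_points_def)
          moreover have "0 \<le> (of_bool (i \<in> S) :: int)" by simp
          ultimately have "int k + 1 \<le> y i \<and> y i \<le> int q - 1 - int a" by linarith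
          then show ?thesis using mk a_ge by auto
        qed
      qed
      ultimately have "card (?Al y) = card ?W - (l - m)" by (simp add: card_Diff_subset)
      also have "card ?W - (l - m) = q - 1 - l - m" using q mk by simp
      finally show ?thesis by simp
    qed
    fix y :: "nat \<Rightarrow> int"
    have "inj_on (y(m := 0)) {Suc m..l} \<longleftrightarrow> inj_on y {Suc m..l}" by (auto simp: inj_on_def)
    moreover have "(y(m := 0)) ` {Suc m..l} = y ` {Suc m..l}" by auto
    moreover have "(\<forall>i\<in>{k..l}. \<forall>j\<in>S. (y(m := 0)) i - (y(m := 0)) j \<noteq> 1) \<longleftrightarrow> (\<forall>i\<in>{k..l}. \<forall>j\<in>S. y i - y j \<noteq> 1)"
    proof -
      have "(y(m := 0)) i = y i" if "i \<in> {k..l}" for i using that mk by auto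
      then show ?thesis using S by (metis subsetD)
    qed
    moreover have "(\<forall>i\<in>{k..l}. int k + 1 \<le> (y(m := 0)) i \<and> (y(m := 0)) i \<le> int q - 1 - int a - of_bool (i \<in> S))
        \<longleftrightarrow> (\<forall>i\<in>{k..l}. int k + 1 \<le> y i \<and> y i \<le> int q - 1 - int a - of_bool (i \<in> S))"
      using mk by auto
    ultimately show "y \<in> lower_points q m \<longleftrightarrow> y(m := 0) \<in> lower_points q (Suc m) \<and> y m \<in> ?Al (y(m := 0))"
      unfolding lower_points_def ml mk' by auto
  qed
  moreover have "(\<Prod>i = m..l. q - 1 - l - i) = (q - 1 - l - m) * (\<Prod>i = Suc m..l. q - 1 - l - i)"
    unfolding ml by simp
  ultimately show ?case using step by simp
qed

text \<open>Weights from \<open>-u\<close> to \<open>v\<close> remove residues at both ends of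
  \<open>{0..<q}\<close>. What remains makes every expression \<open>y i - y j - c\<close> smaller
  than \<open>q\<close> in absolute value, so divisibility by \<open>q\<close> means being
  zero.\<close>

lemma complement_eq_lower_points:
  assumes q: "q > 2 * l + 2"
  shows "{y \<in> mod_points {1..l} q. \<forall>(i, j, c)\<in>T. \<not> int q dvd y i - y j - c} = lower_points q 1"
proof (intro subset_antisym subsetI)
  fix y assume "y \<in> {y \<in> mod_points {1..l} q. \<forall>(i, j, c)\<in>T. \<not> int q dvd y i - y j - c}"
  then have rng: "\<And>i. i \<in> {1..l} \<Longrightarrow> 0 \<le> y i \<and> y i < int q" and y0: "\<And>i. i \<notin> {1..l} \<Longrightarrow> y i = 0"
    and T: "\<And>i j c. (i, j, c) \<in> T \<Longrightarrow> \<not> int q dvd y i - y j - c"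
    by (auto simp: mod_points_def)
  have weight: "v + 1 \<le> y i \<and> y i \<le> int q - 1 - u"
    if i: "i \<in> {1..l}" and w: "\<And>c. - u \<le> c \<Longrightarrow> c \<le> v \<Longrightarrow> (i, 0, c) \<in> T" and uv: "0 \<le> u" "0 \<le> v" for i u v
  proof (rule ccontr)
    assume "\<not> ?thesis"
    then consider "y i \<le> v" | "y i - int q \<ge> - u" by linarith
    then show False
    proof cases
      case 1
      then show ?thesis using T[OF w[of "y i"]] rng[OF i] uv y0[of 0] by auto
    next
      case 2
      then show ?thesis using T[OF w[of "y i - int q"]] rng[OF i] uv y0[of 0] by auto
    qed
  qed
  have "inj_on y {1..l}"
  proof (rule linorder_inj_onI)
    fix i j assume ij: "i < j" "i \<in> {1..l}" "j \<in> {1..l}"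
    then have "(i, j, 0) \<in> T" by (auto simp: CD_gains_def)
    then show "y i \<noteq> y j" using T by fastforce
  qed auto
  moreover have "int i + 1 \<le> y i \<and> y i \<le> int q - 1 - int i" if "i \<in> {1..<k}" for i
    by (rule weight) (use that k in \<open>auto simp: CD_gains_def\<close>)
  moreover have "int k + 1 \<le> y i \<and> y i \<le> int q - 1 - (int a + of_bool (i \<in> S))" if "i \<in> {k..l}" for i
    by (rule weight) (use that k in \<open>auto simp: CD_gains_def\<close>)
  moreover have "y i - y j \<noteq> 1" if "i \<in> {k..l}" "j \<in> S" for i j
  proof (cases "i = j")
    case False
    then have "(i, j, 1) \<in> T" using that by (auto simp: CD_gains_def)
    then show ?thesis using T by fastforce
  qed simp
  ultimately show "y \<in> lower_points q 1" using y0 by (auto simp: lower_points_def algebra_simps)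
next
  fix y assume y: "y \<in> lower_points q 1"
  have y0: "\<And>i. i \<notin> {1..l} \<Longrightarrow> y i = 0" and inj: "inj_on y {1..l}"
    and w1: "\<And>i. i \<in> {1..<k} \<Longrightarrow> int i + 1 \<le> y i \<and> y i \<le> int q - 1 - int i"
    and w2: "\<And>i. i \<in> {k..l} \<Longrightarrow> int k + 1 \<le> y i \<and> y i \<le> int q - 1 - int a - of_bool (i \<in> S)"
    and sp: "\<And>i j. i \<in> {k..l} \<Longrightarrow> j \<in> S \<Longrightarrow> y i - y j \<noteq> 1"
    using y by (auto simp: lower_points_def)
  have rng: "1 \<le> y i \<and> y i < int q" if "i \<in> {1..l}" for i
  proof (cases "i < k")
    case True
    then show ?thesis using w1[of i] that by auto
  next
    case False
    then have "int k + 1 \<le> y i \<and> y i \<le> int q - 1 - int a - of_bool (i \<in> S)" using w2[of i] that by auto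
    moreover have "0 \<le> (of_bool (i \<in> S) :: int)" by simp
    ultimately show ?thesis by linarith
  qed
  have nd: "\<not> int q dvd d" if "d \<noteq> 0" "\<bar>d\<bar> < int q" for d
    using dvd_imp_le_int[OF that(1)] that(2) by fastforce
  have "\<not> int q dvd y i - y j - c" if t: "(i, j, c) \<in> T" for i j c
  proof -
    consider (eq) "c = 0" "i < j" "i \<in> {1..l}" "j \<in> {1..l}" | (edge) "c = 1" "i \<in> {k..l}" "j \<in> S"
      | (low) "j = 0" "i \<in> {1..<k}" "- int i \<le> c" "c \<le> int i"
      | (blk) "j = 0" "i \<in> {k..l}" "- int a - of_bool (i \<in> S) \<le> c" "c \<le> int k"
      using t by (auto simp: CD_gains_def)
    then show ?thesis
    proof cases
      case eq
      then have "y i \<noteq> y j" using inj_onD[OF inj, of i j] by blast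
      then show ?thesis using eq rng[of i] rng[of j] by (intro nd) auto
    next
      case edge
      have "i \<in> {1..l}" "j \<in> {1..l}" using edge S k by auto
      moreover have "y j \<le> int q - 2" using w2[of j] edge S by auto
      ultimately show ?thesis using edge sp[of i j] rng[of i] rng[of j] by (intro nd) auto
    next
      case low
      then show ?thesis using w1[of i] y0[of 0] by (intro nd) auto
    next
      case blk
      then show ?thesis using w2[of i] y0[of 0] by (intro nd) auto
    qed
  qed
  moreover have "y \<in> mod_points {1..l} q" using y0 rng by (fastforce simp: mod_points_def)
  ultimately show "y \<in> {y \<in> mod_points {1..l} q. \<forall>(i, j, c)\<in>T. \<not> int q dvd y i - y j - c}" by blast
qed

text \<open>The values depend on \<open>l\<close> alone, whence the invariance under both
  eliminations. Above the bound chosen in the proof no factor is truncated.\<close>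

theorem char_poly_CD_values:
  "\<exists>b. \<forall>q>b. poly (arr_char_poly (gain_arr {1..l} T)) (int q) = int (\<Prod>i = 1..l. q - 1 - l - i)"
proof -
  obtain b where b: "\<And>q. q > b \<Longrightarrow> poly (arr_char_poly (gain_arr {1..l} T)) (int q)
    = int (card {y \<in> mod_points {1..l} q. \<forall>(i, j, c)\<in>T. \<not> int q dvd y i - y j - c})"
    using char_poly_eq_count[OF gains_T] by blast
  have "poly (arr_char_poly (gain_arr {1..l} T)) (int q) = int (\<Prod>i = 1..l. q - 1 - l - i)"
    if "q > max b (2 * l + 2)" for q
    using b[of q] complement_eq_lower_points[of q] card_lower_points[of q 1] that k by simp
  then show ?thesis by blast
qed

end

lemma poly_eqI_eventually:
  fixes p r :: "int poly"
  assumes "\<And>q :: nat. q > b \<Longrightarrow> poly p (int q) = poly r (int q)"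
  shows "p = r"
proof (rule ccontr)
  assume "p \<noteq> r"
  then have "finite {x. poly (p - r) x = 0}" by (intro poly_roots_finite) simp
  moreover have "int ` {b<..} \<subseteq> {x. poly (p - r) x = 0}" using assms by auto
  ultimately have "finite (int ` {b<..})" by (rule finite_subset[rotated])
  then have "finite {b<..}" by (rule finite_imageD) simp
  then show False by (simp add: infinite_Ioi)
qed

theorem char_poly_CD_eq:
  assumes "CD l k a S" "CD l k' a' S'"
  shows "arr_char_poly (gain_arr {1..l} (CD_gains l k S a)) = arr_char_poly (gain_arr {1..l} (CD_gains l k' S' a'))"
proof -
  obtain b b' where "\<forall>q>b. poly (arr_char_poly (gain_arr {1..l} (CD_gains l k S a))) (int q) = int (\<Prod>i = 1..l. q - 1 - l - i)"
    "\<forall>q>b'. poly (arr_char_poly (gain_arr {1..l} (CD_gains l k' S' a'))) (int q) = int (\<Prod>i = 1..l. q - 1 - l - i)"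
    using CD.char_poly_CD_values[OF assms(1)] CD.char_poly_CD_values[OF assms(2)] by blast
  then show ?thesis by (intro poly_eqI_eventually[of "max b b'"]) simp
qed

section \<open>Supersolvability of the last cone\<close>

text \<open>If the sum of \<open>X\<close> with any flat is a flat, it is their meet in the lattice,
  and the claim becomes Dedekind's modular law for subspaces.\<close>

lemma modular_flat_if_sum_closed:
  fixes L :: "'a::real_vector set set"
  assumes X: "X \<in> L" and sub: "\<And>Y. Y \<in> L \<Longrightarrow> subspace Y" and int: "\<And>Y Z. Y \<in> L \<Longrightarrow> Z \<in> L \<Longrightarrow> Y \<inter> Z \<in> L"
    and sum: "\<And>Y. Y \<in> L \<Longrightarrow> {x + y | x y. x \<in> X \<and> y \<in> Y} \<in> L"
  shows "modular_flat L X"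
  unfolding modular_flat_def
proof (intro conjI ballI impI X)
  fix Y Z assume Y: "Y \<in> L" and Z: "Z \<in> L" and YZ: "Y \<subseteq> Z"
  let ?P = "{x + y | x y. x \<in> X \<and> y \<in> Y}"
  have zero: "0 \<in> W" and add: "u \<in> W \<Longrightarrow> v \<in> W \<Longrightarrow> u + v \<in> W" and diff: "u \<in> W \<Longrightarrow> v \<in> W \<Longrightarrow> u - v \<in> W"
    if "W \<in> L" for W u v
    using sub[OF that] by (auto intro: subspace_0 subspace_add subspace_diff)
  have XP: "X \<subseteq> ?P" and YP: "Y \<subseteq> ?P" using zero[OF X] zero[OF Y] by force+
  have "flat_meet L X Y = ?P"
    unfolding flat_meet_def
  proof (intro subset_antisym Inter_lower Inter_greatest)
    show "?P \<in> {W \<in> L. X \<union> Y \<subseteq> W}" using sum[OF Y] XP YP by blast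
    show "?P \<subseteq> W" if "W \<in> {W \<in> L. X \<union> Y \<subseteq> W}" for W
      using that add by blast
  qed
  moreover have "flat_meet L (Z \<inter> X) Y = Z \<inter> ?P"
    unfolding flat_meet_def
  proof (intro subset_antisym Inter_lower Inter_greatest)
    show "Z \<inter> ?P \<in> {W \<in> L. Z \<inter> X \<union> Y \<subseteq> W}" using int[OF Z sum[OF Y]] XP YP YZ by blast
    show "Z \<inter> ?P \<subseteq> W" if W: "W \<in> {W \<in> L. Z \<inter> X \<union> Y \<subseteq> W}" for W
    proof
      fix v assume "v \<in> Z \<inter> ?P"
      then obtain x y where v: "v = x + y" "v \<in> Z" "x \<in> X" "y \<in> Y" by blast
      then have "x \<in> Z" using diff[OF Z v(2), of y] YZ by auto
      then show "v \<in> W" using v W add[of W x y] by blast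
    qed
  qed
  ultimately show "Z \<inter> flat_meet L X Y = flat_meet L (Z \<inter> X) Y" by simp
qed

locale edgeless =
  fixes l :: nat
  assumes l: "1 \<le> l"
begin

abbreviation "I \<equiv> {1..l}"
abbreviation "J \<equiv> cone_coords {1..l}"
definition "T = CD_gains l l {l..l} (l - 1)"
abbreviation "A \<equiv> arr_cone (gain_arr {1..l} T)"

lemma mem_T: "(i, j, c) \<in> T \<longleftrightarrow> (c = 0 \<and> 1 \<le> i \<and> i < j \<and> j \<le> l) \<or> (j = 0 \<and> 1 \<le> i \<and> i \<le> l \<and> - int i \<le> c \<and> c \<le> int i)"
  using l by (auto simp: T_def CD_gains_def)

lemma CD_edgeless: "CD l l (l - 1) {l..l}"
  using l by unfold_locales auto

lemma gains_edgeless: "gains I T"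
  using CD.gains_T[OF CD_edgeless] unfolding T_def .

text \<open>Apart from the virtual index \<open>0\<close>, the first index of a triple in
  \<open>T\<close> is its smallest coordinate. So these are the hyperplanes whose equations avoid
  the coordinates below \<open>m\<close>.\<close>

definition hyps_from :: "nat \<Rightarrow> (nat option \<Rightarrow>\<^sub>0 real) set set" where
  "hyps_from m = insert (infinity_hyp I) (cone_hyp I ` {t \<in> T. m \<le> fst t})"

definition flats_from :: "nat \<Rightarrow> (nat option \<Rightarrow>\<^sub>0 real) set set" where
  "flats_from m = {rspace J \<inter> \<Inter>B | B. B \<subseteq> hyps_from m}"

lemma hyps_A: "hyps A = hyps_from 1"
proof -
  have "{t \<in> T. 1 \<le> fst t} = T" using gains_tripleD(4)[OF gains_edgeless] by (auto simp: Suc_le_eq)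
  then show ?thesis unfolding hyps_cone_gain_arr[OF gains_edgeless] hyps_from_def by simp
qed

lemma rspace_add: "x \<in> rspace K \<Longrightarrow> y \<in> rspace K \<Longrightarrow> x + y \<in> rspace K" for x y :: "'v \<Rightarrow>\<^sub>0 real"
  using keys_add[of x y] unfolding rspace_def by blast

lemma subspace_rspace: "subspace (rspace K)"
  unfolding subspace_def using rspace_add[of _ K] rspace_scaleR[of _ K] by (auto simp: rspace_def)

lemma subspace_hyp: "H \<in> hyps_from m \<Longrightarrow> subspace H"
  unfolding hyps_from_def infinity_hyp_def cone_hyp_def subspace_def
  by (auto simp: lookup_add lookup_scaleR algebra_simps rspace_add rspace_scaleR)
    (auto simp: rspace_def algebra_simps)

lemma subspace_flat: "Y \<in> flats_from m \<Longrightarrow> subspace Y"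
  unfolding flats_from_def
  by (auto intro!: subspace_inter subspace_rspace subspace_Inter dest: subsetD subspace_hyp)

lemma flats_A: "flats A = flats_from 1"
proof -
  have "flats A = flats_from 1 - {{}}"
    unfolding flats_def flats_from_def hyps_A coords_cone_gain_arr[OF gains_edgeless] ..
  moreover have "{} \<notin> flats_from 1" using subspace_flat[of "{}" 1] subspace_0 by blast
  ultimately show ?thesis by simp
qed

lemma flats_from_mono: "m \<le> n \<Longrightarrow> flats_from n \<subseteq> flats_from m"
proof -
  assume "m \<le> n"
  then have "hyps_from n \<subseteq> hyps_from m" by (auto simp: hyps_from_def)
  then show ?thesis unfolding flats_from_def by blast
qed

lemma flats_from_Inter:
  assumes "\<A> \<subseteq> flats_from m"
  shows "rspace J \<inter> \<Inter>\<A> \<in> flats_from m"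
proof -
  have "\<forall>Y\<in>\<A>. \<exists>B. B \<subseteq> hyps_from m \<and> Y = rspace J \<inter> \<Inter>B" using assms by (auto simp: flats_from_def)
  then obtain B where B: "\<And>Y. Y \<in> \<A> \<Longrightarrow> B Y \<subseteq> hyps_from m \<and> Y = rspace J \<inter> \<Inter>(B Y)" by metis
  have "rspace J \<inter> \<Inter>\<A> = rspace J \<inter> \<Inter>(\<Union>(B ` \<A>))"
  proof (intro subset_antisym subsetI)
    fix y assume "y \<in> rspace J \<inter> \<Inter>\<A>"
    then have "y \<in> Y" if "Y \<in> \<A>" for Y using that by blast
    then have "y \<in> H" if "Y \<in> \<A>" "H \<in> B Y" for Y H using B[OF that(1)] that by blast
    then show "y \<in> rspace J \<inter> \<Inter>(\<Union>(B ` \<A>))" using \<open>y \<in> rspace J \<inter> \<Inter>\<A>\<close> by blast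
  next
    fix y assume y: "y \<in> rspace J \<inter> \<Inter>(\<Union>(B ` \<A>))"
    have "y \<in> Y" if "Y \<in> \<A>" for Y using B[OF that] that y by blast
    then show "y \<in> rspace J \<inter> \<Inter>\<A>" using y by blast
  qed
  moreover have "\<Union>(B ` \<A>) \<subseteq> hyps_from m" using B by blast
  ultimately show ?thesis unfolding flats_from_def by blast
qed

lemma flats_from_Int: "Y \<in> flats_from m \<Longrightarrow> Z \<in> flats_from m \<Longrightarrow> Y \<inter> Z \<in> flats_from m"
proof -
  assume YZ: "Y \<in> flats_from m" "Z \<in> flats_from m"
  then have "Y \<subseteq> rspace J" by (auto simp: flats_from_def)
  then have "Y \<inter> Z = rspace J \<inter> \<Inter>{Y, Z}" by blast
  then show ?thesis using flats_from_Inter[of "{Y, Z}" m] YZ by simp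
qed

lemma hyps_from_flat: "H \<in> hyps_from m \<Longrightarrow> H \<in> flats_from m"
proof -
  assume H: "H \<in> hyps_from m"
  then have "H \<subseteq> rspace J" by (auto simp: hyps_from_def infinity_hyp_def cone_hyp_def)
  then have "H = rspace J \<inter> \<Inter>{H}" by blast
  then show ?thesis using H unfolding flats_from_def by blast
qed

lemma rspace_flat: "rspace J \<in> flats_from m"
  using flats_from_Inter[of "{}" m] by simp

section \<open>Elimination of a coordinate from a flat\<close>

definition prescribed :: "nat \<times> nat \<times> int \<Rightarrow> (nat option \<Rightarrow>\<^sub>0 real) \<Rightarrow> real" where
  "prescribed = (\<lambda>(m, j, c) y. Poly_Mapping.lookup y (Some j) + of_int c * Poly_Mapping.lookup y None)"

text \<open>Eliminating \<open>x_m\<close> from two equations must not leave the arrangement. Two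
  different weights give \<open>z = 0\<close>, and two equalities with distinct partners give an
  equality of these. A weight \<open>c\<close> and an equality \<open>x_m = x_j\<close> give
  \<open>x_j = c z\<close>, which is available because \<open>\<bar>c\<bar> \<le> m < j\<close>:
  here it matters that the weights grow with the index.\<close>

lemma prescribed_eq_flat:
  assumes t: "t \<in> T" "t' \<in> T" "fst t = m" "fst t' = m"
  shows "{y \<in> rspace J. prescribed t y = prescribed t' y} \<in> flats_from (Suc m)" (is "?K \<in> _")
proof -
  obtain j c j' c' where tt: "t = (m, j, c)" "t' = (m, j', c')" using t by (metis prod.collapse)
  have s0: "Poly_Mapping.lookup y (Some 0) = 0" if "y \<in> rspace J" for y
    using that by (rule lookup_rspace_0) simp
  have hyp: "cone_hyp I s \<in> flats_from (Suc m)" if "s \<in> T" "Suc m \<le> fst s" for s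
    using that by (intro hyps_from_flat) (auto simp: hyps_from_def)
  consider (eq) "j = j'" "c = c'" | (cc) "j = 0" "j' = 0" "c \<noteq> c'"
    | (jc) "m < j" "j \<le> l" "c = 0" "j' = 0" "- int m \<le> c'" "c' \<le> int m"
    | (cj) "m < j'" "j' \<le> l" "c' = 0" "j = 0" "- int m \<le> c" "c \<le> int m"
    | (lt) "m < j" "j < j'" "j' \<le> l" "c = 0" "c' = 0" | (gt) "m < j'" "j' < j" "j \<le> l" "c = 0" "c' = 0"
    using t(1,2) unfolding tt mem_T by (metis linorder_neqE_nat)
  then show ?thesis
  proof cases
    case eq
    then show ?thesis using rspace_flat by (simp add: tt)
  next
    case cc
    then have "?K = infinity_hyp I"
      by (auto simp: tt prescribed_def infinity_hyp_def)
    then show ?thesis using hyps_from_flat by (simp add: hyps_from_def)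
  next
    case jc
    then have "?K = cone_hyp I (j, 0, c')" by (auto simp: tt prescribed_def cone_hyp_def s0)
    then show ?thesis using jc hyp[of "(j, 0, c')"] by (simp add: mem_T)
  next
    case cj
    then have "?K = cone_hyp I (j', 0, c)" by (auto simp: tt prescribed_def cone_hyp_def s0)
    then show ?thesis using cj hyp[of "(j', 0, c)"] by (simp add: mem_T)
  next
    case lt
    then have "?K = cone_hyp I (j, j', 0)" by (auto simp: tt prescribed_def cone_hyp_def)
    then show ?thesis using lt hyp[of "(j, j', 0)"] by (simp add: mem_T)
  next
    case gt
    then have "?K = cone_hyp I (j', j, 0)" by (auto simp: tt prescribed_def cone_hyp_def)
    then show ?thesis using gt hyp[of "(j', j, 0)"] by (simp add: mem_T)
  qed
qed

lemma cone_hyp_prescribed: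
  "(m, j, c) \<in> T \<Longrightarrow> y \<in> cone_hyp I (m, j, c) \<longleftrightarrow> y \<in> rspace J \<and> Poly_Mapping.lookup y (Some m) = prescribed (m, j, c) y"
  by (auto simp: cone_hyp_def prescribed_def)

text \<open>Equations without \<open>x_m\<close> remain; those with \<open>x_m\<close> are replaced
  by the agreement of the values they prescribe, and \<open>prescribed_eq_flat\<close> keeps this
  within the flats.\<close>

lemma eliminate_coordinate:
  assumes Y: "Y \<in> flats_from m" and m: "1 \<le> m" "m \<le> l"
  shows "{v \<in> rspace J. \<exists>y\<in>Y. \<forall>u. u \<noteq> Some m \<longrightarrow> Poly_Mapping.lookup v u = Poly_Mapping.lookup y u} \<in> flats_from (Suc m)"
    (is "?E \<in> _")
proof -
  obtain B where B: "B \<subseteq> hyps_from m" "Y = rspace J \<inter> \<Inter>B" using Y by (auto simp: flats_from_def)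
  define B1 where "B1 = {t \<in> T. fst t = m \<and> cone_hyp I t \<in> B}"
  define B2 where "B2 = B \<inter> hyps_from (Suc m)"
  have B12: "B = cone_hyp I ` B1 \<union> B2"
  proof (intro subset_antisym subsetI)
    fix H assume H: "H \<in> B"
    then have "H = infinity_hyp I \<or> (\<exists>t\<in>T. m \<le> fst t \<and> H = cone_hyp I t)" using B(1) by (auto simp: hyps_from_def)
    then show "H \<in> cone_hyp I ` B1 \<union> B2"
      using H by (auto simp: B1_def B2_def hyps_from_def le_eq_less_or_eq Suc_le_eq)
  qed (auto simp: B1_def B2_def)
  have agree: "v \<in> H \<longleftrightarrow> y \<in> H" if "H \<in> hyps_from (Suc m)" "v \<in> rspace J" "y \<in> rspace J"
    "\<And>u. u \<noteq> Some m \<Longrightarrow> Poly_Mapping.lookup v u = Poly_Mapping.lookup y u" for H v y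
  proof -
    have "i \<noteq> m \<and> j \<noteq> m" if "(i, j, c) \<in> T" "Suc m \<le> i" for i j c using that m by (auto simp: mem_T)
    then show ?thesis using that unfolding hyps_from_def infinity_hyp_def cone_hyp_def by auto
  qed
  have presc: "prescribed t v = prescribed t y" if tB: "t \<in> B1" and vy: "\<And>u. u \<noteq> Some m \<Longrightarrow> Poly_Mapping.lookup v u = Poly_Mapping.lookup y u" for t v y
  proof -
    obtain j c where t: "t = (m, j, c)" "(m, j, c) \<in> T" using tB by (cases t) (auto simp: B1_def)
    then have "j \<noteq> m" using m by (auto simp: mem_T)
    then show ?thesis using vy t by (simp add: prescribed_def)
  qed
  have hyp1: "y \<in> cone_hyp I t \<longleftrightarrow> y \<in> rspace J \<and> Poly_Mapping.lookup y (Some m) = prescribed t y" if "t \<in> B1" for t y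
    using that cone_hyp_prescribed by (cases t) (auto simp: B1_def)
  have "?E = rspace J \<inter> \<Inter>(B2 \<union> {{y \<in> rspace J. prescribed t y = prescribed t' y} | t t'. t \<in> B1 \<and> t' \<in> B1})"
  proof (intro subset_antisym subsetI)
    fix v assume "v \<in> ?E"
    then obtain y where v: "v \<in> rspace J" and y: "y \<in> Y" and vy: "\<And>u. u \<noteq> Some m \<Longrightarrow> Poly_Mapping.lookup v u = Poly_Mapping.lookup y u"
      by blast
    have yJ: "y \<in> rspace J" using y B by blast
    have "v \<in> H" if "H \<in> B2" for H using agree[of H v y] that v yJ vy y B by (auto simp: B2_def)
    moreover have "prescribed t v = prescribed t' v" if "t \<in> B1" "t' \<in> B1" for t t'
    proof -
      have "y \<in> cone_hyp I t" "y \<in> cone_hyp I t'" using that y B by (auto simp: B1_def)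
      then show ?thesis using that hyp1 presc[OF that(1) vy] presc[OF that(2) vy] by auto
    qed
    ultimately show "v \<in> rspace J \<inter> \<Inter>(B2 \<union> {{y \<in> rspace J. prescribed t y = prescribed t' y} | t t'. t \<in> B1 \<and> t' \<in> B1})"
      using v by blast
  next
    fix v assume v: "v \<in> rspace J \<inter> \<Inter>(B2 \<union> {{y \<in> rspace J. prescribed t y = prescribed t' y} | t t'. t \<in> B1 \<and> t' \<in> B1})"
    \<comment> \<open>All prescribed values agree at \<open>v\<close>, so any one of them serves; if
      no equation involves \<open>x_m\<close>, the value \<open>0\<close> is arbitrary.\<close>
    define s where "s = (if B1 = {} then 0 else prescribed (SOME t. t \<in> B1) v)"
    define y where "y = v + Poly_Mapping.single (Some m) (s - Poly_Mapping.lookup v (Some m))"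
    have vy: "Poly_Mapping.lookup v u = Poly_Mapping.lookup y u" if "u \<noteq> Some m" for u
      using that by (auto simp: y_def lookup_add lookup_single when_def)
    have ym: "Poly_Mapping.lookup y (Some m) = s" by (simp add: y_def lookup_add)
    have yJ: "y \<in> rspace J"
      using v m by (auto simp: y_def intro!: subspace_add[OF subspace_rspace]) (auto simp: rspace_def)
    have "y \<in> cone_hyp I t" if t: "t \<in> B1" for t
    proof -
      have "(SOME t. t \<in> B1) \<in> B1" using t by (rule someI)
      then have "v \<in> {y \<in> rspace J. prescribed t y = prescribed (SOME t. t \<in> B1) y}" using v t by blast
      then have "prescribed t v = s" using t by (auto simp: s_def)
      then show ?thesis using hyp1[OF t] yJ ym presc[OF t vy] by simp
    qed
    moreover have "y \<in> H" if "H \<in> B2" for H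
      using agree[of H v y] that v yJ vy B2_def by blast
    ultimately have "y \<in> Y" using yJ B(2) unfolding B12 by blast
    then show "v \<in> ?E" using v vy by blast
  qed
  also have "\<dots> \<in> flats_from (Suc m)"
  proof (rule flats_from_Inter)
    have "{y \<in> rspace J. prescribed t y = prescribed t' y} \<in> flats_from (Suc m)" if "t \<in> B1" "t' \<in> B1" for t t'
      using that by (intro prescribed_eq_flat) (auto simp: B1_def)
    then show "B2 \<union> {{y \<in> rspace J. prescribed t y = prescribed t' y} | t t'. t \<in> B1 \<and> t' \<in> B1} \<subseteq> flats_from (Suc m)"
      using hyps_from_flat unfolding B2_def by blast
  qed
  finally show ?thesis .
qed

text \<open>\<open>z\<close> is numbered last, so \<open>x_1, ..., x_l\<close> are eliminated in the
  order in which \<open>flats_from\<close> shrinks, and \<open>z\<close> never is.\<close>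

definition coord :: "nat \<Rightarrow> nat option" where
  "coord n = (if n = l + 1 then None else Some n)"

definition chain_flat :: "nat \<Rightarrow> (nat option \<Rightarrow>\<^sub>0 real) set" where
  "chain_flat m = {y \<in> rspace J. \<forall>n\<in>{m<..l + 1}. Poly_Mapping.lookup y (coord n) = 0}"

lemma rspace_J_eqI:
  assumes "v \<in> rspace J" "y \<in> rspace J" "\<And>n. n \<in> {0<..l + 1} \<Longrightarrow> Poly_Mapping.lookup v (coord n) = Poly_Mapping.lookup y (coord n)"
  shows "v = y"
proof (rule poly_mapping_eqI)
  fix u
  show "Poly_Mapping.lookup v u = Poly_Mapping.lookup y u"
  proof (cases "u \<in> J")
    case True
    have "\<exists>n\<in>{0<..l + 1}. u = coord n"
    proof (cases u)
      case None
      then show ?thesis by (intro bexI[of _ "l + 1"]) (auto simp: coord_def)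
    next
      case (Some x)
      then show ?thesis using True by (intro bexI[of _ x]) (auto simp: coord_def)
    qed
    then show ?thesis using assms(3) by blast
  next
    case False
    then show ?thesis using assms(1,2) by (simp add: lookup_rspace_0)
  qed
qed

text \<open>Adding the space of the first \<open>m\<close> coordinates means forgetting them, that
  is, \<open>m\<close> successive eliminations, each of which passes to the next
  \<open>flats_from\<close>.\<close>

lemma sum_chain_flat:
  assumes Y: "Y \<in> flats_from 1" and m: "m \<le> l"
  shows "{v \<in> rspace J. \<exists>y\<in>Y. \<forall>n\<in>{m<..l + 1}. Poly_Mapping.lookup v (coord n) = Poly_Mapping.lookup y (coord n)}
    \<in> flats_from (Suc m)"
  using m
proof (induction m)
  case 0
  have "Y \<subseteq> rspace J" using Y by (auto simp: flats_from_def)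
  then have "{v \<in> rspace J. \<exists>y\<in>Y. \<forall>n\<in>{0<..l + 1}. Poly_Mapping.lookup v (coord n) = Poly_Mapping.lookup y (coord n)} = Y"
    using rspace_J_eqI by blast
  then show ?case using Y by simp
next
  case (Suc m)
  let ?E = "\<lambda>m. {v \<in> rspace J. \<exists>y\<in>Y. \<forall>n\<in>{m<..l + 1}. Poly_Mapping.lookup v (coord n) = Poly_Mapping.lookup y (coord n)}"
  have "{v \<in> rspace J. \<exists>y\<in>?E m. \<forall>u. u \<noteq> Some (Suc m) \<longrightarrow> Poly_Mapping.lookup v u = Poly_Mapping.lookup y u} \<in> flats_from (Suc (Suc m))"
    using Suc by (intro eliminate_coordinate) auto
  also have "{v \<in> rspace J. \<exists>y\<in>?E m. \<forall>u. u \<noteq> Some (Suc m) \<longrightarrow> Poly_Mapping.lookup v u = Poly_Mapping.lookup y u} = ?E (Suc m)"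
  proof (intro subset_antisym subsetI)
    fix v assume "v \<in> {v \<in> rspace J. \<exists>y\<in>?E m. \<forall>u. u \<noteq> Some (Suc m) \<longrightarrow> Poly_Mapping.lookup v u = Poly_Mapping.lookup y u}"
    then obtain w y where v: "v \<in> rspace J" and vw: "\<And>u. u \<noteq> Some (Suc m) \<Longrightarrow> Poly_Mapping.lookup v u = Poly_Mapping.lookup w u"
      and y: "y \<in> Y" and wy: "\<And>n. n \<in> {m<..l + 1} \<Longrightarrow> Poly_Mapping.lookup w (coord n) = Poly_Mapping.lookup y (coord n)" by auto
    have "Poly_Mapping.lookup v (coord n) = Poly_Mapping.lookup y (coord n)" if "n \<in> {Suc m<..l + 1}" for n
    proof -
      have "coord n \<noteq> Some (Suc m)" using that by (auto simp: coord_def)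
      then show ?thesis using vw wy[of n] that by auto
    qed
    then show "v \<in> ?E (Suc m)" using v y by blast
  next
    fix v assume "v \<in> ?E (Suc m)"
    then obtain y where v: "v \<in> rspace J" and y: "y \<in> Y"
      and vy: "\<And>n. n \<in> {Suc m<..l + 1} \<Longrightarrow> Poly_Mapping.lookup v (coord n) = Poly_Mapping.lookup y (coord n)" by blast
    define w where "w = v + Poly_Mapping.single (Some (Suc m)) (Poly_Mapping.lookup y (Some (Suc m)) - Poly_Mapping.lookup v (Some (Suc m)))"
    have vw: "Poly_Mapping.lookup v u = Poly_Mapping.lookup w u" if "u \<noteq> Some (Suc m)" for u
      using that by (auto simp: w_def lookup_add lookup_single when_def)
    have wm: "Poly_Mapping.lookup w (Some (Suc m)) = Poly_Mapping.lookup y (Some (Suc m))" by (simp add: w_def lookup_add)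
    have wJ: "w \<in> rspace J"
      using v Suc.prems by (auto simp: w_def intro!: subspace_add[OF subspace_rspace]) (auto simp: rspace_def)
    have "Poly_Mapping.lookup w (coord n) = Poly_Mapping.lookup y (coord n)" if "n \<in> {m<..l + 1}" for n
    proof (cases "n = Suc m")
      case True
      then show ?thesis using wm Suc.prems by (simp add: coord_def)
    next
      case False
      then have "coord n \<noteq> Some (Suc m)" by (auto simp: coord_def)
      then show ?thesis using vw[of "coord n"] vy[of n] False that by auto
    qed
    then have "w \<in> ?E m" using wJ y by blast
    then show "v \<in> {v \<in> rspace J. \<exists>y\<in>?E m. \<forall>u. u \<noteq> Some (Suc m) \<longrightarrow> Poly_Mapping.lookup v u = Poly_Mapping.lookup y u}"
      using v vw by blast
  qed
  finally show ?case .
qed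

lemma chain_flat_top: "chain_flat (l + 1) = rspace J"
  by (simp add: chain_flat_def)

lemma chain_flat_sum_eq:
  assumes "Y \<subseteq> rspace J"
  shows "{x + y | x y. x \<in> chain_flat m \<and> y \<in> Y}
    = {v \<in> rspace J. \<exists>y\<in>Y. \<forall>n\<in>{m<..l + 1}. Poly_Mapping.lookup v (coord n) = Poly_Mapping.lookup y (coord n)}" (is "?L = ?R")
proof (intro subset_antisym subsetI)
  fix v assume "v \<in> ?L"
  then show "v \<in> ?R"
    using assms by (fastforce simp: chain_flat_def lookup_add intro: subspace_add[OF subspace_rspace])
next
  fix v assume "v \<in> ?R"
  then obtain y where v: "v \<in> rspace J" and y: "y \<in> Y"
    and vy: "\<And>n. n \<in> {m<..l + 1} \<Longrightarrow> Poly_Mapping.lookup v (coord n) = Poly_Mapping.lookup y (coord n)" by blast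
  have "v - y \<in> chain_flat m"
    using v y assms vy by (auto simp: chain_flat_def lookup_minus intro: rspace_diff)
  moreover have "v = (v - y) + y" by simp
  ultimately show "v \<in> ?L" using y by blast
qed

text \<open>Below the top this is the sum of \<open>chain_flat m\<close> with the flat
  \<open>{0}\<close>. The top, where \<open>z\<close> too would have to be eliminated, is the whole
  space.\<close>

lemma chain_flat_flat: "m \<le> l + 1 \<Longrightarrow> chain_flat m \<in> flats_from 1"
proof -
  assume m: "m \<le> l + 1"
  have z: "{0} \<in> flats_from 1"
  proof -
    have "rspace J \<inter> \<Inter>(hyps_from 1) \<in> flats_from 1" by (auto simp: flats_from_def)
    moreover have "rspace J \<inter> \<Inter>(hyps_from 1) = {0}"
    proof (intro subset_antisym subsetI)
      fix y assume y: "y \<in> rspace J \<inter> \<Inter>(hyps_from 1)"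
      then have "y \<in> infinity_hyp I" by (auto simp: hyps_from_def)
      then have n: "Poly_Mapping.lookup y None = 0" by (simp add: infinity_hyp_def)
      have "Poly_Mapping.lookup y (Some i) = 0" if "i \<in> {1..l}" for i
      proof -
        have "(i, 0, 0) \<in> T" using that by (simp add: mem_T)
        then have "y \<in> cone_hyp I (i, 0, 0)" using y that by (auto simp: hyps_from_def)
        moreover have "Poly_Mapping.lookup y (Some 0) = 0" using y by (intro lookup_rspace_0[of y J]) auto
        ultimately show ?thesis by (simp add: cone_hyp_def)
      qed
      then have "y = 0" using y n by (intro rspace_J_eqI) (auto simp: coord_def rspace_def)
      then show "y \<in> {0}" by simp
    next
      fix y :: "nat option \<Rightarrow>\<^sub>0 real" assume "y \<in> {0}"
      then show "y \<in> rspace J \<inter> \<Inter>(hyps_from 1)"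
        using subspace_hyp subspace_0 by (auto simp: rspace_def)
    qed
    ultimately show ?thesis by simp
  qed
  show ?thesis
  proof (cases "m = l + 1")
    case True
    then show ?thesis by (simp only: chain_flat_top rspace_flat)
  next
    case False
    have "chain_flat m = {v \<in> rspace J. \<exists>y\<in>{0}. \<forall>n\<in>{m<..l + 1}. Poly_Mapping.lookup v (coord n) = Poly_Mapping.lookup y (coord n)}"
      by (simp add: chain_flat_def)
    also have "\<dots> \<in> flats_from (Suc m)" using False m by (intro sum_chain_flat[OF z]) auto
    finally show ?thesis using flats_from_mono[of 1 "Suc m"] by auto
  qed
qed

lemma chain_flat_modular:
  assumes "m \<le> l + 1"
  shows "modular_flat (flats A) (chain_flat m)"
  unfolding flats_A
proof (rule modular_flat_if_sum_closed[OF chain_flat_flat[OF assms] subspace_flat flats_from_Int])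
  fix Y assume Y: "Y \<in> flats_from 1"
  then have YJ: "Y \<subseteq> rspace J" by (auto simp: flats_from_def)
  show "{x + y | x y. x \<in> chain_flat m \<and> y \<in> Y} \<in> flats_from 1"
  proof (cases "m = l + 1")
    case True
    have "{x + y | x y. x \<in> chain_flat m \<and> y \<in> Y} = rspace J"
      unfolding chain_flat_sum_eq[OF YJ] True using subspace_0[OF subspace_flat[OF Y]] by auto
    then show ?thesis by (simp only: rspace_flat)
  next
    case False
    then show ?thesis
      unfolding chain_flat_sum_eq[OF YJ]
      using sum_chain_flat[OF Y, of m] assms flats_from_mono[of 1 "Suc m"] by auto
  qed
qed

lemma chain_flat_mono: "m \<le> n \<Longrightarrow> chain_flat m \<subseteq> chain_flat n"
  by (auto simp: chain_flat_def)

text \<open>Consecutive members of the chain differ by one dimension. For the least \<open>m\<close>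
  with \<open>Y \<subseteq> chain_flat m\<close>, a vector of \<open>Y\<close> whose coordinate
  number \<open>m\<close> is nonzero fills, together with \<open>chain_flat (m - 1)\<close>, all of
  \<open>chain_flat m\<close>. This yields maximality of the chain.\<close>

lemma comparable_flat_in_chain:
  assumes Y: "Y \<in> flats_from 1" and comp: "\<And>m. m \<le> l + 1 \<Longrightarrow> Y \<subseteq> chain_flat m \<or> chain_flat m \<subseteq> Y"
  shows "\<exists>m\<le>l + 1. Y = chain_flat m"
proof -
  define m where "m = (LEAST m. Y \<subseteq> chain_flat m)"
  have top: "Y \<subseteq> chain_flat (l + 1)" using Y unfolding chain_flat_top by (auto simp: flats_from_def)
  then have Ym: "Y \<subseteq> chain_flat m" unfolding m_def by (rule LeastI)
  have ml: "m \<le> l + 1" unfolding m_def by (rule Least_le) (rule top)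
  note sub = subspace_flat[OF Y]
  have "chain_flat m \<subseteq> Y"
  proof (cases m)
    case 0
    have "v = 0" if "v \<in> chain_flat 0" for v
      using that by (intro rspace_J_eqI) (auto simp: chain_flat_def rspace_def)
    then show ?thesis using subspace_0[OF sub] 0 by auto
  next
    case (Suc n)
    have not: "\<not> Y \<subseteq> chain_flat n" using not_less_Least[of n "\<lambda>m. Y \<subseteq> chain_flat m"] Suc unfolding m_def by simp
    then have nY: "chain_flat n \<subseteq> Y" using comp[of n] Suc ml by auto
    have step: "{n<..l + 1} = insert m {m<..l + 1}" using Suc ml by auto
    obtain y where y: "y \<in> Y" "Poly_Mapping.lookup y (coord m) \<noteq> 0"
      using not Ym unfolding chain_flat_def step by blast
    show ?thesis
    proof
      fix v assume v: "v \<in> chain_flat m"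
      let ?r = "Poly_Mapping.lookup v (coord m) / Poly_Mapping.lookup y (coord m)"
      have "y \<in> chain_flat m" using y Ym by blast
      then have "v - ?r *\<^sub>R y \<in> chain_flat n"
        using v y(2) unfolding chain_flat_def step
        by (auto simp: lookup_minus lookup_scaleR intro!: rspace_diff rspace_scaleR)
      then have "(v - ?r *\<^sub>R y) + ?r *\<^sub>R y \<in> Y"
        using nY y(1) sub by (intro subspace_add subspace_scale) auto
      then show "v \<in> Y" by simp
    qed
  qed
  then show ?thesis using Ym ml by blast
qed

theorem supersolvable_edgeless: "supersolvable A"
  unfolding supersolvable_def
proof (intro conjI exI[of _ "chain_flat ` {..l + 1}"] ballI)
  show "central A" by (rule central_cone_gain_arr[OF gains_edgeless])
  show "modular_flat (flats A) X" if "X \<in> chain_flat ` {..l + 1}" for X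
    using that chain_flat_modular by auto
  have chain: "subset.chain (flats A) (chain_flat ` {..l + 1})"
    unfolding subset_chain_def flats_A
  proof (intro conjI ballI)
    show "chain_flat ` {..l + 1} \<subseteq> flats_from 1" using chain_flat_flat by auto
    fix X Y assume "X \<in> chain_flat ` {..l + 1}" "Y \<in> chain_flat ` {..l + 1}"
    then obtain m n where "X = chain_flat m" "Y = chain_flat n" by blast
    then show "X \<subseteq> Y \<or> Y \<subseteq> X"
      using chain_flat_mono[of m n] chain_flat_mono[of n m] by (cases "m \<le> n") auto
  qed
  moreover have "S = chain_flat ` {..l + 1}" if S: "subset.chain (flats A) S" "chain_flat ` {..l + 1} \<subseteq> S" for S
  proof (intro subset_antisym S(2) subsetI)
    fix Y assume YS: "Y \<in> S"
    have "Y \<in> flats_from 1" using S(1) YS unfolding subset_chain_def flats_A by blast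
    moreover have "Y \<subseteq> chain_flat m \<or> chain_flat m \<subseteq> Y" if "m \<le> l + 1" for m
      using S YS that unfolding subset_chain_def by blast
    ultimately obtain m where "m \<le> l + 1" "Y = chain_flat m" using comparable_flat_in_chain by blast
    then show "Y \<in> chain_flat ` {..l + 1}" by blast
  qed
  ultimately show "subset.maxchain (flats A) (chain_flat ` {..l + 1})"
    unfolding subset.maxchain_def by blast
qed

end

section \<open>The Catalan arrangement\<close>

lemma lookup_map_key_Inl: "Poly_Mapping.lookup (Poly_Mapping.map_key Inl x) i = Poly_Mapping.lookup x (Inl i)"
  by (simp add: map_key.rep_eq)

lemma gain_hyp_swap: "gain_hyp I (i, j, c) = gain_hyp I (j, i, - c)"
  by (auto simp: gain_hyp_def)

text \<open>The coordinate of \<open>Phi1\<close> becomes the one with index \<open>l + 1\<close>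
  and is added to all others. Differences are unchanged, while a weight \<open>x_i = c\<close> turns
  into \<open>x_i - x_(l+1) = c\<close>; the equivalence is even linear.\<close>

definition shear :: "nat \<Rightarrow> (nat + unit \<Rightarrow>\<^sub>0 real) \<Rightarrow> nat \<Rightarrow>\<^sub>0 real" where
  "shear l x = (\<Sum>i\<in>{1..l + 1}. Poly_Mapping.single i
     ((if i = l + 1 then 0 else Poly_Mapping.lookup x (Inl i)) + Poly_Mapping.lookup x (Inr ())))"

definition unshear :: "nat \<Rightarrow> (nat \<Rightarrow>\<^sub>0 real) \<Rightarrow> nat + unit \<Rightarrow>\<^sub>0 real" where
  "unshear l y = (\<Sum>u\<in>{1..l} <+> UNIV. Poly_Mapping.single u
     (case u of Inl i \<Rightarrow> Poly_Mapping.lookup y i - Poly_Mapping.lookup y (l + 1) | Inr _ \<Rightarrow> Poly_Mapping.lookup y (l + 1)))"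

lemma lookup_shear: "Poly_Mapping.lookup (shear l x) i = (if i \<in> {1..l + 1}
    then (if i = l + 1 then 0 else Poly_Mapping.lookup x (Inl i)) + Poly_Mapping.lookup x (Inr ()) else 0)"
  unfolding shear_def by (rule lookup_sum_single) simp

lemma lookup_unshear: "Poly_Mapping.lookup (unshear l y) u = (if u \<in> {1..l} <+> UNIV
    then (case u of Inl i \<Rightarrow> Poly_Mapping.lookup y i - Poly_Mapping.lookup y (l + 1) | Inr _ \<Rightarrow> Poly_Mapping.lookup y (l + 1)) else 0)"
  unfolding unshear_def by (rule lookup_sum_single) simp

lemma affinely_equivalent_Cat:
  assumes l: "1 \<le> l"
  shows "affinely_equivalent (arr_prod (wdig_arr (C_dig l 1)) Phi1) (Cat (l + 1))"
  unfolding affinely_equivalent_def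
proof (intro exI conjI)
  let ?K = "{1..l} <+> (UNIV :: unit set)" and ?T = "CD_gains l 1 {1..l} 0"
  have arr: "wdig_arr (C_dig l 1) = gain_arr {1..l} ?T" using wdig_arr_C[of 1 l] l by simp
  have coords: "coords (arr_prod (wdig_arr (C_dig l 1)) Phi1) = ?K"
    unfolding arr by (simp add: arr_prod_def Phi1_def)
  have hyps: "hyps (arr_prod (wdig_arr (C_dig l 1)) Phi1)
      = (\<lambda>t. {x \<in> rspace ?K. Poly_Mapping.map_key Inl x \<in> gain_hyp {1..l} t}) ` ?T"
    unfolding arr by (auto simp: arr_prod_def Phi1_def)
  have Cat: "coords (Cat (l + 1)) = {1..l + 1}" "hyps (Cat (l + 1)) = gain_hyp {1..l + 1} ` Cat_gains (l + 1)"
    by (simp_all add: Cat_eq_gain_arr)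
  show "linear (shear l)"
    by (rule linearI; rule poly_mapping_eqI) (simp_all add: lookup_shear lookup_add lookup_scaleR algebra_simps)
  have us: "unshear l (shear l x) = x" if "x \<in> rspace ?K" for x
  proof (rule poly_mapping_eqI)
    fix u
    show "Poly_Mapping.lookup (unshear l (shear l x)) u = Poly_Mapping.lookup x u"
    proof (cases "u \<in> ?K")
      case True
      then show ?thesis by (cases u) (auto simp: lookup_unshear lookup_shear)
    next
      case False
      then show ?thesis using lookup_rspace_0[OF that False] by (simp only: lookup_unshear if_False)
    qed
  qed
  have su: "shear l (unshear l y) = y" if "y \<in> rspace {1..l + 1}" for y
  proof (rule poly_mapping_eqI)
    fix i
    show "Poly_Mapping.lookup (shear l (unshear l y)) i = Poly_Mapping.lookup y i"
      using that lookup_rspace_0[of y "{1..l + 1}" i] by (auto simp: lookup_unshear lookup_shear)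
  qed
  have sh: "shear l x \<in> rspace {1..l + 1}" for x
    by (auto simp: rspace_def in_keys_iff lookup_shear split: if_splits)
  have ush: "unshear l y \<in> rspace ?K" for y
    by (auto simp: rspace_def in_keys_iff lookup_unshear split: if_splits)
  have bij: "bij_betw (shear l) (rspace ?K) (rspace {1..l + 1})"
    by (rule bij_betw_byWitness[where f' = "unshear l"]) (use us su sh ush in auto)
  then show "bij_betw (\<lambda>x. shear l x + 0) (ambient (arr_prod (wdig_arr (C_dig l 1)) Phi1)) (ambient (Cat (l + 1)))"
    unfolding coords Cat by simp
  \<comment> \<open>The virtual index \<open>0\<close> becomes the genuine index
    \<open>l + 1\<close>.\<close>
  define up :: "nat \<times> nat \<times> int \<Rightarrow> nat \<times> nat \<times> int" where
    "up = (\<lambda>(i, j, c). (i, if j = 0 then l + 1 else j, c))"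
  have img: "(\<lambda>x. shear l x + 0) ` {x \<in> rspace ?K. Poly_Mapping.map_key Inl x \<in> gain_hyp {1..l} t} = gain_hyp {1..l + 1} (up t)"
    if t: "t \<in> ?T" for t
  proof -
    obtain i j c where tt: "t = (i, j, c)" by (cases t)
    have i: "i \<in> {1..l}" and j: "j = 0 \<or> j \<in> {1..l}"
      using t l unfolding tt CD_gains_def by auto
    have key: "Poly_Mapping.map_key Inl x \<in> gain_hyp {1..l} t \<longleftrightarrow> shear l x \<in> gain_hyp {1..l + 1} (up t)"
      if x: "x \<in> rspace ?K" for x
    proof -
      have "Poly_Mapping.map_key Inl x \<in> rspace {1..l}"
        using x by (auto simp: rspace_def keys_map_key)
      moreover have "Poly_Mapping.lookup x (Inl 0) = 0" using x by (rule lookup_rspace_0) auto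
      ultimately show ?thesis
        using i j sh[of x] by (auto simp: tt up_def gain_hyp_def lookup_map_key_Inl lookup_shear)
    qed
    have "gain_hyp {1..l + 1} (up t) \<subseteq> rspace {1..l + 1}" by (auto simp: gain_hyp_def up_def tt)
    then have "gain_hyp {1..l + 1} (up t) \<subseteq> shear l ` rspace ?K" using bij unfolding bij_betw_def by blast
    then show ?thesis using key by (auto simp: image_iff)
  qed
  have "(\<lambda>H. (\<lambda>x. shear l x + 0) ` H) ` hyps (arr_prod (wdig_arr (C_dig l 1)) Phi1) = gain_hyp {1..l + 1} ` up ` ?T"
    unfolding hyps image_image by (rule image_cong[OF refl]) (rule img)
  also have "\<dots> = gain_hyp {1..l + 1} ` Cat_gains (l + 1)"
  proof (intro subset_antisym image_subsetI)
    fix t assume "t \<in> up ` ?T"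
    then obtain i j c where t: "(i, j, c) \<in> ?T" "t = up (i, j, c)" by auto
    \<comment> \<open>An edge with \<open>i > j\<close> appears in \<open>Cat_gains\<close> with
      reversed orientation and offset \<open>-1\<close>.\<close>
    have "t \<in> Cat_gains (l + 1) \<or> (\<exists>i j c. t = (i, j, c) \<and> (j, i, - c) \<in> Cat_gains (l + 1))"
      using t by (auto simp: CD_gains_def up_def Cat_gains_def)
    then show "gain_hyp {1..l + 1} t \<in> gain_hyp {1..l + 1} ` Cat_gains (l + 1)"
      using gain_hyp_swap by (metis image_eqI)
  next
    fix t assume "t \<in> Cat_gains (l + 1)"
    then obtain i j c where t: "t = (i, j, c)" "1 \<le> i" "i < j" "j \<le> l + 1" "c = -1 \<or> c = 0 \<or> c = 1"
      by (auto simp: Cat_gains_def)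
    have mem: "gain_hyp {1..l + 1} s \<in> gain_hyp {1..l + 1} ` up ` ?T" if "s' \<in> ?T" "s = up s'" for s s'
      using that by blast
    consider "j = l + 1" | "j \<le> l" "c = 0" | "j \<le> l" "c = 1" | "j \<le> l" "c = -1" using t by linarith
    then show "gain_hyp {1..l + 1} t \<in> gain_hyp {1..l + 1} ` up ` ?T"
    proof cases
      case 1
      then show ?thesis using t by (intro mem[of "(i, 0, c)"]) (auto simp: CD_gains_def up_def)
    next
      case 2
      then show ?thesis using t by (intro mem[of "(i, j, 0)"]) (auto simp: CD_gains_def up_def)
    next
      case 3
      then show ?thesis using t by (intro mem[of "(i, j, 1)"]) (auto simp: CD_gains_def up_def)
    next
      case 4
      then have "gain_hyp {1..l + 1} t = gain_hyp {1..l + 1} (j, i, 1)" using t gain_hyp_swap by simp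
      also have "\<dots> \<in> gain_hyp {1..l + 1} ` up ` ?T"
        using 4 t by (intro mem[of "(j, i, 1)"]) (auto simp: CD_gains_def up_def)
      finally show ?thesis .
    qed
  qed
  finally show "(\<lambda>H. (\<lambda>x. shear l x + 0) ` H) ` hyps (arr_prod (wdig_arr (C_dig l 1)) Phi1) = hyps (Cat (l + 1))"
    unfolding Cat .
qed

section \<open>The eliminations\<close>

lemma coking_elim_C:
  assumes "1 \<le> k" "k < l"
  shows "apply_on {k..l} (coking_elim k) (C_dig l k) = D_dig l k"
proof -
  let ?f = "coking_elim k (induced (C_dig l k) {k..l})"
  have "edges ?f \<union> (edges (C_dig l k) - {k..l} \<times> {k..l}) = edges (D_dig l k)"
    using assms by (auto simp: coking_elim_def induced_def C_dig_def D_dig_def)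
  moreover have "(\<lambda>i. if i \<in> {k..l} then weight ?f i else weight (C_dig l k) i) = weight (D_dig l k)"
    using assms by (auto simp: fun_eq_iff coking_elim_def induced_def C_dig_def D_dig_def min_def)
  ultimately show ?thesis
    unfolding apply_on_def by (simp add: C_dig_def D_dig_def)
qed

lemma king_elim_D:
  assumes "1 \<le> k" "k < l"
  shows "apply_on {k..l} (king_elim k) (D_dig l k) = C_dig l (k + 1)"
proof -
  let ?f = "king_elim k (induced (D_dig l k) {k..l})"
  have "edges ?f \<union> (edges (D_dig l k) - {k..l} \<times> {k..l}) = edges (C_dig l (k + 1))"
    using assms by (auto simp: king_elim_def induced_def C_dig_def D_dig_def)
  moreover have "(\<lambda>i. if i \<in> {k..l} then weight ?f i else weight (D_dig l k) i) = weight (C_dig l (k + 1))"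
    using assms by (auto simp: fun_eq_iff king_elim_def induced_def C_dig_def D_dig_def min_def)
  ultimately show ?thesis
    unfolding apply_on_def by (simp add: C_dig_def D_dig_def)
qed

lemma fold_eliminations:
  assumes "1 \<le> m" "m \<le> l"
  shows "fold (\<lambda>k G. apply_on {k..l} (king_elim k) (apply_on {k..l} (coking_elim k) G)) [1..<m] (C_dig l 1) = C_dig l m"
  using assms
proof (induction m rule: nat_induct_at_least)
  case (Suc m)
  then show ?case using coking_elim_C[of m l] king_elim_D[of m l] by simp
qed simp

theorem theorem4p18:
  shows
    "(\<forall>l::nat. 1 \<le> l \<longrightarrow>
        (\<forall>k\<in>{1..l-1}.
            coking (induced (C_dig l k) {k..l}) k
          \<and> (\<forall>i\<in>{1..k-1}. isolated (C_dig l k) i)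
          \<and> apply_on {k..l} (coking_elim k) (C_dig l k) = D_dig l k
          \<and> king (induced (D_dig l k) {k..l}) k
          \<and> (\<forall>i\<in>{1..k-1}. isolated (D_dig l k) i)
          \<and> apply_on {k..l} (king_elim k) (D_dig l k) = C_dig l (k+1)
          \<and> arr_char_poly (wdig_arr (C_dig l k)) = arr_char_poly (wdig_arr (D_dig l k))
          \<and> arr_char_poly (wdig_arr (D_dig l k)) = arr_char_poly (wdig_arr (C_dig l (k+1)))
          \<and> (free_arrangement (arr_cone (wdig_arr (C_dig l k)))
               \<longleftrightarrow> free_arrangement (arr_cone (wdig_arr (D_dig l k))))
          \<and> (free_arrangement (arr_cone (wdig_arr (D_dig l k)))
               \<longleftrightarrow> free_arrangement (arr_cone (wdig_arr (C_dig l (k+1))))))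
      \<and> affinely_equivalent (arr_prod (wdig_arr (C_dig l 1)) Phi1) (Cat (l+1))
      \<and> fold (\<lambda>k G. apply_on {k..l} (king_elim k) (apply_on {k..l} (coking_elim k) G)) [1..<l]
          (C_dig l 1) = C_dig l l
      \<and> edges (C_dig l l) = {}
      \<and> supersolvable (arr_cone (wdig_arr (C_dig l l))))
    \<and> (\<forall>n::nat. 2 \<le> n \<longrightarrow>
        free_with_exponents (arr_cone (Cat n)) ({#0, 1#} + mset_set {n+1..2*n-1}))"
proof (intro conjI allI impI ballI, goal_cases)
  case (1 l k)
  then show ?case by (auto simp: coking_def induced_def C_dig_def)
next
  case (2 l k i)
  then show ?case by (auto simp: isolated_def C_dig_def)
next
  case (3 l k)
  then show ?case by (intro coking_elim_C) auto
next
  case (4 l k)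
  then show ?case by (auto simp: king_def induced_def D_dig_def)
next
  case (5 l k i)
  then show ?case by (auto simp: isolated_def D_dig_def)
next
  case (6 l k)
  then show ?case by (intro king_elim_D) auto
next
  case (7 l k)
  then have k: "1 \<le> k" "k \<le> l" by auto
  show ?case
    unfolding wdig_arr_C[OF k] wdig_arr_D[OF k] by (rule char_poly_CD_eq[OF CD_C[OF k] CD_D[OF k]])
next
  case (8 l k)
  then have k: "1 \<le> k" "k \<le> l" and k': "1 \<le> k + 1" "k + 1 \<le> l" by auto
  show ?case
    unfolding wdig_arr_C[OF k'] wdig_arr_D[OF k] by (rule char_poly_CD_eq[OF CD_D[OF k] CD_C[OF k']])
next
  case (9 l k)
  then have k: "1 \<le> k" "k \<le> l" by auto
  show ?case
    unfolding wdig_arr_C[OF k] wdig_arr_D[OF k]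
    using CD.free_cone_CD[OF CD_C[OF k]] CD.free_cone_CD[OF CD_D[OF k]] by blast
next
  case (10 l k)
  then have k: "1 \<le> k" "k \<le> l" and k': "1 \<le> k + 1" "k + 1 \<le> l" by auto
  show ?case
    unfolding wdig_arr_C[OF k'] wdig_arr_D[OF k]
    using CD.free_cone_CD[OF CD_D[OF k]] CD.free_cone_CD[OF CD_C[OF k']] by blast
next
  case (11 l)
  then show ?case by (rule affinely_equivalent_Cat)
next
  case (12 l)
  then show ?case by (intro fold_eliminations) auto
next
  case (13 l)
  show ?case by (auto simp: C_dig_def)
next
  case (14 l)
  then interpret edgeless l by unfold_locales
  show ?case using supersolvable_edgeless unfolding T_def wdig_arr_C[OF 14 order.refl] .
next
  case (15 n)
  then show ?case by (intro free_cone_Cat) simp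
qed

end
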